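(* Let $X$ be an operator space whose generated TRO $T$ is finite dimensional, such that every irreducible representation of $T$ is a boundary representation for $X$. Then $X$ is rectangular hyperrigid (in $T$).
   Context: Hilbert spaces are complex and nonzero. A ternary ring of operators (TRO) is a norm closed subspace $T\subset B(H_0,K_0)$ with $xy^*z\in T$ for all $x,y,z\in T$. A triple morphism is a linear map $\theta$ between TROs with $\theta(xy^*z)=\theta(x)\theta(y)^*\theta(z)$; a representation of $T$ is a triple morphism $\theta:T\to B(H,K)$ for Hilbert spaces $H,K$; it is faithful if injective (equivalently completely isometric). It is irreducible if, whenever $p\in B(H)$, $q\in B(K)$ are projections with $q\theta(t)=\theta(t)p$ for all $t\in T$, either $p=0,q=0$ or $p=1,q=1$. A linear map $\phi$ into $B(H,K)$ is nondegenerate if, whenever $p\in B(H)$, $q\in B(K)$ are projections with $q\phi(x)=\phi(x)p=0$ for all $x$ in the domain, one has $p=0$ and $q=0$. A rectangular operator state on an operator space is a nondegenerate completely contractive linear map into some $B(H,K)$ with completely bounded norm $1$. If $X$ generates $T$, a rectangular operator state $\phi$ on $X$ has the unique extension property if any rectangular operator state of $T$ whose restriction to $X$ is $\phi$ is automatically a triple morphism. It is a boundary representation for $X$ if it has the unique extension property and its unique extension to $T$ is irreducible. A representation $\pi$ of $T$ is called a boundary representation for $X$ if $\pi|_X$ is a boundary representation for $X$. A generating set $G$ of a TRO $T$ (finite or countable, or a generating operator space $G=X$) is rectangular hyperrigid if for every faithful nondegenerate representation $\pi:T\to B(H,K)$, identifying $T$ with $\pi(T)\subset B(H,K)$, and every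 sequence of completely contractive maps $\phi_n:B(H,K)\to B(H,K)$ with $\|\phi_n\|_{cb}=1$, $n=1,2,\dots$: if $\lim_n\|\phi_n(g)-g\|=0$ for all $g\in G$, then $\lim_n\|\phi_n(t)-t\|=0$ for all $t\in T$. *)

theory Defs
  imports "HOL-Analysis.Analysis"
begin

text \<open>
  Complex Hilbert spaces, on top of the real inner product space obtained by taking real parts.
  The complex inner product is linear in the first variable.
\<close>

class chilbert_space = real_inner + complete_space +
  fixes scaleC :: "complex \<Rightarrow> 'a \<Rightarrow> 'a"  (infixr \<open>*\<^sub>C\<close> 75)
    and cinner :: "'a \<Rightarrow> 'a \<Rightarrow> complex"
  assumes scaleC_add_right: "c *\<^sub>C (x + y) = c *\<^sub>C x + c *\<^sub>C y"
    and scaleC_add_left: "(c + d) *\<^sub>C x = c *\<^sub>C x + d *\<^sub>C x"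
    and scaleC_scaleC: "c *\<^sub>C (d *\<^sub>C x) = (c * d) *\<^sub>C x"
    and scaleC_of_real: "complex_of_real r *\<^sub>C x = r *\<^sub>R x"
    and cinner_add_left: "cinner (x + y) z = cinner x z + cinner y z"
    and cinner_scaleC_left: "cinner (c *\<^sub>C x) y = c * cinner x y"
    and cinner_commute: "cinner y x = cnj (cinner x y)"
    and Re_cinner: "Re (cinner x y) = inner x y"

lemma scaleC_one: "1 *\<^sub>C (x :: 'a::chilbert_space) = x"
  using scaleC_of_real[of 1 x] by simp

global_interpretation cvec: vector_space "scaleC :: complex \<Rightarrow> 'a::chilbert_space \<Rightarrow> 'a"
  by unfold_locales (simp_all add: scaleC_add_right scaleC_add_left scaleC_scaleC scaleC_one)

lemma norm_scaleC: "norm (c *\<^sub>C (x :: 'a::chilbert_space)) = cmod c * norm x"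
proof -
  have norm_sq: "of_real ((norm z)\<^sup>2) = cinner z z" for z :: 'a
    using Re_cinner[of z z] cinner_commute[of z z]
    by (simp add: complex_eq_iff power2_norm_eq_inner)
  have right: "cinner (c *\<^sub>C x) (c *\<^sub>C x) = c * cnj c * cinner x x"
    using cinner_commute[of x "c *\<^sub>C x"] cinner_commute[of x x]
    by (simp add: cinner_scaleC_left)
  have "complex_of_real ((norm (c *\<^sub>C x))\<^sup>2) = of_real ((cmod c * norm x)\<^sup>2)"
    unfolding norm_sq right
    by (simp add: power_mult_distrib norm_sq[symmetric] flip: complex_norm_square)
  then have "(norm (c *\<^sub>C x))\<^sup>2 = (cmod c * norm x)\<^sup>2"
    using of_real_eq_iff by blast
  then show ?thesis
    by (simp add: power2_eq_iff_nonneg)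
qed

lemma bounded_linear_scaleC: "bounded_linear (\<lambda>x :: 'a::chilbert_space. c *\<^sub>C x)"
proof (rule bounded_linear_intro[where K = "cmod c"])
  fix r and x :: 'a
  show "c *\<^sub>C (r *\<^sub>R x) = r *\<^sub>R (c *\<^sub>C x)"
    by (simp flip: scaleC_of_real add: scaleC_scaleC mult.commute)
qed (simp_all add: scaleC_add_right norm_scaleC mult.commute)

text \<open>
  Since types cannot be quantified over inside a formula, a Hilbert space is a nonzero closed
  complex subspace of an arbitrary type of class \<open>chilbert_space\<close>. Taking the whole type as the
  subspace gives the Hilbert spaces that are types.
\<close>

definition hilbert :: "'a::chilbert_space set \<Rightarrow> bool" where
  "hilbert H \<longleftrightarrow> cvec.subspace H \<and> closed H \<and> H \<noteq> {0}"

text \<open>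
  \<open>B(H,K)\<close> for closed subspaces \<open>H\<close> and \<open>K\<close>: every operator from \<open>H\<close> to \<open>K\<close> is extended by zero on
  the orthogonal complement of \<open>H\<close>. This keeps linear structure, products, adjoints and
  (matrix) norms. The library type of operators consists of real-linear ones, hence the condition
  of complex homogeneity.
\<close>

definition Bop :: "'a::chilbert_space set \<Rightarrow> 'b::chilbert_space set \<Rightarrow> ('a \<Rightarrow>\<^sub>L 'b) set" where
  "Bop H K = {A. (\<forall>c x. blinfun_apply A (c *\<^sub>C x) = c *\<^sub>C blinfun_apply A x) \<and>
                 (\<forall>x. blinfun_apply A x \<in> K) \<and>
                 (\<forall>x. (\<forall>h\<in>H. cinner x h = 0) \<longrightarrow> blinfun_apply A x = 0)}"

definition cscale :: "complex \<Rightarrow> ('a::chilbert_space \<Rightarrow>\<^sub>L 'b::chilbert_space) \<Rightarrow> 'a \<Rightarrow>\<^sub>L 'b" where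
  "cscale c A = Blinfun (\<lambda>x. c *\<^sub>C x) o\<^sub>L A"

lemma cscale_apply: "blinfun_apply (cscale c A) x = c *\<^sub>C blinfun_apply A x"
  by (simp add: cscale_def bounded_linear_Blinfun_apply[OF bounded_linear_scaleC])

global_interpretation cop: vector_space
  "cscale :: complex \<Rightarrow> ('a::chilbert_space \<Rightarrow>\<^sub>L 'b::chilbert_space) \<Rightarrow> 'a \<Rightarrow>\<^sub>L 'b"
  by unfold_locales
    (rule blinfun_eqI, simp add: cscale_apply blinfun.add_left scaleC_add_right scaleC_add_left
      scaleC_scaleC scaleC_one)+

text \<open>
  By the Riesz representation theorem the adjoint exists (uniquely) for every complex-linear
  bounded operator, in particular for the elements of \<open>Bop H K\<close>; it then lies in \<open>Bop K H\<close>.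
\<close>

definition adj :: "('a::chilbert_space \<Rightarrow>\<^sub>L 'b::chilbert_space) \<Rightarrow> 'b \<Rightarrow>\<^sub>L 'a" where
  "adj A = (THE B. \<forall>x y. cinner (blinfun_apply A x) y = cinner x (blinfun_apply B y))"

definition projections :: "'a::chilbert_space set \<Rightarrow> ('a \<Rightarrow>\<^sub>L 'a) set" where
  "projections H = {p \<in> Bop H H. p o\<^sub>L p = p \<and> adj p = p}"

definition triple ::
    "('a::chilbert_space \<Rightarrow>\<^sub>L 'b::chilbert_space) \<Rightarrow> ('a \<Rightarrow>\<^sub>L 'b) \<Rightarrow> ('a \<Rightarrow>\<^sub>L 'b) \<Rightarrow> 'a \<Rightarrow>\<^sub>L 'b" where
  "triple x y z = x o\<^sub>L adj y o\<^sub>L z"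

definition operator_space ::
    "'a::chilbert_space set \<Rightarrow> 'b::chilbert_space set \<Rightarrow> ('a \<Rightarrow>\<^sub>L 'b) set \<Rightarrow> bool" where
  "operator_space H K X \<longleftrightarrow> X \<subseteq> Bop H K \<and> cop.subspace X"

definition tro ::
    "'a::chilbert_space set \<Rightarrow> 'b::chilbert_space set \<Rightarrow> ('a \<Rightarrow>\<^sub>L 'b) set \<Rightarrow> bool" where
  "tro H K T \<longleftrightarrow> T \<subseteq> Bop H K \<and> cop.subspace T \<and> closed T \<and>
     (\<forall>x\<in>T. \<forall>y\<in>T. \<forall>z\<in>T. triple x y z \<in> T)"

definition generated_tro ::
    "'a::chilbert_space set \<Rightarrow> 'b::chilbert_space set \<Rightarrow> ('a \<Rightarrow>\<^sub>L 'b) set \<Rightarrow> ('a \<Rightarrow>\<^sub>L 'b) set" where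
  "generated_tro H K G = \<Inter>{S. tro H K S \<and> G \<subseteq> S}"

definition finite_dimensional :: "('a::chilbert_space \<Rightarrow>\<^sub>L 'b::chilbert_space) set \<Rightarrow> bool" where
  "finite_dimensional T \<longleftrightarrow> (\<exists>B. finite B \<and> T \<subseteq> cop.span B)"

text \<open>
  Maps on a set \<open>X\<close> of operators are functions on the ambient type of operators; all notions below
  depend only on the values on \<open>X\<close>, so the restriction of a map on \<open>T\<close> to \<open>X\<close> is that same function.
\<close>

definition linear_map ::
    "('a::chilbert_space \<Rightarrow>\<^sub>L 'b::chilbert_space) set
      \<Rightarrow> 'c::chilbert_space set \<Rightarrow> 'd::chilbert_space set
      \<Rightarrow> (('a \<Rightarrow>\<^sub>L 'b) \<Rightarrow> ('c \<Rightarrow>\<^sub>L 'd)) \<Rightarrow> bool" where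
  "linear_map X H K \<phi> \<longleftrightarrow> (\<forall>x\<in>X. \<phi> x \<in> Bop H K) \<and>
     (\<forall>x\<in>X. \<forall>y\<in>X. \<phi> (x + y) = \<phi> x + \<phi> y) \<and>
     (\<forall>c. \<forall>x\<in>X. \<phi> (cscale c x) = cscale c (\<phi> x))"

text \<open>The norm of an \<open>n \<times> n\<close> matrix of operators, acting between \<open>n\<close>-fold Hilbert sums.\<close>

definition mat_norm :: "nat \<Rightarrow> (nat \<Rightarrow> nat \<Rightarrow> 'a::chilbert_space \<Rightarrow>\<^sub>L 'b::chilbert_space) \<Rightarrow> real" where
  "mat_norm n A =
     Sup {L2_set (\<lambda>i. norm (\<Sum>j<n. blinfun_apply (A i j) (\<xi> j))) {..<n} | \<xi>.
          L2_set (\<lambda>j. norm (\<xi> j)) {..<n} \<le> 1}"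

definition amplification_norm ::
    "nat \<Rightarrow> ('a::chilbert_space \<Rightarrow>\<^sub>L 'b::chilbert_space) set
      \<Rightarrow> (('a \<Rightarrow>\<^sub>L 'b) \<Rightarrow> ('c::chilbert_space \<Rightarrow>\<^sub>L 'd::chilbert_space)) \<Rightarrow> ereal" where
  "amplification_norm n X \<phi> =
     (SUP A \<in> {A. (\<forall>i<n. \<forall>j<n. A i j \<in> X) \<and> mat_norm n A \<le> 1}.
        ereal (mat_norm n (\<lambda>i j. \<phi> (A i j))))"

definition cb_norm ::
    "('a::chilbert_space \<Rightarrow>\<^sub>L 'b::chilbert_space) set
      \<Rightarrow> (('a \<Rightarrow>\<^sub>L 'b) \<Rightarrow> ('c::chilbert_space \<Rightarrow>\<^sub>L 'd::chilbert_space)) \<Rightarrow> ereal" where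
  "cb_norm X \<phi> = (SUP n. amplification_norm n X \<phi>)"

definition completely_contractive ::
    "('a::chilbert_space \<Rightarrow>\<^sub>L 'b::chilbert_space) set
      \<Rightarrow> (('a \<Rightarrow>\<^sub>L 'b) \<Rightarrow> ('c::chilbert_space \<Rightarrow>\<^sub>L 'd::chilbert_space)) \<Rightarrow> bool" where
  "completely_contractive X \<phi> \<longleftrightarrow> cb_norm X \<phi> \<le> 1"

definition nondegenerate ::
    "('a::chilbert_space \<Rightarrow>\<^sub>L 'b::chilbert_space) set
      \<Rightarrow> 'c::chilbert_space set \<Rightarrow> 'd::chilbert_space set
      \<Rightarrow> (('a \<Rightarrow>\<^sub>L 'b) \<Rightarrow> ('c \<Rightarrow>\<^sub>L 'd)) \<Rightarrow> bool" where
  "nondegenerate X H K \<phi> \<longleftrightarrow>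
     (\<forall>p\<in>projections H. \<forall>q\<in>projections K.
        (\<forall>x\<in>X. q o\<^sub>L \<phi> x = 0 \<and> \<phi> x o\<^sub>L p = 0) \<longrightarrow> p = 0 \<and> q = 0)"

definition rectangular_state ::
    "('a::chilbert_space \<Rightarrow>\<^sub>L 'b::chilbert_space) set
      \<Rightarrow> 'c::chilbert_space set \<Rightarrow> 'd::chilbert_space set
      \<Rightarrow> (('a \<Rightarrow>\<^sub>L 'b) \<Rightarrow> ('c \<Rightarrow>\<^sub>L 'd)) \<Rightarrow> bool" where
  "rectangular_state X H K \<phi> \<longleftrightarrow>
     linear_map X H K \<phi> \<and> nondegenerate X H K \<phi> \<and> completely_contractive X \<phi> \<and> cb_norm X \<phi> = 1"

definition representation ::
    "('a::chilbert_space \<Rightarrow>\<^sub>L 'b::chilbert_space) set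
      \<Rightarrow> 'c::chilbert_space set \<Rightarrow> 'd::chilbert_space set
      \<Rightarrow> (('a \<Rightarrow>\<^sub>L 'b) \<Rightarrow> ('c \<Rightarrow>\<^sub>L 'd)) \<Rightarrow> bool" where
  "representation T H K \<theta> \<longleftrightarrow> linear_map T H K \<theta> \<and>
     (\<forall>x\<in>T. \<forall>y\<in>T. \<forall>z\<in>T. \<theta> (triple x y z) = triple (\<theta> x) (\<theta> y) (\<theta> z))"

definition irreducible_representation ::
    "('a::chilbert_space \<Rightarrow>\<^sub>L 'b::chilbert_space) set
      \<Rightarrow> 'c::chilbert_space set \<Rightarrow> 'd::chilbert_space set
      \<Rightarrow> (('a \<Rightarrow>\<^sub>L 'b) \<Rightarrow> ('c \<Rightarrow>\<^sub>L 'd)) \<Rightarrow> bool" where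
  "irreducible_representation T H K \<theta> \<longleftrightarrow> representation T H K \<theta> \<and>
     (\<forall>p\<in>projections H. \<forall>q\<in>projections K.
        (\<forall>t\<in>T. q o\<^sub>L \<theta> t = \<theta> t o\<^sub>L p) \<longrightarrow>
        (p = 0 \<and> q = 0) \<or>
        ((\<forall>h\<in>H. blinfun_apply p h = h) \<and> (\<forall>k\<in>K. blinfun_apply q k = k)))"

definition unique_extension_property ::
    "('a::chilbert_space \<Rightarrow>\<^sub>L 'b::chilbert_space) set \<Rightarrow> ('a \<Rightarrow>\<^sub>L 'b) set
      \<Rightarrow> 'c::chilbert_space set \<Rightarrow> 'd::chilbert_space set
      \<Rightarrow> (('a \<Rightarrow>\<^sub>L 'b) \<Rightarrow> ('c \<Rightarrow>\<^sub>L 'd)) \<Rightarrow> bool" where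
  "unique_extension_property X T H K \<phi> \<longleftrightarrow> rectangular_state X H K \<phi> \<and>
     (\<forall>\<psi>. rectangular_state T H K \<psi> \<and> (\<forall>x\<in>X. \<psi> x = \<phi> x) \<longrightarrow> representation T H K \<psi>)"

text \<open>
  Under the unique extension property, any two extensions are triple morphisms that agree on the
  generating set \<open>X\<close>, so the extension \<open>\<psi>\<close> below is unique on \<open>T\<close>.
\<close>

definition boundary_representation ::
    "('a::chilbert_space \<Rightarrow>\<^sub>L 'b::chilbert_space) set \<Rightarrow> ('a \<Rightarrow>\<^sub>L 'b) set
      \<Rightarrow> 'c::chilbert_space set \<Rightarrow> 'd::chilbert_space set
      \<Rightarrow> (('a \<Rightarrow>\<^sub>L 'b) \<Rightarrow> ('c \<Rightarrow>\<^sub>L 'd)) \<Rightarrow> bool" where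
  "boundary_representation X T H K \<phi> \<longleftrightarrow> unique_extension_property X T H K \<phi> \<and>
     (\<exists>\<psi>. rectangular_state T H K \<psi> \<and> (\<forall>x\<in>X. \<psi> x = \<phi> x) \<and> irreducible_representation T H K \<psi>)"

text \<open>The type arguments are the universes over whose Hilbert spaces \<open>H\<close> and \<open>K\<close> range.\<close>

definition rectangular_hyperrigid ::
    "'c::chilbert_space itself \<Rightarrow> 'd::chilbert_space itself
      \<Rightarrow> ('a::chilbert_space \<Rightarrow>\<^sub>L 'b::chilbert_space) set \<Rightarrow> ('a \<Rightarrow>\<^sub>L 'b) set \<Rightarrow> bool" where
  "rectangular_hyperrigid _ _ G T \<longleftrightarrow>
     (\<forall>(H :: 'c set) (K :: 'd set) \<pi> (\<phi> :: nat \<Rightarrow> ('c \<Rightarrow>\<^sub>L 'd) \<Rightarrow> ('c \<Rightarrow>\<^sub>L 'd)).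
        hilbert H \<and> hilbert K \<and>
        representation T H K \<pi> \<and> inj_on \<pi> T \<and> nondegenerate T H K \<pi> \<and>
        (\<forall>n. linear_map (Bop H K) H K (\<phi> n) \<and> completely_contractive (Bop H K) (\<phi> n) \<and>
             cb_norm (Bop H K) (\<phi> n) = 1) \<and>
        (\<forall>g\<in>G. (\<lambda>n. norm (\<phi> n (\<pi> g) - \<pi> g)) \<longlonglongrightarrow> 0)
        \<longrightarrow> (\<forall>t\<in>T. (\<lambda>n. norm (\<phi> n (\<pi> t) - \<pi> t)) \<longlonglongrightarrow> 0))"

end

theory Submission
  imports Defs
begin

text \<open>
  A failure of hyperrigidity at \<open>t\<close> yields, for infinitely many \<open>n\<close>, a vector \<open>h\<^sub>n\<close> on which
  \<open>\<phi>\<^sub>n(\<pi>(t))\<close> stays away from \<open>\<pi>(t)\<close>. Together with \<open>\<phi>\<^sub>n(\<pi>(t)) h\<^sub>n\<close> it lies in a reducing pair of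
  subspaces of \<open>\<pi>\<close> of dimension bounded independently of \<open>n\<close>. Transporting these pairs to one fixed
  finite-dimensional pair and passing to the limit along an ultrafilter gives a representation \<open>\<theta>\<close>
  and a completely contractive map \<open>\<psi>\<close> on \<open>T\<close> that agree on \<open>X\<close> but not at \<open>t\<close>. However, \<open>\<theta>\<close> splits
  into irreducible summands, and compressing \<open>\<psi>\<close> to a summand gives that summand, as it is a
  boundary representation. The off-diagonal part of \<open>\<psi>(t)\<close> vanishes because \<open>t\<close> (if \<open>\<parallel>t\<parallel> \<le> 1\<close>) is an
  entry of a contractive column over \<open>T\<close> that \<open>\<theta>\<close> maps to a nearly isometric one at a given vector: a
  contraction cannot have anything outside a compression that is already isometric.

  Nondegeneracy survives the limit because of the identity
  \<open>v = \<Sum>b. \<pi>(u b)\<^sup>* \<pi>(b) v\<close> with finitely many \<open>b, u b \<in> T\<close>, and \<open>\<pi>\<close> is completely contractive because its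
  irreducible summands are.
\<close>

section \<open>Hilbert spaces and adjoints\<close>

text \<open>Two obstacles shape the argument. The boundary hypothesis covers only subspaces of the
  two types \<open>'c\<close> and \<open>'d\<close>, so infinite direct sums or ultraproducts would
  lead out of its reach; and \<open>H\<close>, \<open>K\<close> may be infinite-dimensional, since
  finite dimension of \<open>T\<close> does not limit multiplicity. Both are met by
  finite-dimensional reducing pairs, with a pair that already occurs at some index as the fixed
  model. The dimensions are bounded because three alternating factors of \<open>\<pi>\<close> and
  its adjoints collapse to one, so finitely many vectors generate an invariant pair after words of
  length at most two in a basis of \<open>T\<close>. In the model, operators are finite matrices:
  ultralimits of the entries are norm limits, and these respect triple products and adjoints. The
  identity for \<open>v\<close> comes from a dimension count: right multiplication of
  \<open>T\<close> by the sum of \<open>adj c o\<^sub>L c\<close> over a basis is injective, hence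
  onto. Irreducible summands are never listed; an induction over orthogonal splittings proves
  statements that add up over summands.\<close>

lemma cinner_add_right: "cinner x (y + z) = cinner x y + cinner (x :: 'a::chilbert_space) z"
  by (metis cinner_add_left cinner_commute complex_cnj_add)

lemma cinner_scaleC_right: "cinner x (c *\<^sub>C y) = cnj c * cinner (x :: 'a::chilbert_space) y"
  by (metis cinner_scaleC_left cinner_commute complex_cnj_mult)

lemma cinner_zero_left [simp]: "cinner 0 (y :: 'a::chilbert_space) = 0"
  by (metis add_cancel_right_left cinner_add_left)

lemma cinner_zero_right [simp]: "cinner (y :: 'a::chilbert_space) 0 = 0"
  by (metis add_cancel_right_left cinner_add_right)

lemma cinner_minus_left [simp]: "cinner (- x) (y :: 'a::chilbert_space) = - cinner x y"
  by (metis add.right_inverse cinner_add_left cinner_zero_left minus_unique)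

lemma cinner_minus_right [simp]: "cinner x (- y :: 'a::chilbert_space) = - cinner x y"
  by (metis cinner_commute cinner_minus_left complex_cnj_minus)

lemma cinner_diff_left: "cinner (x - z) (y :: 'a::chilbert_space) = cinner x y - cinner z y"
  by (metis cinner_add_left cinner_minus_left diff_conv_add_uminus)

lemma cinner_diff_right: "cinner x (y - z :: 'a::chilbert_space) = cinner x y - cinner x z"
  by (metis cinner_add_right cinner_minus_right diff_conv_add_uminus)

lemma cinner_sum_left: "cinner (sum f A) (y :: 'a::chilbert_space) = (\<Sum>i\<in>A. cinner (f i) y)"
  by (induction A rule: infinite_finite_induct) (simp_all add: cinner_add_left)

lemma cinner_sum_right: "cinner x (sum f A :: 'a::chilbert_space) = (\<Sum>i\<in>A. cinner x (f i))"
  by (induction A rule: infinite_finite_induct) (simp_all add: cinner_add_right)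

lemma cinner_self: "cinner x (x :: 'a::chilbert_space) = of_real ((norm x)\<^sup>2)"
  using Re_cinner[of x x] cinner_commute[of x x]
  by (simp add: complex_eq_iff power2_norm_eq_inner)

lemma cinner_self_eq_0 [simp]: "cinner x (x :: 'a::chilbert_space) = 0 \<longleftrightarrow> x = 0"
  by (simp add: cinner_self)

lemma cinner_eqI: "(\<And>y. cinner x y = cinner z y) \<Longrightarrow> x = (z :: 'a::chilbert_space)"
  by (metis cinner_diff_left cinner_self_eq_0 eq_iff_diff_eq_0)

lemma scaleR_scaleC: "r *\<^sub>R (x :: 'a::chilbert_space) = complex_of_real r *\<^sub>C x"
  by (simp add: scaleC_of_real)

lemma cmod_cinner_le: "cmod (cinner x y) \<le> norm x * norm (y :: 'a::chilbert_space)"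
proof (cases "cinner x y = 0")
  case False
  define c where "c = cnj (sgn (cinner x y))"
  have c: "cmod c = 1" using False by (simp add: c_def norm_sgn)
  have "cinner (c *\<^sub>C x) y = cinner x y * cnj (cinner x y) / of_real (cmod (cinner x y))"
    by (simp add: cinner_scaleC_left c_def sgn_eq mult.commute)
  also have "\<dots> = of_real (cmod (cinner x y))"
    using False by (simp add: power2_eq_square flip: complex_norm_square)
  finally have "cinner (c *\<^sub>C x) y = of_real (cmod (cinner x y))" .
  then have "cmod (cinner x y) = inner (c *\<^sub>C x) y"
    by (metis Re_cinner Re_complex_of_real)
  also have "\<dots> \<le> norm (c *\<^sub>C x) * norm y" by (rule norm_cauchy_schwarz)
  finally show ?thesis by (simp add: norm_scaleC c)
qed simp

section \<open>Orthogonal projection and the Riesz theorem\<close>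

lemma Pythagoras:
  assumes "cinner x (y :: 'a::chilbert_space) = 0"
  shows "(norm (x + y))\<^sup>2 = (norm x)\<^sup>2 + (norm y)\<^sup>2"
proof -
  have "inner x y = 0" using assms Re_cinner[of x y] by simp
  then show ?thesis by (simp add: power2_norm_eq_inner inner_add_left inner_add_right inner_commute)
qed

text \<open>\<open>S\<close> may be infinite-dimensional, so compactness gives no nearest point. A
  minimising sequence is Cauchy by the parallelogram law, and completeness supplies its
  limit.\<close>

lemma orthogonal_decomposition:
  fixes S :: "'a::{real_inner, complete_space} set"
  assumes S: "subspace S" "closed S"
  obtains s where "s \<in> S" "\<And>y. y \<in> S \<Longrightarrow> inner (x - s) y = 0"
proof -
  define d where "d = infdist x S"
  have ne: "S \<noteq> {}" using subspace_0[OF S(1)] by auto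
  have "\<exists>y\<in>S. (dist x y)\<^sup>2 < d\<^sup>2 + 1 / real (Suc n)" for n
  proof (rule ccontr)
    assume "\<not> ?thesis"
    then have "sqrt (d\<^sup>2 + 1 / real (Suc n)) \<le> dist x y" if "y \<in> S" for y
      using that by (intro real_le_lsqrt) (auto simp: not_less)
    then have "sqrt (d\<^sup>2 + 1 / real (Suc n)) \<le> d"
      unfolding d_def infdist_def using ne by (auto intro!: cINF_greatest)
    then have "d\<^sup>2 + 1 / real (Suc n) \<le> d\<^sup>2"
      by (rule sqrt_le_D)
    then show False by (simp add: field_simps)
  qed
  then obtain y where y: "y n \<in> S" "(dist x (y n))\<^sup>2 < d\<^sup>2 + 1 / real (Suc n)" for n
    by metis
  \<comment> \<open>Parallelogram law for \<open>x - y m\<close> and \<open>x - y n\<close>: the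
    midpoint of \<open>y m\<close> and \<open>y n\<close> lies in \<open>S\<close>, so its distance
    from \<open>x\<close> is at least \<open>d\<close>.\<close>
  have par: "(dist (y m) (y n))\<^sup>2 \<le> 2 / real (Suc m) + 2 / real (Suc n)" for m n
  proof -
    have "(1/2) *\<^sub>R (y m + y n) \<in> S"
      using y S(1) by (simp add: subspace_add subspace_scale)
    then have "d \<le> norm (x - (1/2) *\<^sub>R (y m + y n))"
      unfolding d_def by (metis dist_norm infdist_le)
    then have "d\<^sup>2 \<le> (norm (x - (1/2) *\<^sub>R (y m + y n)))\<^sup>2"
      by (intro power_mono) (simp_all add: d_def infdist_nonneg)
    moreover have "(norm (y m - y n))\<^sup>2 + 4 * (norm (x - (1/2) *\<^sub>R (y m + y n)))\<^sup>2
        = 2 * (norm (x - y m))\<^sup>2 + 2 * (norm (x - y n))\<^sup>2"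
      by (simp add: power2_norm_eq_inner algebra_simps inner_commute)
    ultimately show ?thesis using y(2)[of m] y(2)[of n]
      by (simp add: dist_norm)
  qed
  have "Cauchy y"
  proof (rule metric_CauchyI)
    fix e :: real assume e: "e > 0"
    obtain N where N: "4 / e\<^sup>2 < real N" using reals_Archimedean2 by blast
    have "dist (y m) (y n) < e" if mn: "m \<ge> N" "n \<ge> N" for m n
    proof -
      have *: "2 / real (Suc k) < e\<^sup>2 / 2" if "k \<ge> N" for k
      proof -
        have "4 / e\<^sup>2 < real (Suc k)" using N that by linarith
        then show ?thesis using e by (simp add: field_simps)
      qed
      have "(dist (y m) (y n))\<^sup>2 < e\<^sup>2"
        using par[of m n] *[OF mn(1)] *[OF mn(2)] by linarith
      then show ?thesis using e by (simp add: power_less_imp_less_base)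
    qed
    then show "\<exists>M. \<forall>m\<ge>M. \<forall>n\<ge>M. dist (y m) (y n) < e" by blast
  qed
  then obtain s where s: "y \<longlonglongrightarrow> s" using convergent_eq_Cauchy by blast
  have sS: "s \<in> S" using closed_sequentially[OF S(2) _ s] y(1) by blast
  have ds: "(norm (x - s))\<^sup>2 \<le> d\<^sup>2"
  proof (rule LIMSEQ_le)
    show "(\<lambda>n. (dist x (y n))\<^sup>2) \<longlonglongrightarrow> (norm (x - s))\<^sup>2"
      unfolding dist_norm by (intro tendsto_intros s)
    show "(\<lambda>n. d\<^sup>2 + 1 / real (Suc n)) \<longlonglongrightarrow> d\<^sup>2"
      using tendsto_add[OF tendsto_const[of "d\<^sup>2"] LIMSEQ_inverse_real_of_nat]
      by (simp add: divide_inverse)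
  qed (use y(2) less_imp_le in blast)
  have "inner (x - s) z = 0" if z: "z \<in> S" for z
  proof (rule ccontr)
    assume nz: "inner (x - s) z \<noteq> 0"
    then have zn: "z \<noteq> 0" by auto
    \<comment> \<open>The step along \<open>z\<close> that minimises the distance to
      \<open>x\<close>; a nonzero inner product would make the gain strict.\<close>
    define r where "r = inner (x - s) z / (norm z)\<^sup>2"
    have "s + r *\<^sub>R z \<in> S" using sS z S(1) by (simp add: subspace_add subspace_scale)
    then have "d \<le> norm (x - (s + r *\<^sub>R z))"
      unfolding d_def by (metis dist_norm infdist_le)
    then have "d\<^sup>2 \<le> (norm (x - (s + r *\<^sub>R z)))\<^sup>2"
      by (intro power_mono) (simp_all add: d_def infdist_nonneg)
    also have "\<dots> = (norm (x - s))\<^sup>2 - 2 * r * inner (x - s) z + r\<^sup>2 * (norm z)\<^sup>2"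
      unfolding power2_norm_eq_inner
      by (simp add: algebra_simps inner_commute power2_eq_square)
    also have "\<dots> = (norm (x - s))\<^sup>2 - (inner (x - s) z)\<^sup>2 / (norm z)\<^sup>2"
      using zn by (simp add: r_def power2_eq_square)
    also have "\<dots> < (norm (x - s))\<^sup>2" using nz zn by simp
    finally show False using ds by simp
  qed
  then show thesis using that sS by blast
qed

text \<open>The kernel of a nonzero \<open>f\<close> has codimension one. The component
  \<open>w\<close> of \<open>x\<close> orthogonal to it spans the complement, and rescaling
  \<open>w\<close> gives the representing vector.\<close>

lemma Riesz_representation:
  fixes f :: "'a::{real_inner, complete_space} \<Rightarrow> real"
  assumes f: "bounded_linear f"
  obtains z where "\<And>x. f x = inner x z"
proof (cases "\<forall>x. f x = 0")
  case True then show ?thesis using that[of 0] by simp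
next
  case False
  then obtain x where x: "f x \<noteq> 0" by blast
  interpret f: bounded_linear f by fact
  have "subspace {x. f x = 0}"
    by (auto simp: subspace_def f.add f.scaleR f.zero)
  moreover have "closed {x. f x = 0}"
    by (intro closed_Collect_eq continuous_intros linear_continuous_on f)
  ultimately obtain s where s: "f s = 0" "\<And>y. f y = 0 \<Longrightarrow> inner (x - s) y = 0"
    using orthogonal_decomposition[of "{x. f x = 0}" x] by auto
  define w where "w = x - s"
  have fw: "f w = f x" by (simp add: w_def f.diff s)
  with x have w0: "w \<noteq> 0" using f.zero by auto
  have "f y = inner y ((f w / inner w w) *\<^sub>R w)" for y
  proof -
    have "f (y - (f y / f w) *\<^sub>R w) = 0" using x fw by (simp add: f.diff f.scaleR)
    then have "inner w (y - (f y / f w) *\<^sub>R w) = 0" using s(2) w_def by blast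
    then show ?thesis using x fw w0 by (simp add: inner_diff_right inner_commute field_simps)
  qed
  then show thesis using that by blast
qed

section \<open>Complex-linear operators and their adjoints\<close>

definition clin :: "('a::chilbert_space \<Rightarrow>\<^sub>L 'b::chilbert_space) \<Rightarrow> bool" where
  "clin A \<longleftrightarrow> (\<forall>c x. blinfun_apply A (c *\<^sub>C x) = c *\<^sub>C blinfun_apply A x)"

lemma clinD: "clin A \<Longrightarrow> blinfun_apply A (c *\<^sub>C x) = c *\<^sub>C blinfun_apply A x"
  by (simp add: clin_def)

text \<open>Riesz is applied to the real part of the inner product; complex homogeneity of
  \<open>A\<close> then recovers the imaginary part.\<close>

lemma adjoint_exists:
  fixes A :: "'a::chilbert_space \<Rightarrow>\<^sub>L 'b::chilbert_space"
  assumes A: "clin A"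
  obtains B :: "'b \<Rightarrow>\<^sub>L 'a"
  where "\<And>x y. cinner (blinfun_apply A x) y = cinner x (blinfun_apply B y)"
proof -
  have "\<exists>z. \<forall>x. inner (blinfun_apply A x) y = inner x z" for y
  proof -
    have "bounded_linear (\<lambda>x. inner (blinfun_apply A x) y)"
      by (intro bounded_linear_intros)
    then show ?thesis by (rule Riesz_representation) blast
  qed
  then have "\<exists>B. \<forall>y x. inner (blinfun_apply A x) y = inner x (B y)"
    by (intro choice) blast
  then obtain B where B: "inner (blinfun_apply A x) y = inner x (B y)" for x y
    by blast
  have Beq: "u = v" if "\<And>x. inner x u = inner x v" for u v :: 'a
    using that vector_eq_ldot[of u v] by blast
  have nB: "norm (B y) \<le> norm y * norm A" for y
  proof -
    have "norm (B y) * norm (B y) = inner (blinfun_apply A (B y)) y"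
      by (simp add: B power2_norm_eq_inner flip: power2_eq_square)
    also have "\<dots> \<le> norm (blinfun_apply A (B y)) * norm y" by (rule norm_cauchy_schwarz)
    also have "\<dots> \<le> (norm A * norm (B y)) * norm y"
      by (intro mult_right_mono norm_blinfun) simp
    finally have "norm (B y) * norm (B y) \<le> (norm y * norm A) * norm (B y)"
      by (simp add: ac_simps)
    then show ?thesis
      by (cases "B y = 0") (simp_all add: mult_le_cancel_right)
  qed
  have "bounded_linear B"
  proof (rule bounded_linear_intro[where K = "norm A"])
    show "B (x + y) = B x + B y" for x y
      by (rule Beq) (simp add: inner_add_right flip: B)
    show "B (r *\<^sub>R x) = r *\<^sub>R B x" for r x
      by (rule Beq) (simp flip: B)
  qed (rule nB)
  then have Bl: "blinfun_apply (Blinfun B) = B" by (rule bounded_linear_Blinfun_apply)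
  have "cinner (blinfun_apply A x) y = cinner x (B y)" for x y
  proof (rule complex_eqI)
    show "Re (cinner (blinfun_apply A x) y) = Re (cinner x (B y))"
      by (simp add: Re_cinner B)
    \<comment> \<open>An imaginary part is a real part after rotating \<open>u\<close> by the
      imaginary unit, and \<open>A\<close> commutes with this rotation.\<close>
    have im: "Im (cinner u v) = - Re (cinner (\<i> *\<^sub>C u) v)" for u v :: "'h::chilbert_space"
      by (simp add: cinner_scaleC_left)
    show "Im (cinner (blinfun_apply A x) y) = Im (cinner x (B y))"
      unfolding im clinD[OF A, symmetric] by (simp add: Re_cinner B)
  qed
  then show thesis using that[of "Blinfun B"] Bl by simp
qed

lemma cinner_adj:
  assumes "clin A"
  shows "cinner (blinfun_apply A x) y = cinner x (blinfun_apply (adj A) y)"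
proof -
  obtain B where B: "\<And>x y. cinner (blinfun_apply A x) y = cinner x (blinfun_apply B y)"
    using adjoint_exists[OF assms] by blast
  have "\<forall>x y. cinner (blinfun_apply A x) y = cinner x (blinfun_apply (adj A) y)"
    unfolding adj_def
  proof (rule theI[where a = B])
    fix C assume C: "\<forall>x y. cinner (blinfun_apply A x) y = cinner x (blinfun_apply C y)"
    show "C = B"
      by (rule blinfun_eqI, rule cinner_eqI) (metis B C cinner_commute)
  qed (use B in blast)
  then show ?thesis by blast
qed

lemma adj_eqI:
  assumes "\<And>x y. cinner (blinfun_apply A x) y = cinner x (blinfun_apply B y)"
  shows "adj A = B"
  unfolding adj_def
proof (rule the_equality)
  fix C assume C: "\<forall>x y. cinner (blinfun_apply A x) y = cinner x (blinfun_apply C y)"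
  show "C = B"
    by (rule blinfun_eqI, rule cinner_eqI) (metis assms C cinner_commute)
qed (use assms in blast)

lemma cinner_adj_left:
  "clin A \<Longrightarrow> cinner (blinfun_apply (adj A) y) x = cinner y (blinfun_apply A x)"
  using cinner_adj[of A x y] cinner_commute[where y = "blinfun_apply (adj A) y" and x = x]
    cinner_commute[where y = y and x = "blinfun_apply A x"] by simp

lemma clinI_adj:
  assumes "\<And>x y. cinner (blinfun_apply A x) y = cinner x (blinfun_apply B y)"
  shows "clin A"
  unfolding clin_def by (intro allI, rule cinner_eqI) (simp only: assms cinner_scaleC_left)

lemma clin_adj: "clin A \<Longrightarrow> clin (adj A)"
  by (rule clinI_adj, rule cinner_adj_left)

lemma adj_adj: "clin A \<Longrightarrow> adj (adj A) = A"
  by (rule adj_eqI, rule cinner_adj_left)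

lemma clin_0 [simp]: "clin 0" by (simp add: clin_def)
lemma clin_add: "clin A \<Longrightarrow> clin B \<Longrightarrow> clin (A + B)"
  by (simp add: clin_def blinfun.add_left scaleC_add_right)
lemma clin_minus: "clin A \<Longrightarrow> clin (- A)"
  by (simp add: clin_def blinfun.minus_left)
lemma clin_diff: "clin A \<Longrightarrow> clin B \<Longrightarrow> clin (A - B)"
  using clin_add[of A "- B"] clin_minus[of B] by simp
lemma clin_sum: "(\<And>i. i \<in> I \<Longrightarrow> clin (A i)) \<Longrightarrow> clin (sum A I)"
  by (induction I rule: infinite_finite_induct) (simp_all add: clin_add)
lemma clin_cscale: "clin A \<Longrightarrow> clin (cscale c A)"
  by (simp add: clin_def cscale_apply scaleC_scaleC mult.commute)
lemma clin_compose: "clin A \<Longrightarrow> clin B \<Longrightarrow> clin (A o\<^sub>L B)"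
  by (simp add: clin_def)

lemma adj_0 [simp]: "adj 0 = 0" by (rule adj_eqI) simp
lemma adj_add: "clin A \<Longrightarrow> clin B \<Longrightarrow> adj (A + B) = adj A + adj B"
  by (rule adj_eqI) (simp add: blinfun.add_left cinner_add_left cinner_add_right cinner_adj)
lemma adj_diff: "clin A \<Longrightarrow> clin B \<Longrightarrow> adj (A - B) = adj A - adj B"
  by (rule adj_eqI) (simp add: blinfun.diff_left cinner_diff_left cinner_diff_right cinner_adj)
lemma adj_sum: "(\<And>i. i \<in> I \<Longrightarrow> clin (A i)) \<Longrightarrow> adj (sum A I) = (\<Sum>i\<in>I. adj (A i))"
  by (induction I rule: infinite_finite_induct) (simp_all add: adj_add clin_sum)
lemma adj_cscale: "clin A \<Longrightarrow> adj (cscale c A) = cscale (cnj c) (adj A)"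
  by (rule adj_eqI) (simp add: cscale_apply cinner_scaleC_left cinner_scaleC_right cinner_adj)
lemma adj_compose: "clin A \<Longrightarrow> clin B \<Longrightarrow> adj (A o\<^sub>L B) = adj B o\<^sub>L adj A"
  by (rule adj_eqI) (simp add: cinner_adj)

lemma norm_adj_le:
  assumes A: "clin A"
  shows "norm (adj A) \<le> norm A"
proof (rule norm_blinfun_bound)
  fix y
  let ?B = "blinfun_apply (adj A)"
  have "norm (?B y) * norm (?B y) = inner (blinfun_apply A (?B y)) y"
    by (metis A Re_cinner cinner_adj power2_eq_square power2_norm_eq_inner)
  also have "\<dots> \<le> norm (blinfun_apply A (?B y)) * norm y" by (rule norm_cauchy_schwarz)
  also have "\<dots> \<le> (norm A * norm (?B y)) * norm y"
    by (intro mult_right_mono norm_blinfun) simp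
  finally have "norm (?B y) * norm (?B y) \<le> (norm A * norm y) * norm (?B y)"
    by (simp add: ac_simps)
  then show "norm (?B y) \<le> norm A * norm y"
    by (cases "?B y = 0") (simp_all add: mult_le_cancel_right)
qed simp

lemma norm_cscale: "norm (cscale c A) = cmod c * norm A"
proof (rule antisym)
  have le: "norm (cscale c A) \<le> cmod c * norm A" for c and A :: "'a \<Rightarrow>\<^sub>L 'b"
    by (rule norm_blinfun_bound)
      (simp_all add: cscale_apply norm_scaleC mult_left_mono norm_blinfun mult.assoc)
  then show "norm (cscale c A) \<le> cmod c * norm A" .
  show "cmod c * norm A \<le> norm (cscale c A)"
  proof (cases "c = 0")
    case False
    have "norm A = norm (cscale (inverse c) (cscale c A))"
      using False by simp
    also have "\<dots> \<le> cmod (inverse c) * norm (cscale c A)" by (rule le)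
    finally show ?thesis using False by (simp add: norm_inverse field_simps norm_divide)
  qed simp
qed

text \<open>\<open>adj\<close> is a definite description, under control only on complex-linear
  operators; there it is additive and does not increase the norm, hence is continuous.\<close>

lemma tendsto_adj:
  assumes "(A \<longlongrightarrow> B) F" "eventually (\<lambda>n. clin (A n)) F" "clin B"
  shows "((\<lambda>n. adj (A n)) \<longlongrightarrow> adj B) F"
proof (rule LIM_zero_cancel, rule Lim_null_comparison)
  show "eventually (\<lambda>n. norm (adj (A n) - adj B) \<le> norm (A n - B)) F"
    using assms(2) by eventually_elim (simp add: assms(3) norm_adj_le clin_diff flip: adj_diff)
  show "((\<lambda>n. norm (A n - B)) \<longlongrightarrow> 0) F"
    using assms(1) by (simp add: LIM_zero_iff tendsto_norm_zero_iff)
qed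

section \<open>Complex subspaces and the operators between them\<close>

lemma csubspace_subspace: "cvec.subspace S \<Longrightarrow> subspace (S :: 'a::chilbert_space set)"
  by (auto simp: subspace_def cvec.subspace_def scaleR_scaleC)

text \<open>Real orthogonality to a complex subspace is complex orthogonality, because with
  \<open>y\<close> the subspace contains its rotation by the imaginary unit.\<close>

lemma cproj_exists:
  fixes S :: "'a::chilbert_space set"
  assumes S: "cvec.subspace S" "closed S"
  obtains s where "s \<in> S" "\<And>y. y \<in> S \<Longrightarrow> cinner (x - s) y = 0"
proof -
  obtain s where s: "s \<in> S" "\<And>y. y \<in> S \<Longrightarrow> inner (x - s) y = 0"
    using orthogonal_decomposition[OF csubspace_subspace[OF S(1)] S(2), of x] by blast
  have "cinner (x - s) y = 0" if y: "y \<in> S" for y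
  proof (rule complex_eqI)
    show "Re (cinner (x - s) y) = Re 0" using s(2)[OF y] by (simp add: Re_cinner)
    have "inner (x - s) (\<i> *\<^sub>C y) = 0" using s(2) cvec.subspace_scale[OF S(1) y] by blast
    then show "Im (cinner (x - s) y) = Im 0"
      by (simp add: cinner_scaleC_right flip: Re_cinner)
  qed
  then show thesis using that s(1) by blast
qed

lemma Bop_clin: "A \<in> Bop H K \<Longrightarrow> clin A"
  by (simp add: Bop_def clin_def)

lemma Bop_range: "A \<in> Bop H K \<Longrightarrow> blinfun_apply A x \<in> K"
  by (simp add: Bop_def)

lemma BopI:
  assumes "clin A" "\<And>x. blinfun_apply A x \<in> K"
    "\<And>x. (\<And>h. h \<in> H \<Longrightarrow> cinner x h = 0) \<Longrightarrow> blinfun_apply A x = 0"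
  shows "A \<in> Bop H K"
  using assms by (simp add: Bop_def clin_def)

lemma Bop_kernel:
  "A \<in> Bop H K \<Longrightarrow> (\<And>h. h \<in> H \<Longrightarrow> cinner x h = 0) \<Longrightarrow> blinfun_apply A x = 0"
  by (simp add: Bop_def)

text \<open>The component of \<open>adj A y\<close> orthogonal to \<open>H\<close> is killed by
  \<open>A\<close>, so it is orthogonal to \<open>adj A y\<close> itself and must vanish.\<close>

lemma Bop_adj_range:
  assumes A: "A \<in> Bop H K" and H: "cvec.subspace H" "closed H"
  shows "blinfun_apply (adj A) y \<in> H"
proof -
  let ?v = "blinfun_apply (adj A) y"
  obtain s where s: "s \<in> H" "\<And>z. z \<in> H \<Longrightarrow> cinner (?v - s) z = 0"
    using cproj_exists[OF H] by blast
  have "blinfun_apply A (?v - s) = 0" using Bop_kernel[OF A] s(2) by blast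
  then have "cinner (?v - s) ?v = 0"
    using cinner_adj[OF Bop_clin[OF A], of "?v - s" y] by simp
  moreover have "cinner (?v - s) s = 0" using s by blast
  ultimately have "cinner (?v - s) (?v - s) = 0" by (simp add: cinner_diff_right)
  then show ?thesis using s(1) by simp
qed

section \<open>Partial isometries and projections\<close>

definition rank_one :: "'b::chilbert_space \<Rightarrow> 'a::chilbert_space \<Rightarrow> 'a \<Rightarrow>\<^sub>L 'b" where
  "rank_one y x = Blinfun (\<lambda>z. cinner z x *\<^sub>C y)"

lemma rank_one_apply: "blinfun_apply (rank_one y x) z = cinner z x *\<^sub>C y"
proof -
  have "bounded_linear (\<lambda>z. cinner z x *\<^sub>C y)"
  proof (rule bounded_linear_intro[where K = "norm x * norm y"])
    show "norm (cinner z x *\<^sub>C y) \<le> norm z * (norm x * norm y)" for z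
      unfolding norm_scaleC mult.assoc[symmetric]
      by (intro mult_right_mono cmod_cinner_le) simp
  qed (simp_all add: cinner_add_left scaleC_add_left scaleR_scaleC cinner_scaleC_left scaleC_scaleC)
  then show ?thesis by (simp add: rank_one_def bounded_linear_Blinfun_apply)
qed

lemma clin_rank_one [simp]: "clin (rank_one y x)"
  by (simp add: clin_def rank_one_apply cinner_scaleC_left scaleC_scaleC)

lemma adj_rank_one: "adj (rank_one y x) = rank_one x y"
  by (rule adj_eqI)
    (simp add: rank_one_apply cinner_scaleC_left cinner_scaleC_right flip: cinner_commute)

definition orthonormal :: "(nat \<Rightarrow> 'a::chilbert_space) \<Rightarrow> nat \<Rightarrow> bool" where
  "orthonormal e m \<longleftrightarrow> (\<forall>i<m. \<forall>j<m. cinner (e i) (e j) = (if i = j then 1 else 0))"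

text \<open>For orthonormal \<open>e\<close> this sends \<open>e i\<close> to \<open>f i\<close> and
  kills the orthogonal complement of their span. With \<open>f = e\<close> it is the projection onto
  the span; with two frames it transports one finite-dimensional space to another.\<close>

definition partial_isom :: "(nat \<Rightarrow> 'b::chilbert_space) \<Rightarrow> (nat \<Rightarrow> 'a::chilbert_space) \<Rightarrow> nat \<Rightarrow> 'a \<Rightarrow>\<^sub>L 'b" where
  "partial_isom f e m = (\<Sum>i<m. rank_one (f i) (e i))"

lemma partial_isom_apply: "blinfun_apply (partial_isom f e m) x = (\<Sum>i<m. cinner x (e i) *\<^sub>C f i)"
  by (simp add: partial_isom_def blinfun.sum_left rank_one_apply)

lemma clin_partial_isom [simp]: "clin (partial_isom f e m)"
  by (simp add: partial_isom_def clin_sum)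

lemma adj_partial_isom: "adj (partial_isom f e m) = partial_isom e f m"
  by (simp add: partial_isom_def adj_sum adj_rank_one)

lemma partial_isom_vector:
  assumes "orthonormal e m" "i < m"
  shows "blinfun_apply (partial_isom f e m) (e i) = f i"
proof -
  have "(\<Sum>j<m. cinner (e i) (e j) *\<^sub>C f j) = (\<Sum>j<m. if i = j then f j else 0)"
    using assms by (intro sum.cong) (auto simp: orthonormal_def scaleC_one)
  then show ?thesis using assms(2) by (simp add: partial_isom_apply)
qed

lemma partial_isom_compose:
  assumes "orthonormal e m"
  shows "partial_isom f e m o\<^sub>L partial_isom e g m = partial_isom f g m"
proof (rule blinfun_eqI)
  fix x
  have "blinfun_apply (partial_isom f e m o\<^sub>L partial_isom e g m) x
      = (\<Sum>i<m. cinner x (g i) *\<^sub>C blinfun_apply (partial_isom f e m) (e i))"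
    by (simp add: partial_isom_apply[of e g] blinfun.sum_right clinD)
  also have "\<dots> = blinfun_apply (partial_isom f g m) x"
    using assms by (simp add: partial_isom_vector partial_isom_apply[of f g])
  finally show "blinfun_apply (partial_isom f e m o\<^sub>L partial_isom e g m) x = blinfun_apply (partial_isom f g m) x" .
qed

definition proj :: "('a::chilbert_space \<Rightarrow>\<^sub>L 'a) \<Rightarrow> bool" where
  "proj p \<longleftrightarrow> clin p \<and> p o\<^sub>L p = p \<and> adj p = p"

lemma proj_partial_isom: "orthonormal e m \<Longrightarrow> proj (partial_isom e e m)"
  by (simp add: proj_def adj_partial_isom partial_isom_compose)

lemma proj_clin: "proj p \<Longrightarrow> clin p" by (simp add: proj_def)
lemma proj_adj: "proj p \<Longrightarrow> adj p = p" by (simp add: proj_def)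
lemma proj_comp: "proj p \<Longrightarrow> p o\<^sub>L p = p" by (simp add: proj_def)
lemma proj_idem: "proj p \<Longrightarrow> blinfun_apply p (blinfun_apply p x) = blinfun_apply p x"
  by (metis blinfun_apply_blinfun_compose proj_comp)
lemma proj_cinner: "proj p \<Longrightarrow> cinner (blinfun_apply p x) y = cinner x (blinfun_apply p y)"
  using cinner_adj[of p x y] by (simp add: proj_clin proj_adj)

lemma proj_range_iff: "proj p \<Longrightarrow> x \<in> range (blinfun_apply p) \<longleftrightarrow> blinfun_apply p x = x"
  using proj_idem[of p] by (metis (no_types) rangeE rangeI)

lemma norm_proj_split:
  assumes "proj p"
  shows "(norm x)\<^sup>2 = (norm (blinfun_apply p x))\<^sup>2 + (norm (x - blinfun_apply p x))\<^sup>2"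
proof -
  have "cinner (blinfun_apply p x) (x - blinfun_apply p x) = 0"
    using assms by (simp add: cinner_diff_right proj_cinner proj_idem)
  from Pythagoras[OF this] show ?thesis by simp
qed

lemma norm_proj_le: "proj p \<Longrightarrow> norm (blinfun_apply p x) \<le> norm x"
  using norm_proj_split[of p x] by (simp add: power2_le_imp_le)

lemma proj_norm_le_1: "proj p \<Longrightarrow> norm p \<le> 1"
  by (rule norm_blinfun_bound) (simp_all add: norm_proj_le)

lemma csubspace_range:
  assumes "clin A" shows "cvec.subspace (range (blinfun_apply A))"
proof (rule cvec.subspaceI)
  show "0 \<in> range (blinfun_apply A)" by (metis blinfun.zero_right rangeI)
next
  fix x y assume "x \<in> range (blinfun_apply A)" "y \<in> range (blinfun_apply A)"
  then show "x + y \<in> range (blinfun_apply A)"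
    by (metis (no_types) blinfun.add_right rangeE rangeI)
next
  fix c x assume "x \<in> range (blinfun_apply A)"
  then show "c *\<^sub>C x \<in> range (blinfun_apply A)"
    using assms by (metis (no_types) clinD rangeE rangeI)
qed

lemma closed_range_proj:
  assumes "proj p" shows "closed (range (blinfun_apply p))"
proof -
  have "range (blinfun_apply p) = {x. blinfun_apply p x = x}"
    using proj_range_iff[OF assms] by blast
  then show ?thesis
    by (simp add: closed_Collect_eq linear_continuous_on blinfun.bounded_linear_right)
qed

lemma hilbert_range_proj:
  assumes "proj p" "p \<noteq> 0" shows "hilbert (range (blinfun_apply p))"
proof -
  have "range (blinfun_apply p) \<noteq> {0}"
    using assms(2) by (metis blinfun_eqI rangeI singletonD zero_blinfun.rep_eq)
  then show ?thesis
    using assms(1) by (simp add: hilbert_def closed_range_proj csubspace_range proj_clin)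
qed

text \<open>For subspaces given as ranges of projections, \<open>Bop\<close> is the corner cut out
  by \<open>q\<close> and \<open>p\<close>; membership becomes two operator equations that can be
  checked by calculation.\<close>

lemma Bop_range_iff:
  assumes "proj p" "proj q"
  shows "A \<in> Bop (range (blinfun_apply p)) (range (blinfun_apply q))
    \<longleftrightarrow> clin A \<and> q o\<^sub>L A = A \<and> A o\<^sub>L p = A" (is "?L \<longleftrightarrow> ?R")
proof
  assume L: ?L
  have "blinfun_apply A (x - blinfun_apply p x) = 0" for x
  proof (rule Bop_kernel[OF L])
    fix h assume "h \<in> range (blinfun_apply p)"
    then have "cinner (x - blinfun_apply p x) h = cinner (x - blinfun_apply p x) (blinfun_apply p h)"
      by (simp only: proj_range_iff[OF assms(1)])
    also have "\<dots> = cinner (blinfun_apply p (x - blinfun_apply p x)) h"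
      using assms by (simp add: proj_cinner)
    finally show "cinner (x - blinfun_apply p x) h = 0"
      using assms by (simp add: blinfun.diff_right proj_idem)
  qed
  then have "A o\<^sub>L p = A" by (intro blinfun_eqI) (simp add: blinfun.diff_right)
  moreover have "q o\<^sub>L A = A"
    using Bop_range[OF L] proj_range_iff[OF assms(2)] by (intro blinfun_eqI) simp
  ultimately show ?R using Bop_clin[OF L] by blast
next
  assume R: ?R
  show ?L
  proof (rule BopI)
    show "blinfun_apply A x \<in> range (blinfun_apply q)" for x
      by (metis R blinfun_apply_blinfun_compose rangeI)
    fix x assume x: "\<And>h. h \<in> range (blinfun_apply p) \<Longrightarrow> cinner x h = 0"
    have "blinfun_apply p x = 0"
      by (rule cinner_eqI) (simp add: proj_cinner[OF assms(1)] x)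
    then show "blinfun_apply A x = 0" by (metis R blinfun.zero_right blinfun_apply_blinfun_compose)
  qed (use R in blast)
qed

lemma projections_range_iff:
  assumes "proj p"
  shows "r \<in> projections (range (blinfun_apply p)) \<longleftrightarrow> proj r \<and> p o\<^sub>L r = r \<and> r o\<^sub>L p = r"
  unfolding projections_def mem_Collect_eq Bop_range_iff[OF assms assms] proj_def by blast

lemma proj_rank_one:
  assumes "norm x = 1" shows "proj (rank_one x x)"
proof -
  have "orthonormal (\<lambda>_. x) 1" using assms by (simp add: orthonormal_def cinner_self)
  from proj_partial_isom[OF this] show ?thesis by (simp add: partial_isom_def)
qed

text \<open>The bound \<open>m \<le> card S\<close> is what later bounds the dimensions of reducing
  pairs. It is an inequality because a vector already in the span is skipped.\<close>

lemma Gram_Schmidt: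
  fixes S :: "'a::chilbert_space set"
  assumes "finite S"
  shows "\<exists>e m. m \<le> card S \<and> orthonormal e m \<and> cvec.span S = cvec.span (e ` {..<m})"
  using assms
proof (induction S rule: finite_induct)
  case empty
  show ?case by (intro exI[of _ "\<lambda>_. 0"] exI[of _ 0]) (simp add: orthonormal_def)
next
  case (insert x S)
  then obtain e m where em: "m \<le> card S" "orthonormal e m" "cvec.span S = cvec.span (e ` {..<m})"
    by blast
  define z where "z = blinfun_apply (partial_isom e e m) x"
  have zS: "z \<in> cvec.span (e ` {..<m})"
    unfolding z_def partial_isom_apply
    by (intro cvec.span_sum cvec.span_scale cvec.span_base) simp
  define w where "w = x - z"
  have orth: "cinner w (e i) = 0" if "i < m" for i
    using proj_cinner[OF proj_partial_isom[OF em(2)], of x "e i"] partial_isom_vector[OF em(2) that, of e]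
    by (simp add: w_def z_def cinner_diff_left)
  have sp: "cvec.span (insert x S) = cvec.span (insert w (e ` {..<m}))"
  proof -
    have "cvec.span (insert x S) = cvec.span (insert x (e ` {..<m}))"
      using em(3) by (simp add: cvec.span_insert)
    also have "\<dots> = cvec.span (insert w (e ` {..<m}))"
    proof (rule cvec.eq_span_insert_eq)
      show "x - w \<in> cvec.span (e ` {..<m})" using zS by (simp add: w_def)
    qed
    finally show ?thesis .
  qed
  show ?case
  proof (cases "w = 0")
    case True
    then have "cvec.span (insert x S) = cvec.span (e ` {..<m})"
      using sp by (simp add: cvec.span_insert_0)
    then show ?thesis using em insert.hyps by (intro exI[of _ e] exI[of _ m]) simp
  next
    case False
    define u where "u = complex_of_real (1 / norm w) *\<^sub>C w"
    define e' where "e' = e(m := u)"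
    have uu: "cinner u u = 1" using False
      by (simp add: cinner_self u_def norm_scaleC norm_divide)
    have uo: "cinner u (e i) = 0" "cinner (e i) u = 0" if "i < m" for i
      using orth[OF that] cinner_commute[of "e i" u]
      by (simp_all add: u_def cinner_scaleC_left)
    have "orthonormal e' (Suc m)"
      using em(2) uo uu by (auto simp: orthonormal_def e'_def less_Suc_eq)
    moreover have "e' ` {..<Suc m} = insert u (e ` {..<m})"
      by (auto simp: e'_def lessThan_Suc)
    moreover have "cvec.span (insert u (e ` {..<m})) = cvec.span (insert w (e ` {..<m}))"
    proof (rule subset_antisym; rule cvec.span_minimal[OF _ cvec.subspace_span]; rule insert_subsetI)
      have "w = complex_of_real (norm w) *\<^sub>C u"
        using False by (simp add: u_def scaleC_scaleC scaleC_one)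
      then show "w \<in> cvec.span (insert u (e ` {..<m}))"
        by (metis cvec.span_base cvec.span_scale insertI1)
      show "u \<in> cvec.span (insert w (e ` {..<m}))"
        unfolding u_def by (intro cvec.span_scale cvec.span_base) simp
    qed (auto intro: cvec.span_base)
    ultimately show ?thesis using sp em(1) insert.hyps
      by (intro exI[of _ e'] exI[of _ "Suc m"]) simp
  qed
qed

lemma partial_isom_span:
  assumes "orthonormal e m"
  shows "range (blinfun_apply (partial_isom e e m)) = cvec.span (e ` {..<m})"
proof
  show "range (blinfun_apply (partial_isom e e m)) \<subseteq> cvec.span (e ` {..<m})"
    by (auto simp: partial_isom_apply intro!: cvec.span_sum cvec.span_scale intro: cvec.span_base)
  show "cvec.span (e ` {..<m}) \<subseteq> range (blinfun_apply (partial_isom e e m))"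
  proof (rule cvec.span_minimal)
    show "e ` {..<m} \<subseteq> range (blinfun_apply (partial_isom e e m))"
      using partial_isom_vector[OF assms, of _ e] by (metis image_subsetI lessThan_iff rangeI)
  qed (simp add: csubspace_range)
qed

section \<open>Complete contractions\<close>

text \<open>Matrix norm at most one, written without supremum and square root, so that it can be
  tested one family of vectors at a time.\<close>

definition mat_contraction ::
    "nat \<Rightarrow> (nat \<Rightarrow> nat \<Rightarrow> 'a::chilbert_space \<Rightarrow>\<^sub>L 'b::chilbert_space) \<Rightarrow> bool" where
  "mat_contraction n A \<longleftrightarrow> (\<forall>\<xi>. (\<Sum>i<n. (norm (\<Sum>j<n. blinfun_apply (A i j) (\<xi> j)))\<^sup>2)
     \<le> (\<Sum>j<n. (norm (\<xi> j))\<^sup>2))"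

lemma mat_norm_le_1_iff: "mat_norm n A \<le> 1 \<longleftrightarrow> mat_contraction n A"
proof -
  define N where "N \<xi> = L2_set (\<lambda>i. norm (\<Sum>j<n. blinfun_apply (A i j) (\<xi> j))) {..<n}" for \<xi>
  define M where "M \<xi> = L2_set (\<lambda>j. norm (\<xi> j)) {..<n}" for \<xi> :: "nat \<Rightarrow> 'a"
  define S where "S = {N \<xi> | \<xi>. M \<xi> \<le> 1}"
  have norm_def: "mat_norm n A = Sup S" by (simp add: mat_norm_def S_def N_def M_def)
  have M0: "M (\<lambda>_. 0) \<le> 1" by (simp add: M_def L2_set_def)
  have bdd: "bdd_above S"
  proof (rule bdd_aboveI)
    fix r assume "r \<in> S"
    then obtain \<xi> where r: "r = N \<xi>" "M \<xi> \<le> 1" by (auto simp: S_def)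
    have 1: "norm (\<xi> j) \<le> 1" if "j < n" for j
      using member_le_L2_set[of "{..<n}" j "\<lambda>j. norm (\<xi> j)"] that r(2) by (simp add: M_def)
    have "N \<xi> \<le> (\<Sum>i<n. norm (\<Sum>j<n. blinfun_apply (A i j) (\<xi> j)))"
      unfolding N_def by (rule L2_set_le_sum) simp
    also have "\<dots> \<le> (\<Sum>i<n. \<Sum>j<n. norm (A i j) * 1)"
      by (intro sum_mono order.trans[OF norm_sum] order.trans[OF norm_blinfun] mult_left_mono)
        (auto simp: 1)
    finally show "r \<le> (\<Sum>i<n. \<Sum>j<n. norm (A i j))" using r by simp
  qed
  have eq: "mat_contraction n A \<longleftrightarrow> (\<forall>\<xi>. N \<xi> \<le> M \<xi>)"
    by (simp add: mat_contraction_def N_def M_def L2_set_def)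
  show ?thesis unfolding eq norm_def
  proof
    assume le: "Sup S \<le> 1"
    show "\<forall>\<xi>. N \<xi> \<le> M \<xi>"
    proof
      fix \<xi>
      have M_nonneg: "M \<xi> \<ge> 0" by (simp add: M_def L2_set_nonneg)
      have N_scale: "N (\<lambda>j. r *\<^sub>R \<xi> j) = r * N \<xi>" if "r \<ge> 0" for r
        using that by (simp add: N_def blinfun.scaleR_right L2_set_right_distrib
          flip: scaleR_sum_right)
      have M_scale: "M (\<lambda>j. r *\<^sub>R \<xi> j) = r * M \<xi>" if "r \<ge> 0" for r
        using that by (simp add: M_def L2_set_right_distrib)
      \<comment> \<open>The supremum sees only the unit ball, so a general vector is rescaled into
        it; one with \<open>M \<xi> = 0\<close> cannot be rescaled and is treated apart.\<close>
      show "N \<xi> \<le> M \<xi>"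
      proof (cases "M \<xi> = 0")
        case True
        then have "\<xi> j = 0" if "j < n" for j
          using that by (simp add: M_def L2_set_eq_0_iff)
        then show ?thesis using True by (simp add: N_def L2_set_def)
      next
        case False
        have "N (\<lambda>j. inverse (M \<xi>) *\<^sub>R \<xi> j) \<in> S"
          using False M_nonneg by (auto simp: S_def M_scale intro!: exI[of _ "\<lambda>j. inverse (M \<xi>) *\<^sub>R \<xi> j"])
        then have "N (\<lambda>j. inverse (M \<xi>) *\<^sub>R \<xi> j) \<le> 1"
          using cSup_upper[OF _ bdd] le by force
        then show ?thesis using False M_nonneg by (simp add: N_scale field_simps)
      qed
    qed
  next
    assume "\<forall>\<xi>. N \<xi> \<le> M \<xi>"
    then show "Sup S \<le> 1"
      using M0 by (intro cSup_least) (auto simp: S_def intro: order_trans)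
  qed
qed

lemma completely_contractive_iff:
  "completely_contractive X \<phi> \<longleftrightarrow>
    (\<forall>n A. (\<forall>i<n. \<forall>j<n. A i j \<in> X) \<longrightarrow> mat_contraction n A \<longrightarrow> mat_contraction n (\<lambda>i j. \<phi> (A i j)))"
  unfolding completely_contractive_def cb_norm_def amplification_norm_def SUP_le_iff
  by (auto simp: mat_norm_le_1_iff one_ereal_def)

lemma completely_contractiveD:
  assumes "completely_contractive X \<phi>" "\<And>i j. i < n \<Longrightarrow> j < n \<Longrightarrow> A i j \<in> X" "mat_contraction n A"
  shows "mat_contraction n (\<lambda>i j. \<phi> (A i j))"
  using assms unfolding completely_contractive_iff by blast

lemma cb_norm_mono: "X \<subseteq> Y \<Longrightarrow> cb_norm X \<phi> \<le> cb_norm Y \<phi>"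
  unfolding cb_norm_def amplification_norm_def
  by (rule SUP_subset_mono[OF order_refl], rule SUP_subset_mono) auto

lemma mat_norm_cong:
  assumes "\<And>i j. i < n \<Longrightarrow> j < n \<Longrightarrow> A i j = B i j"
  shows "mat_norm n A = mat_norm n B"
proof -
  have "L2_set (\<lambda>i. norm (\<Sum>j<n. blinfun_apply (A i j) (\<xi> j))) {..<n}
      = L2_set (\<lambda>i. norm (\<Sum>j<n. blinfun_apply (B i j) (\<xi> j))) {..<n}" for \<xi>
    using assms by (intro L2_set_cong refl arg_cong[of _ _ norm] sum.cong) auto
  then show ?thesis by (simp add: mat_norm_def)
qed

lemma cb_norm_cong: "(\<And>x. x \<in> X \<Longrightarrow> \<phi> x = \<psi> x) \<Longrightarrow> cb_norm X \<phi> = cb_norm X \<psi>"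
  unfolding cb_norm_def amplification_norm_def
  by (intro SUP_cong refl arg_cong[of _ _ ereal] mat_norm_cong) auto

lemma norm_le_1_apply: "norm A \<le> 1 \<Longrightarrow> norm (blinfun_apply A x) \<le> norm x"
  using norm_blinfun[of A x] mult_right_mono[of "norm A" 1 "norm x"] by simp

lemma mat_contraction_compress:
  assumes A: "mat_contraction n A" and "norm U \<le> 1" "norm V \<le> 1"
  shows "mat_contraction n (\<lambda>i j. V o\<^sub>L A i j o\<^sub>L U)"
  unfolding mat_contraction_def
proof
  fix \<xi>
  have "(\<Sum>i<n. (norm (\<Sum>j<n. blinfun_apply (V o\<^sub>L A i j o\<^sub>L U) (\<xi> j)))\<^sup>2)
      = (\<Sum>i<n. (norm (blinfun_apply V (\<Sum>j<n. blinfun_apply (A i j) (blinfun_apply U (\<xi> j)))))\<^sup>2)"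
    by (simp add: blinfun.sum_right)
  also have "\<dots> \<le> (\<Sum>i<n. (norm (\<Sum>j<n. blinfun_apply (A i j) (blinfun_apply U (\<xi> j))))\<^sup>2)"
    using assms by (intro sum_mono power_mono norm_le_1_apply) auto
  also have "\<dots> \<le> (\<Sum>j<n. (norm (blinfun_apply U (\<xi> j)))\<^sup>2)"
    using A unfolding mat_contraction_def by (rule spec)
  also have "\<dots> \<le> (\<Sum>j<n. (norm (\<xi> j))\<^sup>2)"
    using assms by (intro sum_mono power_mono norm_le_1_apply) auto
  finally show "(\<Sum>i<n. (norm (\<Sum>j<n. blinfun_apply (V o\<^sub>L A i j o\<^sub>L U) (\<xi> j)))\<^sup>2)
    \<le> (\<Sum>j<n. (norm (\<xi> j))\<^sup>2)" .
qed

lemma completely_contractive_compress: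
  assumes "completely_contractive X \<phi>" "norm U \<le> 1" "norm V \<le> 1"
  shows "completely_contractive X (\<lambda>x. V o\<^sub>L \<phi> x o\<^sub>L U)"
  unfolding completely_contractive_iff
  by (intro allI impI mat_contraction_compress completely_contractiveD[OF assms(1)] assms(2,3)) auto

lemma completely_contractive_comp:
  assumes "completely_contractive X \<pi>" "completely_contractive Y \<phi>" "\<pi> ` X \<subseteq> Y"
  shows "completely_contractive X (\<lambda>x. \<phi> (\<pi> x))"
  using assms unfolding completely_contractive_iff image_subset_iff by simp

text \<open>For a fixed matrix and fixed vectors the inequality involves only finitely many values
  of the map, so it survives pointwise limits along a proper filter.\<close>

lemma completely_contractive_lim:
  fixes \<psi> :: "('a::chilbert_space \<Rightarrow>\<^sub>L 'b::chilbert_space) \<Rightarrow> ('c::chilbert_space \<Rightarrow>\<^sub>L 'd::chilbert_space)"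
  assumes F: "F \<noteq> bot" and cc: "eventually (\<lambda>k. completely_contractive X (\<phi> k)) F"
    and lim: "\<And>x. x \<in> X \<Longrightarrow> ((\<lambda>k. \<phi> k x) \<longlongrightarrow> \<psi> x) F"
  shows "completely_contractive X \<psi>"
  unfolding completely_contractive_iff mat_contraction_def
proof (intro allI impI)
  fix n :: nat and A and \<xi> :: "nat \<Rightarrow> 'c"
  assume A: "\<forall>i<(n::nat). \<forall>j<(n::nat). A i j \<in> X"
    and le: "\<forall>\<xi>. (\<Sum>i<n. (norm (\<Sum>j<n. blinfun_apply (A i j) (\<xi> j)))\<^sup>2) \<le> (\<Sum>j<n. (norm (\<xi> j))\<^sup>2)"
  let ?f = "\<lambda>\<phi> :: ('a \<Rightarrow>\<^sub>L 'b) \<Rightarrow> ('c \<Rightarrow>\<^sub>L 'd). \<Sum>i<n. (norm (\<Sum>j<n. blinfun_apply (\<phi> (A i j)) (\<xi> j)))\<^sup>2"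
  show "?f \<psi> \<le> (\<Sum>j<n. (norm (\<xi> j))\<^sup>2)"
  proof (rule tendsto_upperbound[OF _ _ F])
    show "((\<lambda>k. ?f (\<phi> k)) \<longlongrightarrow> ?f \<psi>) F"
      using A by (intro tendsto_intros blinfun.tendsto lim) auto
    show "eventually (\<lambda>k. ?f (\<phi> k) \<le> (\<Sum>j<n. (norm (\<xi> j))\<^sup>2)) F"
      using cc
    proof eventually_elim
      case (elim k)
      have "mat_contraction n (\<lambda>i j. \<phi> k (A i j))"
        using completely_contractiveD[OF elim] A le unfolding mat_contraction_def by blast
      then show ?case unfolding mat_contraction_def by blast
    qed
  qed
qed

text \<open>The column with entries \<open>xs\<close>, as one operator into a Hilbert sum, has norm
  at most one. Lists are used because a supremum over columns of all lengths is taken later.\<close>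

definition col_contraction :: "('a::chilbert_space \<Rightarrow>\<^sub>L 'b::chilbert_space) list \<Rightarrow> bool" where
  "col_contraction xs \<longleftrightarrow> (\<forall>v. (\<Sum>x\<leftarrow>xs. (norm (blinfun_apply x v))\<^sup>2) \<le> (norm v)\<^sup>2)"

lemma completely_contractive_column:
  fixes \<phi> :: "('a::chilbert_space \<Rightarrow>\<^sub>L 'b::chilbert_space) \<Rightarrow> ('c::chilbert_space \<Rightarrow>\<^sub>L 'd::chilbert_space)"
  assumes cc: "completely_contractive T \<phi>" and zero: "0 \<in> T" "\<phi> 0 = 0"
    and xs: "set xs \<subseteq> T" "col_contraction xs"
  shows "col_contraction (map \<phi> xs)"
proof (cases "xs = []")
  case True
  then show ?thesis by (simp add: col_contraction_def)
next
  case False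
  define n where "n = length xs"
  have n: "0 < n" using False by (simp add: n_def)
  \<comment> \<open>Complete contractivity speaks of square matrices, so the column is padded with
    zeros; this is where \<open>0 \<in> T\<close> and \<open>\<phi> 0 = 0\<close> enter.\<close>
  define A where "A i j = (if j = 0 then xs ! i else 0)" for i j :: nat
  have col: "(\<Sum>j<n. blinfun_apply (B j) (\<xi> j)) = blinfun_apply (B 0) (\<xi> 0)"
    if "\<And>j. j \<noteq> 0 \<Longrightarrow> B j = 0" for B :: "nat \<Rightarrow> 'x::chilbert_space \<Rightarrow>\<^sub>L 'y::chilbert_space" and \<xi>
    using that n by (subst sum.remove[of _ 0]) (auto intro!: sum.neutral)
  have len: "(\<Sum>x\<leftarrow>xs. f x) = (\<Sum>i<n. f (xs ! i))" for f :: "_ \<Rightarrow> real"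
    by (simp add: n_def sum_list_sum_nth lessThan_atLeast0)
  have "mat_contraction n A"
    unfolding mat_contraction_def
  proof
    fix \<xi> :: "nat \<Rightarrow> 'a"
    have "(\<Sum>i<n. (norm (\<Sum>j<n. blinfun_apply (A i j) (\<xi> j)))\<^sup>2)
        = (\<Sum>x\<leftarrow>xs. (norm (blinfun_apply x (\<xi> 0)))\<^sup>2)"
      unfolding len by (intro sum.cong refl arg_cong[of _ _ "\<lambda>v. (norm v)\<^sup>2"], subst col) (auto simp: A_def)
    also have "\<dots> \<le> (norm (\<xi> 0))\<^sup>2" using xs(2) by (simp add: col_contraction_def)
    also have "\<dots> \<le> (\<Sum>j<n. (norm (\<xi> j))\<^sup>2)" using n by (intro member_le_sum) auto
    finally show "(\<Sum>i<n. (norm (\<Sum>j<n. blinfun_apply (A i j) (\<xi> j)))\<^sup>2)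
        \<le> (\<Sum>j<n. (norm (\<xi> j))\<^sup>2)" .
  qed
  moreover have "A i j \<in> T" if "i < n" "j < n" for i j
    using that xs(1) zero by (auto simp: A_def n_def)
  ultimately have c: "mat_contraction n (\<lambda>i j. \<phi> (A i j))"
    using completely_contractiveD[OF cc] by blast
  show ?thesis
    unfolding col_contraction_def
  proof
    fix v :: 'c
    let ?\<xi> = "\<lambda>j::nat. if j = 0 then v else 0"
    have "(\<Sum>x\<leftarrow>map \<phi> xs. (norm (blinfun_apply x v))\<^sup>2)
        = (\<Sum>x\<leftarrow>xs. (norm (blinfun_apply (\<phi> x) v))\<^sup>2)" by (simp add: o_def)
    also have "\<dots> = (\<Sum>i<n. (norm (\<Sum>j<n. blinfun_apply (\<phi> (A i j)) (?\<xi> j)))\<^sup>2)"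
      unfolding len
      by (intro sum.cong refl arg_cong[of _ _ "\<lambda>v. (norm v)\<^sup>2"], subst col)
        (auto simp: A_def zero)
    also have "\<dots> \<le> (\<Sum>j<n. (norm (?\<xi> j))\<^sup>2)"
      using c unfolding mat_contraction_def by (rule spec)
    also have "\<dots> = (norm v)\<^sup>2"
      using n by (subst sum.remove[of _ 0]) (auto intro!: sum.neutral)
    finally show "(\<Sum>x\<leftarrow>map \<phi> xs. (norm (blinfun_apply x v))\<^sup>2) \<le> (norm v)\<^sup>2" .
  qed
qed

lemma completely_contractive_norm:
  assumes cc: "completely_contractive T \<phi>" and zero: "0 \<in> T" "\<phi> 0 = 0"
    and x: "x \<in> T" "norm x \<le> 1"
  shows "norm (\<phi> x) \<le> 1"
proof -
  have "col_contraction [x]"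
    by (simp add: col_contraction_def power_mono norm_le_1_apply[OF x(2)])
  then have "col_contraction (map \<phi> [x])"
    by (intro completely_contractive_column[OF cc zero]) (simp_all add: x(1))
  then have "norm (blinfun_apply (\<phi> x) v) \<le> 1 * norm v" for v
    by (simp add: col_contraction_def)
  then show ?thesis by (rule norm_blinfun_bound[rotated]) simp
qed

section \<open>Finite-dimensional ternary rings of operators\<close>

lemma Bop_subspace:
  assumes K: "cvec.subspace K" shows "cop.subspace (Bop H K)"
proof (rule cop.subspaceI)
  show "0 \<in> Bop H K" by (rule BopI) (simp_all add: cvec.subspace_0 K)
next
  fix A B assume A: "A \<in> Bop H K" and B: "B \<in> Bop H K"
  show "A + B \<in> Bop H K"
  proof (rule BopI)
    show "blinfun_apply (A + B) x = 0" if "\<And>h. h \<in> H \<Longrightarrow> cinner x h = 0" for x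
      using Bop_kernel[OF A that] Bop_kernel[OF B that] by (simp add: blinfun.add_left)
  qed (simp_all add: clin_add Bop_clin[OF A] Bop_clin[OF B] blinfun.add_left
      cvec.subspace_add[OF K Bop_range[OF A] Bop_range[OF B]])
next
  fix c A assume A: "A \<in> Bop H K"
  show "cscale c A \<in> Bop H K"
  proof (rule BopI)
    show "blinfun_apply (cscale c A) x = 0" if "\<And>h. h \<in> H \<Longrightarrow> cinner x h = 0" for x
      using Bop_kernel[OF A that] by (simp add: cscale_apply)
  qed (simp_all add: clin_cscale Bop_clin[OF A] cscale_apply cvec.subspace_scale[OF K Bop_range[OF A]])
qed

lemma Bop_closed:
  fixes H :: "'a::chilbert_space set" and K :: "'b::chilbert_space set"
  assumes "closed K" shows "closed (Bop H K)"
  unfolding closed_sequential_limits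
proof (intro allI impI, elim conjE)
  fix A :: "nat \<Rightarrow> 'a \<Rightarrow>\<^sub>L 'b" and B
  assume A: "\<forall>n. A n \<in> Bop H K" and "A \<longlonglongrightarrow> B"
  then have lim: "(\<lambda>n. blinfun_apply (A n) x) \<longlonglongrightarrow> blinfun_apply B x" for x
    by (intro blinfun.tendsto tendsto_const)
  show "B \<in> Bop H K"
  proof (rule BopI)
    show "clin B" unfolding clin_def
    proof (intro allI)
      fix c x
      have "(\<lambda>n. blinfun_apply (A n) (c *\<^sub>C x)) \<longlonglongrightarrow> c *\<^sub>C blinfun_apply B x"
        using bounded_linear.tendsto[OF bounded_linear_scaleC lim[of x], of c] A
        by (simp add: Bop_def)
      then show "blinfun_apply B (c *\<^sub>C x) = c *\<^sub>C blinfun_apply B x"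
        using LIMSEQ_unique lim by blast
    qed
    show "blinfun_apply B x \<in> K" for x
      using closed_sequentially[OF assms _ lim[of x]] A by (simp add: Bop_def)
    show "blinfun_apply B x = 0" if x: "\<And>h. h \<in> H \<Longrightarrow> cinner x h = 0" for x
    proof -
      have "blinfun_apply (A n) x = 0" for n
        using Bop_kernel[of "A n" H K x] A x by simp
      then have "(\<lambda>n. 0) \<longlonglongrightarrow> blinfun_apply B x" using lim[of x] by simp
      then show ?thesis using LIMSEQ_unique tendsto_const by blast
    qed
  qed
qed

lemma triple_apply:
  "blinfun_apply (triple x y z) v = blinfun_apply x (blinfun_apply (adj y) (blinfun_apply z v))"
  by (simp add: triple_def)

lemma Bop_triple:
  assumes "x \<in> Bop H K" "y \<in> Bop H K" "z \<in> Bop H K"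
  shows "triple x y z \<in> Bop H K"
proof (rule BopI)
  show "clin (triple x y z)"
    unfolding triple_def using assms by (intro clin_compose clin_adj Bop_clin)
  show "blinfun_apply (triple x y z) v \<in> K" for v
    unfolding triple_apply using assms(1) by (rule Bop_range)
  show "blinfun_apply (triple x y z) v = 0" if "\<And>h. h \<in> H \<Longrightarrow> cinner v h = 0" for v
    using Bop_kernel[OF assms(3) that] by (simp add: triple_apply)
qed

lemma tro_Bop: "hilbert K \<Longrightarrow> tro H K (Bop H K)"
  by (simp add: tro_def hilbert_def Bop_subspace Bop_closed Bop_triple)

text \<open>\<open>Bop H K\<close> is a member of the intersected family, which keeps the
  intersection inside it; the other conditions are stable under intersection.\<close>

lemma tro_generated:
  assumes "hilbert K" "X \<subseteq> Bop H K"
  shows "tro H K (generated_tro H K X)"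
proof -
  let ?F = "{S. tro H K S \<and> X \<subseteq> S}"
  have B: "Bop H K \<in> ?F" using assms tro_Bop by blast
  have sub: "cop.subspace (\<Inter>?F)"
    by (rule cop.subspace_Inter) (simp add: tro_def)
  have clo: "closed (\<Inter>?F)" by (rule closed_Inter) (simp add: tro_def)
  have "triple x y z \<in> S" if "x \<in> \<Inter>?F" "y \<in> \<Inter>?F" "z \<in> \<Inter>?F" "S \<in> ?F" for x y z S
    using that unfolding tro_def by blast
  then have "\<forall>x\<in>\<Inter>?F. \<forall>y\<in>\<Inter>?F. \<forall>z\<in>\<Inter>?F. triple x y z \<in> \<Inter>?F" by blast
  moreover have "\<Inter>?F \<subseteq> Bop H K" using B by (rule Inter_lower)
  ultimately show ?thesis unfolding generated_tro_def tro_def[of H K "\<Inter>?F"] using sub clo by blast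
qed

section \<open>Closedness of finite-dimensional operator spaces\<close>

lemma tendsto_cscale:
  assumes "(c \<longlongrightarrow> l) F" shows "((\<lambda>n. cscale (c n) A) \<longlongrightarrow> cscale l A) F"
proof (rule LIM_zero_cancel)
  have "((\<lambda>n. cmod (c n - l) * norm A) \<longlongrightarrow> 0) F"
    using assms by (intro tendsto_mult_left_zero) (simp add: LIM_zero_iff tendsto_norm_zero_iff)
  then have "((\<lambda>n. norm (cscale (c n) A - cscale l A)) \<longlongrightarrow> 0) F"
    by (simp add: norm_cscale flip: cop.scale_left_diff_distrib)
  then show "((\<lambda>n. cscale (c n) A - cscale l A) \<longlongrightarrow> 0) F"
    by (simp add: tendsto_norm_zero_iff)
qed

text \<open>The bound makes the coordinates of a convergent sequence Cauchy, so the limit is a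
  combination of the same elements of \<open>B\<close>.\<close>

lemma closed_span_of_coordinate_bound:
  fixes B :: "('a::chilbert_space \<Rightarrow>\<^sub>L 'b::chilbert_space) set"
  assumes fin: "finite B"
    and bd: "\<And>u b. b \<in> B \<Longrightarrow> cmod (u b) \<le> C * norm (\<Sum>b\<in>B. cscale (u b) b)"
  shows "closed (cop.span B)"
  unfolding closed_sequential_limits
proof (intro allI impI, elim conjE)
  fix y l
  assume "\<forall>n. y n \<in> cop.span B" and lim: "y \<longlonglongrightarrow> l"
  then have "\<exists>u. y n = (\<Sum>b\<in>B. cscale (u b) b)" for n
    using cop.span_finite[OF fin] by auto
  then obtain u where u: "y n = (\<Sum>b\<in>B. cscale (u n b) b)" for n by metis
  have "convergent (\<lambda>n. u n b)" if b: "b \<in> B" for b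
  proof (rule Cauchy_convergent, rule metric_CauchyI)
    fix e :: real assume "e > 0"
    then have "e / (\<bar>C\<bar> + 1) > 0" by simp
    then obtain N where N: "\<And>m n. m \<ge> N \<Longrightarrow> n \<ge> N \<Longrightarrow> dist (y m) (y n) < e / (\<bar>C\<bar> + 1)"
      using LIMSEQ_imp_Cauchy[OF lim] unfolding Cauchy_def by blast
    have "dist (u m b) (u n b) < e" if "m \<ge> N" "n \<ge> N" for m n
    proof -
      have "dist (u m b) (u n b) \<le> C * dist (y m) (y n)"
        using bd[OF b, of "\<lambda>b. u m b - u n b"]
        by (simp add: dist_norm u cop.scale_left_diff_distrib sum_subtractf)
      also have "\<dots> \<le> (\<bar>C\<bar> + 1) * dist (y m) (y n)" by (intro mult_right_mono) auto
      also have "\<dots> < e" using N[OF that] by (simp add: field_simps)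
      finally show ?thesis .
    qed
    then show "\<exists>M. \<forall>m\<ge>M. \<forall>n\<ge>M. dist (u m b) (u n b) < e" by blast
  qed
  then have "\<forall>b. \<exists>v. b \<in> B \<longrightarrow> (\<lambda>n. u n b) \<longlonglongrightarrow> v" unfolding convergent_def by blast
  then obtain v where v: "\<And>b. b \<in> B \<Longrightarrow> (\<lambda>n. u n b) \<longlonglongrightarrow> v b" by metis
  have "(\<lambda>n. cscale (u n b) b) \<longlonglongrightarrow> cscale (v b) b" if "b \<in> B" for b
    by (rule tendsto_cscale[OF v[OF that]])
  then have "(\<lambda>n. \<Sum>b\<in>B. cscale (u n b) b) \<longlonglongrightarrow> (\<Sum>b\<in>B. cscale (v b) b)" by (rule tendsto_sum)
  then have "y \<longlonglongrightarrow> (\<Sum>b\<in>B. cscale (v b) b)" by (simp flip: u)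
  then have "l = (\<Sum>b\<in>B. cscale (v b) b)" using lim LIMSEQ_unique by blast
  then show "l \<in> cop.span B"
    by (auto intro: cop.span_sum cop.span_scale cop.span_base)
qed

text \<open>Induction that feeds on the preceding lemma: the bound for \<open>B\<close> makes its
  span closed, so a further independent \<open>x\<close> has positive distance \<open>d\<close> from
  it.\<close>

lemma coordinate_bound:
  fixes B :: "('a::chilbert_space \<Rightarrow>\<^sub>L 'b::chilbert_space) set"
  assumes "finite B" "cop.independent B"
  shows "\<exists>C. \<forall>u. \<forall>b\<in>B. cmod (u b) \<le> C * norm (\<Sum>b\<in>B. cscale (u b) b)"
  using assms
proof (induction B rule: finite_induct)
  case (insert x B)
  then have ind: "cop.independent B" and x: "x \<notin> cop.span B"
    by (auto simp: cop.independent_insert)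
  from insert.IH[OF ind] obtain C
    where C: "\<And>u b. b \<in> B \<Longrightarrow> cmod (u b) \<le> C * norm (\<Sum>b\<in>B. cscale (u b) b)" by blast
  define d where "d = infdist x (cop.span B)"
  have d: "d > 0" unfolding d_def
    using closed_span_of_coordinate_bound[OF insert.hyps(1) C] x cop.span_zero
    by (intro infdist_pos_not_in_closed) auto
  \<comment> \<open>\<open>1 / d\<close> bounds the coordinate at \<open>x\<close>. The others obey
    the bound for \<open>B\<close>, applied to what remains after removing the \<open>x\<close>
    part; its norm has grown at most by the factor \<open>1 + norm x / d\<close>.\<close>
  define D where "D = max (1 / d) (\<bar>C\<bar> * (1 + norm x / d))"
  have "cmod (u b) \<le> D * norm (\<Sum>b\<in>insert x B. cscale (u b) b)" if b: "b \<in> insert x B" for u b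
  proof -
    define s where "s = (\<Sum>b\<in>B. cscale (u b) b)"
    have tot: "(\<Sum>b\<in>insert x B. cscale (u b) b) = cscale (u x) x + s"
      using insert.hyps by (simp add: s_def)
    have s: "s \<in> cop.span B"
      unfolding s_def by (intro cop.span_sum cop.span_scale cop.span_base)
    have ux: "cmod (u x) \<le> norm (cscale (u x) x + s) / d"
    proof (cases "u x = 0")
      case False
      have "- cscale (inverse (u x)) s \<in> cop.span B" using s by (intro cop.span_neg cop.span_scale)
      then have "d \<le> norm (x + cscale (inverse (u x)) s)"
        unfolding d_def using infdist_le[of "- cscale (inverse (u x)) s" "cop.span B" x]
        by (simp add: dist_norm)
      then have "cmod (u x) * d \<le> norm (cscale (u x) (x + cscale (inverse (u x)) s))"
        by (simp add: norm_cscale mult_left_mono)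
      also have "\<dots> = norm (cscale (u x) x + s)"
        using False by (simp add: cop.scale_right_distrib)
      finally show ?thesis using d by (simp add: field_simps)
    qed (use d in simp)
    show ?thesis
    proof (cases "b = x")
      case True
      have "norm (cscale (u x) x + s) / d \<le> D * norm (cscale (u x) x + s)"
        using mult_right_mono[of "1 / d" D "norm (cscale (u x) x + s)"] by (simp add: D_def)
      then show ?thesis using ux unfolding tot True by linarith
    next
      case False
      let ?N = "norm (cscale (u x) x + s)"
      have "norm s \<le> ?N + norm (cscale (u x) x)"
        using norm_triangle_ineq4[of "cscale (u x) x + s" "cscale (u x) x"] by simp
      also have "\<dots> \<le> ?N + ?N / d * norm x"
        using mult_right_mono[OF ux, of "norm x"] by (simp add: norm_cscale)
      finally have ns: "norm s \<le> (1 + norm x / d) * ?N" by (simp add: field_simps)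
      have "cmod (u b) \<le> C * norm s" unfolding s_def using False b by (intro C) simp
      also have "\<dots> \<le> \<bar>C\<bar> * norm s" by (intro mult_right_mono) auto
      also have "\<dots> \<le> \<bar>C\<bar> * ((1 + norm x / d) * ?N)" by (intro mult_left_mono ns) auto
      also have "\<dots> \<le> D * ?N"
        unfolding mult.assoc[symmetric] D_def by (intro mult_right_mono) auto
      finally show ?thesis unfolding tot .
    qed
  qed
  then show ?case by blast
qed auto

lemma finite_dimensional_basis:
  fixes S :: "('a::chilbert_space \<Rightarrow>\<^sub>L 'b::chilbert_space) set"
  assumes "cop.subspace S" "S \<subseteq> cop.span F" "finite F"
  obtains B where "finite B" "cop.independent B" "cop.span B = S" "B \<subseteq> S"
proof -
  obtain B where B: "B \<subseteq> S" "cop.independent B" "S \<subseteq> cop.span B"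
    using cop.maximal_independent_subset by blast
  have "finite B" using cop.independent_span_bound[OF assms(3) B(2)] B(1) assms(2) by blast
  moreover have "cop.span B = S" using B assms(1) cop.span_minimal by blast
  ultimately show thesis using that B by blast
qed

lemma finite_dimensional_closed:
  fixes S :: "('a::chilbert_space \<Rightarrow>\<^sub>L 'b::chilbert_space) set"
  assumes "cop.subspace S" "S \<subseteq> cop.span F" "finite F"
  shows "closed S"
proof -
  obtain B where B: "finite B" "cop.independent B" "cop.span B = S"
    by (rule finite_dimensional_basis[OF assms])
  obtain C where C: "\<forall>u. \<forall>b\<in>B. cmod (u b) \<le> C * norm (\<Sum>b\<in>B. cscale (u b) b)"
    using coordinate_bound[OF B(1,2)] ..
  show ?thesis
    unfolding B(3)[symmetric] using C by (intro closed_span_of_coordinate_bound[OF B(1)]) blast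
qed

section \<open>Linear maps, representations and the standing assumptions\<close>

lemma linear_mapD:
  assumes "linear_map T H K \<phi>"
  shows "x \<in> T \<Longrightarrow> \<phi> x \<in> Bop H K"
    and "x \<in> T \<Longrightarrow> y \<in> T \<Longrightarrow> \<phi> (x + y) = \<phi> x + \<phi> y"
    and "x \<in> T \<Longrightarrow> \<phi> (cscale c x) = cscale c (\<phi> x)"
  using assms unfolding linear_map_def by blast+

lemma linear_map_0: "linear_map T H K \<phi> \<Longrightarrow> cop.subspace T \<Longrightarrow> \<phi> 0 = 0"
  using linear_mapD(3)[of T H K \<phi> 0 0] by (simp add: cop.subspace_0)

lemma linear_map_minus: "linear_map T H K \<phi> \<Longrightarrow> x \<in> T \<Longrightarrow> \<phi> (- x) = - \<phi> x"
  using linear_mapD(3)[of T H K \<phi> x "-1"] by (simp add: cop.scale_minus_left)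

lemma linear_map_diff:
  assumes "linear_map T H K \<phi>" "cop.subspace T" "x \<in> T" "y \<in> T"
  shows "\<phi> (x - y) = \<phi> x - \<phi> y"
  using linear_mapD(2)[OF assms(1,3), of "- y"] linear_map_minus[OF assms(1,4)]
    cop.subspace_neg[OF assms(2,4)] by simp

lemma linear_map_sum:
  assumes "linear_map T H K \<phi>" "cop.subspace T" "\<And>i. i \<in> I \<Longrightarrow> f i \<in> T"
  shows "\<phi> (sum f I) = (\<Sum>i\<in>I. \<phi> (f i))"
  using assms(3)
proof (induction I rule: infinite_finite_induct)
  case (insert i I)
  then show ?case
    by (simp add: linear_mapD(2)[OF assms(1)] cop.subspace_sum[OF assms(2)])
qed (simp_all add: linear_map_0[OF assms(1,2)])

lemma representation_linear: "representation T H K \<theta> \<Longrightarrow> linear_map T H K \<theta>"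
  by (simp add: representation_def)

lemma representation_triple:
  "representation T H K \<theta> \<Longrightarrow> x \<in> T \<Longrightarrow> y \<in> T \<Longrightarrow> z \<in> T \<Longrightarrow>
    \<theta> (triple x y z) = triple (\<theta> x) (\<theta> y) (\<theta> z)"
  by (simp add: representation_def)

text \<open>The \<open>itself\<close> parameters fix the two types whose subspaces the assumption
  \<open>boundary\<close> ranges over, so that the whole context uses it at the same types.\<close>

locale boundary_tro =
  fixes H\<^sub>0 :: "'a::chilbert_space set" and K\<^sub>0 :: "'b::chilbert_space set"
    and X T :: "('a \<Rightarrow>\<^sub>L 'b) set"
    and univ\<^sub>H :: "'c::chilbert_space itself" and univ\<^sub>K :: "'d::chilbert_space itself"
  assumes hilbert: "hilbert H\<^sub>0" "hilbert K\<^sub>0"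
    and X: "operator_space H\<^sub>0 K\<^sub>0 X"
    and T: "T = generated_tro H\<^sub>0 K\<^sub>0 X"
    and fin: "finite_dimensional T"
    and boundary: "\<And>(H :: 'c::chilbert_space set) (K :: 'd::chilbert_space set) \<pi>.
           hilbert H \<Longrightarrow> hilbert K \<Longrightarrow> irreducible_representation T H K \<pi> \<Longrightarrow>
           boundary_representation X T H K \<pi>"
begin

lemma tro_T: "tro H\<^sub>0 K\<^sub>0 T"
  using tro_generated[OF hilbert(2), of X H\<^sub>0] X by (simp add: T operator_space_def)

lemma subspace_T: "cop.subspace T" using tro_T by (simp add: tro_def)

lemma T_Bop: "T \<subseteq> Bop H\<^sub>0 K\<^sub>0" using tro_T by (simp add: tro_def)

lemma clin_T: "x \<in> T \<Longrightarrow> clin x" using T_Bop Bop_clin by blast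

lemma triple_T: "x \<in> T \<Longrightarrow> y \<in> T \<Longrightarrow> z \<in> T \<Longrightarrow> triple x y z \<in> T"
  using tro_T by (simp add: tro_def)

lemma X_T: "X \<subseteq> T" unfolding T generated_tro_def by blast

lemma T_minimal: "tro H\<^sub>0 K\<^sub>0 S \<Longrightarrow> X \<subseteq> S \<Longrightarrow> T \<subseteq> S"
  unfolding T generated_tro_def by blast

text \<open>The set of agreement is a TRO containing \<open>X\<close>. Its closedness comes from
  finite dimension, so no continuity of the representations enters.\<close>

lemma representation_eq_on_T:
  assumes \<theta>: "representation T H K \<theta>" and \<sigma>: "representation T H K \<sigma>"
    and eq: "\<And>x. x \<in> X \<Longrightarrow> \<theta> x = \<sigma> x" and t: "t \<in> T"
  shows "\<theta> t = \<sigma> t"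
proof -
  note l = representation_linear[OF \<theta>] representation_linear[OF \<sigma>]
  let ?S = "{t \<in> T. \<theta> t = \<sigma> t}"
  have sub: "cop.subspace ?S"
    using subspace_T by (intro cop.subspaceI)
      (auto simp: linear_map_0[OF l(1)] linear_map_0[OF l(2)] linear_mapD[OF l(1)] linear_mapD[OF l(2)]
        cop.subspace_0 cop.subspace_add cop.subspace_scale)
  obtain F where "finite F" "T \<subseteq> cop.span F" using fin unfolding finite_dimensional_def by blast
  then have "closed ?S" using sub by (intro finite_dimensional_closed[where F = F]) auto
  then have "tro H\<^sub>0 K\<^sub>0 ?S"
    using sub T_Bop by (auto simp: tro_def triple_T representation_triple[OF \<theta>] representation_triple[OF \<sigma>])
  then have "T \<subseteq> ?S" using X_T eq by (intro T_minimal) auto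
  then show ?thesis using t by blast
qed

text \<open>The unique extension property speaks only of rectangular states. A completely
  contractive map that agrees with \<open>\<sigma>\<close> on \<open>X\<close> is one: nondegeneracy
  and the lower bound on the cb norm are inherited from the restriction to \<open>X\<close>.\<close>

lemma irreducible_extension_unique:
  fixes H :: "'c set" and K :: "'d set"
  assumes HK: "hilbert H" "hilbert K" and \<sigma>: "irreducible_representation T H K \<sigma>"
    and \<psi>: "linear_map T H K \<psi>" "completely_contractive T \<psi>"
    and eq: "\<And>x. x \<in> X \<Longrightarrow> \<psi> x = \<sigma> x" and t: "t \<in> T"
  shows "\<psi> t = \<sigma> t"
proof -
  have uep: "unique_extension_property X T H K \<sigma>"
    using boundary[OF HK \<sigma>] by (simp add: boundary_representation_def)
  then have st: "rectangular_state X H K \<sigma>" by (simp add: unique_extension_property_def)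
  have nd: "nondegenerate T H K \<psi>"
    unfolding nondegenerate_def
  proof (intro ballI impI)
    fix p q assume "p \<in> projections H" "q \<in> projections K"
      and "\<forall>x\<in>T. q o\<^sub>L \<psi> x = 0 \<and> \<psi> x o\<^sub>L p = 0"
    moreover from this have "\<forall>x\<in>X. q o\<^sub>L \<sigma> x = 0 \<and> \<sigma> x o\<^sub>L p = 0"
      using X_T by (auto simp flip: eq)
    ultimately show "p = 0 \<and> q = 0"
      using st unfolding rectangular_state_def nondegenerate_def by blast
  qed
  have "1 = cb_norm X \<psi>"
    using st cb_norm_cong[of X \<psi> \<sigma>] eq by (simp add: rectangular_state_def)
  also have "\<dots> \<le> cb_norm T \<psi>" by (rule cb_norm_mono[OF X_T])
  finally have "cb_norm T \<psi> = 1"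
    using \<psi>(2) by (simp add: completely_contractive_def)
  then have "rectangular_state T H K \<psi>" using \<psi> nd by (simp add: rectangular_state_def)
  then have "representation T H K \<psi>"
    using uep eq unfolding unique_extension_property_def by blast
  moreover have "representation T H K \<sigma>"
    using \<sigma> unfolding irreducible_representation_def ..
  ultimately show ?thesis by (rule representation_eq_on_T[OF _ _ eq t])
qed

text \<open>The extension supplied by the boundary property is a rectangular state, hence completely
  contractive, and by uniqueness it coincides with \<open>\<sigma>\<close> on
  \<open>T\<close>.\<close>

lemma irreducible_completely_contractive:
  fixes H :: "'c set" and K :: "'d set"
  assumes HK: "hilbert H" "hilbert K" and \<sigma>: "irreducible_representation T H K \<sigma>"
  shows "completely_contractive T \<sigma>"
proof -
  obtain \<psi> where \<psi>: "rectangular_state T H K \<psi>" "\<And>x. x \<in> X \<Longrightarrow> \<psi> x = \<sigma> x"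
    using boundary[OF HK \<sigma>] by (auto simp: boundary_representation_def)
  have "\<psi> t = \<sigma> t" if "t \<in> T" for t
    using \<psi>(1) unfolding rectangular_state_def
    by (intro irreducible_extension_unique[OF HK \<sigma> _ _ \<psi>(2) that]) simp_all
  then have "cb_norm T \<psi> = cb_norm T \<sigma>" by (rule cb_norm_cong)
  then show ?thesis using \<psi>(1) by (simp add: rectangular_state_def completely_contractive_def)
qed

end

section \<open>Reconstruction and reducing pairs of projections\<close>

text \<open>The rank-one projection onto a common kernel vector, paired with \<open>q = 0\<close>,
  would contradict nondegeneracy.\<close>

lemma nondegenerate_kernel:
  assumes nd: "nondegenerate T H K \<pi>" and H: "cvec.subspace H" and K: "cvec.subspace K"
    and clin: "\<And>t. t \<in> T \<Longrightarrow> clin (\<pi> t)"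
    and x: "x \<in> H" "\<And>t. t \<in> T \<Longrightarrow> blinfun_apply (\<pi> t) x = 0"
  shows "x = 0"
proof (rule ccontr)
  assume nz: "x \<noteq> 0"
  define n where "n = complex_of_real (1 / norm x) *\<^sub>C x"
  have n1: "norm n = 1" using nz by (simp add: n_def norm_scaleC norm_divide)
  have nH: "n \<in> H" unfolding n_def by (rule cvec.subspace_scale[OF H x(1)])
  have "rank_one n n \<in> Bop H H"
  proof (rule BopI)
    show "blinfun_apply (rank_one n n) z \<in> H" for z
      unfolding rank_one_apply by (rule cvec.subspace_scale[OF H nH])
    show "blinfun_apply (rank_one n n) z = 0" if "\<And>h. h \<in> H \<Longrightarrow> cinner z h = 0" for z
      using that[OF nH] by (simp add: rank_one_apply)
  qed simp
  then have p: "rank_one n n \<in> projections H"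
    using proj_rank_one[OF n1] by (simp add: projections_def proj_def)
  have q: "0 \<in> projections K"
    using cvec.subspace_0[OF K] by (auto simp: projections_def intro!: BopI blinfun_eqI)
  have z: "\<pi> t o\<^sub>L rank_one n n = 0" if "t \<in> T" for t
    using x(2)[OF that] by (intro blinfun_eqI) (simp add: rank_one_apply n_def clinD[OF clin[OF that]])
  have "rank_one n n = 0"
    using nd p q z unfolding nondegenerate_def by fastforce
  then have "blinfun_apply (rank_one n n) n = 0" by simp
  then have "n = 0" using n1 by (simp add: rank_one_apply cinner_self scaleC_one)
  then show False using n1 by simp
qed

context boundary_tro
begin

text \<open>\<open>L\<close> is right multiplication by the sum of \<open>adj c o\<^sub>L c\<close>
  over the basis. If \<open>L x = 0\<close>, testing at a vector \<open>y\<close> in the range of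
  \<open>adj x\<close> shows that every \<open>c\<close> kills \<open>y\<close>, hence so does
  \<open>x\<close>, and \<open>y = 0\<close>. An injective map of a finite-dimensional space into
  itself is onto, which gives \<open>u\<close>.\<close>

lemma T_reconstruction:
  obtains B u where "finite B" "B \<subseteq> T" "cop.span B = T" "\<And>b. b \<in> B \<Longrightarrow> u b \<in> T"
    "\<And>b. b \<in> B \<Longrightarrow> b = (\<Sum>c\<in>B. triple (u b) c c)"
proof -
  obtain F where F: "finite F" "T \<subseteq> cop.span F" using fin unfolding finite_dimensional_def by blast
  obtain B where B: "finite B" "cop.independent B" "cop.span B = T" "B \<subseteq> T"
    by (rule finite_dimensional_basis[OF subspace_T F(2,1)])
  define L :: "('a \<Rightarrow>\<^sub>L 'b) \<Rightarrow> ('a \<Rightarrow>\<^sub>L 'b)" where "L x = (\<Sum>c\<in>B. triple x c c)" for x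
  have Lv: "blinfun_apply (L x) v = blinfun_apply x (\<Sum>c\<in>B. blinfun_apply (adj c) (blinfun_apply c v))" for x v
    by (simp add: L_def blinfun.sum_left blinfun.sum_right triple_apply)
  interpret L: Vector_Spaces.linear cscale cscale L
    by unfold_locales (auto intro!: blinfun_eqI simp: Lv blinfun.add_left cscale_apply)
  have LT: "L x \<in> T" if "x \<in> T" for x
    unfolding L_def using that B(4) by (intro cop.subspace_sum subspace_T triple_T) auto
  have inj: "x = 0" if x: "x \<in> T" and L0: "L x = 0" for x
  proof -
    have cl: "clin x" by (rule clin_T[OF x])
    have cB: "clin c" if "c \<in> B" for c using B(4) that clin_T by blast
    have "blinfun_apply (adj x) w = 0" for w
    proof -
      define y where "y = blinfun_apply (adj x) w"
      have "0 = cinner (blinfun_apply (L x) y) w" using L0 by simp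
      also have "\<dots> = (\<Sum>c\<in>B. cinner (blinfun_apply c y) (blinfun_apply c y))"
        unfolding Lv cinner_adj[OF cl] y_def[symmetric] cinner_sum_left
        by (intro sum.cong refl cinner_adj_left cB)
      also have "\<dots> = of_real (\<Sum>c\<in>B. (norm (blinfun_apply c y))\<^sup>2)" by (simp add: cinner_self)
      finally have "(\<Sum>c\<in>B. (norm (blinfun_apply c y))\<^sup>2) = 0"
        by (metis of_real_eq_0_iff)
      then have cy: "blinfun_apply c y = 0" if "c \<in> B" for c
        using that B(1) by (simp add: sum_nonneg_eq_0_iff)
      have "cop.subspace {t. blinfun_apply t y = 0}"
        by (auto intro!: cop.subspaceI simp: blinfun.add_left cscale_apply)
      then have "cop.span B \<subseteq> {t. blinfun_apply t y = 0}"
        using cy by (intro cop.span_minimal) auto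
      then have "blinfun_apply x y = 0" using x B(3) by blast
      then have "cinner y y = 0"
        using cinner_adj[OF cl, of y w] by (simp add: y_def)
      then show ?thesis by (simp add: y_def)
    qed
    then have "adj x = 0" by (intro blinfun_eqI) simp
    then show ?thesis using adj_adj[OF cl] by simp
  qed
  have "inj_on L (cop.span B)"
    unfolding B(3) by (rule inj_onI) (metis L.diff cop.subspace_diff[OF subspace_T] eq_iff_diff_eq_0 inj)
  then have ind: "cop.independent (L ` B)" and injB: "inj_on L B"
    using L.independent_injective_image[OF B(2)] cop.span_superset inj_on_subset by blast+
  \<comment> \<open>Injective implies onto, by counting: a \<open>t\<close> outside the span would
    yield \<open>card B + 1\<close> independent elements of \<open>cop.span B\<close>.\<close>
  have T_sub: "T \<subseteq> cop.span (L ` B)"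
  proof
    fix t assume t: "t \<in> T"
    show "t \<in> cop.span (L ` B)"
    proof (rule ccontr)
      assume n: "t \<notin> cop.span (L ` B)"
      then have "cop.independent (insert t (L ` B))" using ind by (simp add: cop.independent_insertI)
      moreover have "insert t (L ` B) \<subseteq> cop.span B" using t LT B(3,4) by auto
      ultimately have "card (insert t (L ` B)) \<le> card B"
        using cop.independent_span_bound[OF B(1)] by blast
      moreover have "t \<notin> L ` B" using n cop.span_superset by blast
      ultimately show False using B(1) injB by (simp add: card_image)
    qed
  qed
  have "\<exists>u. u \<in> T \<and> b = L u" if "b \<in> B" for b
  proof -
    have "b \<in> L ` cop.span B" using T_sub B(4) that by (auto simp: L.span_image[symmetric])
    then show ?thesis using B(3) by auto
  qed
  then obtain u where "\<And>b. b \<in> B \<Longrightarrow> u b \<in> T \<and> b = L (u b)" by metis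
  then show thesis using that[OF B(1,4,3), of u] by (simp add: L_def)
qed

text \<open>By the identity in \<open>T\<close>, \<open>\<pi> b\<close> equals
  \<open>\<pi> (u b)\<close> after \<open>a\<close>. Hence \<open>v\<close> and \<open>?e\<close>
  have equal inner products with every \<open>a w\<close>; taking for \<open>w\<close> their
  difference \<open>x\<close> makes all \<open>\<pi> c\<close> vanish at \<open>x\<close>, and
  nondegeneracy gives \<open>x = 0\<close>. A finite sum over fixed elements survives compression
  and limits, unlike the quantification over projections in \<open>nondegenerate\<close>.\<close>

lemma representation_reconstruction:
  assumes \<pi>: "representation T H K \<pi>" and nd: "nondegenerate T H K \<pi>" and H: "cvec.subspace H" "closed H"
    and K: "cvec.subspace K"
  obtains B u where "finite B" "B \<subseteq> T" "\<And>b. b \<in> B \<Longrightarrow> u b \<in> T"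
    "\<And>v. v \<in> H \<Longrightarrow> v = (\<Sum>b\<in>B. blinfun_apply (adj (\<pi> (u b))) (blinfun_apply (\<pi> b) v))"
proof -
  obtain B u where B: "finite B" "B \<subseteq> T" "cop.span B = T" "\<And>b. b \<in> B \<Longrightarrow> u b \<in> T"
    "\<And>b. b \<in> B \<Longrightarrow> b = (\<Sum>c\<in>B. triple (u b) c c)"
    by (rule T_reconstruction) blast
  note lin = representation_linear[OF \<pi>]
  have cl: "clin (\<pi> t)" if "t \<in> T" for t
    by (rule Bop_clin[OF linear_mapD(1)[OF lin that]])
  define a where "a w = (\<Sum>c\<in>B. blinfun_apply (adj (\<pi> c)) (blinfun_apply (\<pi> c) w))" for w
  have \<pi>b: "blinfun_apply (\<pi> b) w = blinfun_apply (\<pi> (u b)) (a w)" if b: "b \<in> B" for b w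
  proof -
    have mem: "triple (u b) c c \<in> T" if "c \<in> B" for c
      using B(2,4) b that by (intro triple_T) auto
    have "\<pi> b = \<pi> (\<Sum>c\<in>B. triple (u b) c c)" using B(5)[OF b] by (rule arg_cong)
    also have "\<dots> = (\<Sum>c\<in>B. \<pi> (triple (u b) c c))"
      by (rule linear_map_sum[OF lin subspace_T mem])
    also have "\<dots> = (\<Sum>c\<in>B. triple (\<pi> (u b)) (\<pi> c) (\<pi> c))"
      using B(2,4) b by (intro sum.cong refl representation_triple[OF \<pi>]) auto
    finally show ?thesis by (simp add: a_def blinfun.sum_left blinfun.sum_right triple_apply)
  qed
  have "v = (\<Sum>b\<in>B. blinfun_apply (adj (\<pi> (u b))) (blinfun_apply (\<pi> b) v))" (is "v = ?e") if v: "v \<in> H" for v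
  proof -
    define x where "x = v - ?e"
    have eH: "?e \<in> H"
      by (intro cvec.subspace_sum[OF H(1)] Bop_adj_range[OF linear_mapD(1)[OF lin B(4)] H])
    have xH: "x \<in> H" unfolding x_def by (rule cvec.subspace_diff[OF H(1) v eH])
    have "cinner (a w) v = cinner (a w) ?e" for w
    proof -
      have "cinner (a w) v = (\<Sum>b\<in>B. cinner (blinfun_apply (\<pi> b) w) (blinfun_apply (\<pi> b) v))"
        unfolding a_def cinner_sum_left using B(2) by (intro sum.cong refl cinner_adj_left cl) auto
      also have "\<dots> = (\<Sum>b\<in>B. cinner (blinfun_apply (\<pi> (u b)) (a w)) (blinfun_apply (\<pi> b) v))"
        by (intro sum.cong refl) (simp only: \<pi>b)
      also have "\<dots> = cinner (a w) ?e"
        unfolding cinner_sum_right using B(4) by (intro sum.cong refl cinner_adj cl)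
      finally show ?thesis .
    qed
    then have "0 = cinner (a x) x" by (simp add: x_def cinner_diff_right)
    also have "\<dots> = (\<Sum>c\<in>B. cinner (blinfun_apply (\<pi> c) x) (blinfun_apply (\<pi> c) x))"
      unfolding a_def cinner_sum_left using B(2) by (intro sum.cong refl cinner_adj_left cl) auto
    also have "\<dots> = of_real (\<Sum>c\<in>B. (norm (blinfun_apply (\<pi> c) x))\<^sup>2)" by (simp add: cinner_self)
    finally have "(\<Sum>c\<in>B. (norm (blinfun_apply (\<pi> c) x))\<^sup>2) = 0"
      by (metis of_real_eq_0_iff)
    then have cx: "blinfun_apply (\<pi> c) x = 0" if "c \<in> B" for c
      using that B(1) by (simp add: sum_nonneg_eq_0_iff)
    have "cop.subspace {t \<in> T. blinfun_apply (\<pi> t) x = 0}"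
      by (rule cop.subspaceI)
        (auto simp: blinfun.add_left cscale_apply linear_map_0[OF lin subspace_T] linear_mapD[OF lin]
          cop.subspace_0[OF subspace_T] cop.subspace_add[OF subspace_T] cop.subspace_scale[OF subspace_T])
    then have "cop.span B \<subseteq> {t \<in> T. blinfun_apply (\<pi> t) x = 0}"
      using cx B(2) by (intro cop.span_minimal) auto
    then have "x = 0"
      using B(3) by (intro nondegenerate_kernel[OF nd H(1) K cl xH]) auto
    then show ?thesis by (simp add: x_def)
  qed
  then show thesis by (intro that[of B u] B(1,2,4))
qed

end

section \<open>Reducing pairs of projections\<close>

definition intertwining ::
    "('a::chilbert_space \<Rightarrow>\<^sub>L 'b::chilbert_space) set \<Rightarrow> (('a \<Rightarrow>\<^sub>L 'b) \<Rightarrow> ('c::chilbert_space \<Rightarrow>\<^sub>L 'd::chilbert_space))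
      \<Rightarrow> ('c \<Rightarrow>\<^sub>L 'c) \<Rightarrow> ('d \<Rightarrow>\<^sub>L 'd) \<Rightarrow> bool" where
  "intertwining T \<theta> p q \<longleftrightarrow> proj p \<and> proj q \<and> (\<forall>t\<in>T. q o\<^sub>L \<theta> t = \<theta> t o\<^sub>L p)"

lemma intertwiningD:
  "intertwining T \<theta> p q \<Longrightarrow> t \<in> T \<Longrightarrow>
    blinfun_apply q (blinfun_apply (\<theta> t) v) = blinfun_apply (\<theta> t) (blinfun_apply p v)"
  unfolding intertwining_def by (metis blinfun_apply_blinfun_compose)

lemma intertwining_adj:
  assumes pq: "intertwining T \<theta> p q" and t: "t \<in> T" and cl: "clin (\<theta> t)"
  shows "adj (\<theta> t) o\<^sub>L q = p o\<^sub>L adj (\<theta> t)"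
proof -
  have P: "proj p" "proj q" "q o\<^sub>L \<theta> t = \<theta> t o\<^sub>L p" using pq t by (auto simp: intertwining_def)
  have "adj (q o\<^sub>L \<theta> t) = adj (\<theta> t o\<^sub>L p)" using P(3) by (rule arg_cong)
  then show ?thesis using P(1,2) cl by (simp add: adj_compose proj_clin proj_adj)
qed

lemma linear_map_compress:
  assumes \<phi>: "linear_map T H K \<phi>" and p: "proj p" and q: "proj q"
  shows "linear_map T (range (blinfun_apply p)) (range (blinfun_apply q)) (\<lambda>t. q o\<^sub>L \<phi> t o\<^sub>L p)"
  unfolding linear_map_def
proof (intro conjI ballI allI)
  fix x assume x: "x \<in> T"
  have cl: "clin (\<phi> x)" by (rule Bop_clin[OF linear_mapD(1)[OF \<phi> x]])
  show "q o\<^sub>L \<phi> x o\<^sub>L p \<in> Bop (range (blinfun_apply p)) (range (blinfun_apply q))"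
    unfolding Bop_range_iff[OF p q] using p q cl
    by (auto intro!: clin_compose proj_clin blinfun_eqI simp: proj_idem)
  show "q o\<^sub>L \<phi> (cscale c x) o\<^sub>L p = cscale c (q o\<^sub>L \<phi> x o\<^sub>L p)" for c
    unfolding linear_mapD(3)[OF \<phi> x]
    by (rule blinfun_eqI) (simp add: cscale_apply clinD[OF proj_clin[OF q]])
  fix y assume y: "y \<in> T"
  show "q o\<^sub>L \<phi> (x + y) o\<^sub>L p = (q o\<^sub>L \<phi> x o\<^sub>L p) + (q o\<^sub>L \<phi> y o\<^sub>L p)"
    unfolding linear_mapD(2)[OF \<phi> x y]
    by (rule blinfun_eqI) (simp add: blinfun.add_left blinfun.add_right)
qed

text \<open>Cutting by \<open>p\<close> on the right already cuts by \<open>q\<close> on the left.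
  In a triple product the inner \<open>p\<close> passes through \<open>adj (\<theta> y)\<close>,
  becomes \<open>q\<close>, and is absorbed by the last factor.\<close>

lemma representation_restrict:
  assumes \<theta>: "representation T H K \<theta>" and pq: "intertwining T \<theta> p q"
    and triple_closed: "\<And>x y z. x \<in> T \<Longrightarrow> y \<in> T \<Longrightarrow> z \<in> T \<Longrightarrow> triple x y z \<in> T"
  shows "representation T (range (blinfun_apply p)) (range (blinfun_apply q)) (\<lambda>t. \<theta> t o\<^sub>L p)"
proof -
  note lin = representation_linear[OF \<theta>]
  have P: "proj p" "proj q" using pq by (auto simp: intertwining_def)
  have cl: "clin (\<theta> t)" if "t \<in> T" for t
    by (rule Bop_clin[OF linear_mapD(1)[OF lin that]])
  have eq: "q o\<^sub>L \<theta> t o\<^sub>L p = \<theta> t o\<^sub>L p" if "t \<in> T" for t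
    using P(1) by (intro blinfun_eqI) (simp add: intertwiningD[OF pq that] proj_idem)
  have "linear_map T (range (blinfun_apply p)) (range (blinfun_apply q)) (\<lambda>t. \<theta> t o\<^sub>L p)"
    unfolding linear_map_def
  proof (intro conjI ballI allI)
    fix x assume x: "x \<in> T"
    show "\<theta> x o\<^sub>L p \<in> Bop (range (blinfun_apply p)) (range (blinfun_apply q))"
      using linear_mapD(1)[OF linear_map_compress[OF lin P] x] by (simp only: eq[OF x])
    show "\<theta> (cscale c x) o\<^sub>L p = cscale c (\<theta> x o\<^sub>L p)" for c
      unfolding linear_mapD(3)[OF lin x] by (rule blinfun_eqI) (simp add: cscale_apply)
    fix y assume y: "y \<in> T"
    show "\<theta> (x + y) o\<^sub>L p = (\<theta> x o\<^sub>L p) + (\<theta> y o\<^sub>L p)"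
      unfolding linear_mapD(2)[OF lin x y] by (rule blinfun_eqI) (simp add: blinfun.add_left)
  qed
  moreover have "\<theta> (triple x y z) o\<^sub>L p = triple (\<theta> x o\<^sub>L p) (\<theta> y o\<^sub>L p) (\<theta> z o\<^sub>L p)"
    if "x \<in> T" "y \<in> T" "z \<in> T" for x y z
  proof (rule blinfun_eqI)
    fix v
    have a: "adj (\<theta> y o\<^sub>L p) = p o\<^sub>L adj (\<theta> y)"
      using P(1) cl[OF that(2)] by (simp add: adj_compose proj_clin proj_adj)
    have b: "blinfun_apply (adj (\<theta> y)) (blinfun_apply q w) = blinfun_apply p (blinfun_apply (adj (\<theta> y)) w)" for w
      using intertwining_adj[OF pq that(2) cl[OF that(2)]] by (metis blinfun_apply_blinfun_compose)
    have "blinfun_apply (triple (\<theta> x o\<^sub>L p) (\<theta> y o\<^sub>L p) (\<theta> z o\<^sub>L p)) v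
      = blinfun_apply (\<theta> x) (blinfun_apply (adj (\<theta> y)) (blinfun_apply q (blinfun_apply (\<theta> z) (blinfun_apply p v))))"
      by (simp add: triple_apply a b proj_idem[OF P(1)])
    also have "\<dots> = blinfun_apply (\<theta> (triple x y z) o\<^sub>L p) v"
      using that by (simp add: representation_triple[OF \<theta>] triple_apply intertwiningD[OF pq] proj_idem[OF P(1)])
    finally show "blinfun_apply (\<theta> (triple x y z) o\<^sub>L p) v
      = blinfun_apply (triple (\<theta> x o\<^sub>L p) (\<theta> y o\<^sub>L p) (\<theta> z o\<^sub>L p)) v" by simp
  qed
  ultimately show ?thesis by (simp add: representation_def)
qed

section \<open>Dimension count and complements of reducing pairs\<close>

lemma cvec_dim_strict:
  fixes A B :: "'a::chilbert_space set"
  assumes A: "cvec.subspace A" and B: "B \<subseteq> cvec.span F" "finite F" and AB: "A \<subset> B"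
  shows "cvec.dim A < cvec.dim B"
proof -
  obtain BA where BA: "BA \<subseteq> A" "cvec.independent BA" "A \<subseteq> cvec.span BA"
    using cvec.maximal_independent_subset by blast
  obtain BB where BB: "BA \<subseteq> BB" "BB \<subseteq> B" "cvec.independent BB" "B \<subseteq> cvec.span BB"
    using cvec.maximal_independent_subset_extend[OF _ BA(2), of B] BA(1) AB by blast
  have fin: "finite BB" using cvec.independent_span_bound[OF B(2) BB(3)] BB(2) B(1) by blast
  have "BA \<noteq> BB" using BB(4) BA(1) AB cvec.span_minimal[OF BA(1) A] by blast
  then have "card BA < card BB" using BB(1) fin by (simp add: psubset_card_mono psubset_eq)
  then show ?thesis using BA BB by (metis cvec.basis_card_eq_dim)
qed

lemma cvec_dim_mono:
  fixes A B :: "'a::chilbert_space set"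
  assumes "cvec.subspace A" "B \<subseteq> cvec.span F" "finite F" "A \<subseteq> B"
  shows "cvec.dim A \<le> cvec.dim B"
  using cvec_dim_strict[OF assms(1-3)] assms(4) by (metis order_less_imp_le order_refl psubsetI)

text \<open>Frames rather than projections are recorded because transport to a fixed model needs
  bases. \<open>S\<close> and \<open>R\<close> are vectors to be captured, and \<open>n\<close>
  bounds both dimensions.\<close>

definition reducing_system where
  "reducing_system T H K \<pi> S R n e m f k \<longleftrightarrow> m \<le> n \<and> k \<le> n \<and>
     orthonormal e m \<and> orthonormal f k \<and> intertwining T \<pi> (partial_isom e e m) (partial_isom f f k) \<and>
     S \<subseteq> range (blinfun_apply (partial_isom e e m)) \<and> R \<subseteq> range (blinfun_apply (partial_isom f f k)) \<and>
     range (blinfun_apply (partial_isom e e m)) \<subseteq> H \<and> range (blinfun_apply (partial_isom f f k)) \<subseteq> K"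

lemma proj_diff:
  assumes "proj p" "proj r" "p o\<^sub>L r = r" "r o\<^sub>L p = r"
  shows "proj (p - r)"
proof -
  have a: "blinfun_apply p (blinfun_apply r v) = blinfun_apply r v"
    and b: "blinfun_apply r (blinfun_apply p v) = blinfun_apply r v" for v
    using assms(3,4) by (metis blinfun_apply_blinfun_compose)+
  have "(p - r) o\<^sub>L (p - r) = p - r"
    by (rule blinfun_eqI)
      (simp add: blinfun.diff_left blinfun.diff_right a b proj_idem[OF assms(1)] proj_idem[OF assms(2)])
  then show ?thesis using assms(1,2) by (simp add: proj_def clin_diff adj_diff)
qed

lemma intertwining_diff:
  assumes "intertwining T \<theta> p q" "intertwining T \<theta> p' q'"
    and "p o\<^sub>L p' = p'" "p' o\<^sub>L p = p'" "q o\<^sub>L q' = q'" "q' o\<^sub>L q = q'"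
  shows "intertwining T \<theta> (p - p') (q - q')"
  unfolding intertwining_def
proof (intro conjI ballI)
  show "proj (p - p')" "proj (q - q')"
    using assms by (auto simp: intertwining_def intro!: proj_diff)
  show "(q - q') o\<^sub>L \<theta> t = \<theta> t o\<^sub>L (p - p')" if "t \<in> T" for t
    by (rule blinfun_eqI) (simp add: blinfun.diff_left blinfun.diff_right
        intertwiningD[OF assms(1) that] intertwiningD[OF assms(2) that])
qed

lemma range_subset_of_comp: "p o\<^sub>L r = r \<Longrightarrow> range (blinfun_apply r) \<subseteq> range (blinfun_apply p)"
  by (metis blinfun_apply_blinfun_compose image_subsetI rangeI)

lemma range_eq_proj:
  assumes "proj p" "proj r" "r o\<^sub>L p = r" "range (blinfun_apply p) = range (blinfun_apply r)"
  shows "r = p"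
proof (rule blinfun_eqI)
  fix v
  have "blinfun_apply p v \<in> range (blinfun_apply r)" using assms(4) by blast
  then have "blinfun_apply r (blinfun_apply p v) = blinfun_apply p v"
    using proj_range_iff[OF assms(2)] by blast
  then show "blinfun_apply r v = blinfun_apply p v"
    using assms(3) by (metis blinfun_apply_blinfun_compose)
qed

context boundary_tro
begin

text \<open>Induction on the total dimension of a pair: if the restriction to \<open>(p, q)\<close>
  is reducible, the witnessing projections and their complements form two smaller orthogonal pairs.
  The base case allows every \<open>q\<close>, since a splitting may produce \<open>p' = 0\<close>
  with \<open>q'\<close> nonzero.\<close>

lemma decomposition_induct:
  fixes \<theta> :: "('a \<Rightarrow>\<^sub>L 'b) \<Rightarrow> ('e::chilbert_space \<Rightarrow>\<^sub>L 'f::chilbert_space)"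
  assumes \<theta>: "representation T H K \<theta>" and pq: "intertwining T \<theta> p q"
    and F: "finite F" "range (blinfun_apply p) \<subseteq> cvec.span F"
    and G: "finite G" "range (blinfun_apply q) \<subseteq> cvec.span G"
    and ker: "\<And>v. blinfun_apply p v = v \<Longrightarrow> (\<And>t. t \<in> T \<Longrightarrow> blinfun_apply (\<theta> t) v = 0) \<Longrightarrow> v = 0"
    and zero: "\<And>q. P 0 q"
    and irr: "\<And>p q. intertwining T \<theta> p q \<Longrightarrow> range (blinfun_apply p) \<subseteq> cvec.span F \<Longrightarrow> hilbert (range (blinfun_apply p)) \<Longrightarrow>
        hilbert (range (blinfun_apply q)) \<Longrightarrow>
        irreducible_representation T (range (blinfun_apply p)) (range (blinfun_apply q)) (\<lambda>t. \<theta> t o\<^sub>L p) \<Longrightarrow>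
        P p q"
    and sum: "\<And>p q p' q'. intertwining T \<theta> p q \<Longrightarrow> intertwining T \<theta> p' q' \<Longrightarrow>
        p o\<^sub>L p' = 0 \<Longrightarrow> q o\<^sub>L q' = 0 \<Longrightarrow> P p q \<Longrightarrow> P p' q' \<Longrightarrow> P (p + p') (q + q')"
  shows "P p q"
  using pq F(2) G(2) ker
proof (induction "cvec.dim (range (blinfun_apply p)) + cvec.dim (range (blinfun_apply q))"
    arbitrary: p q rule: less_induct)
  case less
  note pq = less.prems(1)
  have P: "proj p" "proj q" using pq by (auto simp: intertwining_def)
  show ?case
  proof (cases "p = 0")
    case True
    then show ?thesis using zero by simp
  next
    case p0: False
    \<comment> \<open>\<open>hilbert\<close> excludes the zero space. With \<open>q = 0\<close>
      every \<open>\<theta> t\<close> would vanish on the range of \<open>p\<close>, against the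
      kernel assumption.\<close>
    have q0: "q \<noteq> 0"
    proof
      assume "q = 0"
      then have "blinfun_apply (\<theta> t) (blinfun_apply p v) = 0" if "t \<in> T" for t v
        using intertwiningD[OF pq that, of v] by simp
      then have "blinfun_apply p v = 0" for v
        using less.prems(4)[of "blinfun_apply p v"] proj_idem[OF P(1)] by simp
      then show False using p0 by (auto intro: blinfun_eqI)
    qed
    have hil: "hilbert (range (blinfun_apply p))" "hilbert (range (blinfun_apply q))"
      using P p0 q0 by (auto intro: hilbert_range_proj)
    show ?thesis
    proof (cases "irreducible_representation T (range (blinfun_apply p)) (range (blinfun_apply q)) (\<lambda>t. \<theta> t o\<^sub>L p)")
      case True
      then show ?thesis using irr pq less.prems(2) hil by simp
    next
      case False
      then obtain p' q' where p': "p' \<in> projections (range (blinfun_apply p))"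
        and q': "q' \<in> projections (range (blinfun_apply q))"
        and int: "\<And>t. t \<in> T \<Longrightarrow> q' o\<^sub>L (\<theta> t o\<^sub>L p) = (\<theta> t o\<^sub>L p) o\<^sub>L p'"
        and n0: "\<not> (p' = 0 \<and> q' = 0)"
        and n1: "\<not> ((\<forall>h\<in>range (blinfun_apply p). blinfun_apply p' h = h)
                  \<and> (\<forall>k\<in>range (blinfun_apply q). blinfun_apply q' k = k))"
        using representation_restrict[OF \<theta> pq triple_T]
        unfolding irreducible_representation_def by blast
      have pp: "proj p'" "p o\<^sub>L p' = p'" "p' o\<^sub>L p = p'"
        using p' projections_range_iff[OF P(1)] by auto
      have qq: "proj q'" "q o\<^sub>L q' = q'" "q' o\<^sub>L q = q'"
        using q' projections_range_iff[OF P(2)] by auto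
      have apply_pp: "blinfun_apply p (blinfun_apply p' v) = blinfun_apply p' v"
        "blinfun_apply p' (blinfun_apply p v) = blinfun_apply p' v" for v
        using pp by (metis blinfun_apply_blinfun_compose)+
      have apply_qq: "blinfun_apply q (blinfun_apply q' v) = blinfun_apply q' v"
        "blinfun_apply q' (blinfun_apply q v) = blinfun_apply q' v" for v
        using qq by (metis blinfun_apply_blinfun_compose)+
      \<comment> \<open>\<open>p'\<close> and \<open>q'\<close> are given as intertwining the
        restriction only; lying below \<open>p\<close> and \<open>q\<close>, they intertwine
        \<open>\<theta>\<close> itself.\<close>
      have i1: "intertwining T \<theta> p' q'"
        unfolding intertwining_def
      proof (intro conjI ballI pp qq)
        fix t assume t: "t \<in> T"
        show "q' o\<^sub>L \<theta> t = \<theta> t o\<^sub>L p'"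
        proof (rule blinfun_eqI)
          fix v
          have "blinfun_apply q' (blinfun_apply (\<theta> t) v) = blinfun_apply q' (blinfun_apply (\<theta> t) (blinfun_apply p v))"
            by (simp add: apply_qq flip: intertwiningD[OF pq t])
          also have "\<dots> = blinfun_apply (\<theta> t) (blinfun_apply p (blinfun_apply p' v))"
            using arg_cong[OF int[OF t], of "\<lambda>A. blinfun_apply A v"] by simp
          finally show "blinfun_apply (q' o\<^sub>L \<theta> t) v = blinfun_apply (\<theta> t o\<^sub>L p') v"
            by (simp add: apply_pp)
        qed
      qed
      have i2: "intertwining T \<theta> (p - p') (q - q')"
        by (rule intertwining_diff[OF pq i1 pp(2,3) qq(2,3)])
      have dp: "p o\<^sub>L (p - p') = p - p'" "(p - p') o\<^sub>L p = p - p'" "p' o\<^sub>L (p - p') = 0"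
        by (auto intro!: blinfun_eqI simp: blinfun.diff_left blinfun.diff_right apply_pp
            proj_idem[OF P(1)] proj_idem[OF pp(1)])
      have dq: "q o\<^sub>L (q - q') = q - q'" "(q - q') o\<^sub>L q = q - q'" "q' o\<^sub>L (q - q') = 0"
        by (auto intro!: blinfun_eqI simp: blinfun.diff_left blinfun.diff_right apply_qq
            proj_idem[OF P(2)] proj_idem[OF qq(1)])
      \<comment> \<open>A proper subpair may shrink only one of the two projections, hence the sum
        of both dimensions as the measure.\<close>
      have step: "P r s" if rs: "intertwining T \<theta> r s"
        and c: "p o\<^sub>L r = r" "r o\<^sub>L p = r" "q o\<^sub>L s = s" "s o\<^sub>L q = s" and ne: "r \<noteq> p \<or> s \<noteq> q" for r s
      proof -
        have R: "proj r" "proj s" using rs by (auto simp: intertwining_def)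
        note sub = range_subset_of_comp[OF c(1)] range_subset_of_comp[OF c(3)]
        note sp = csubspace_range[OF proj_clin[OF R(1)]] csubspace_range[OF proj_clin[OF R(2)]]
        have le: "cvec.dim (range (blinfun_apply r)) \<le> cvec.dim (range (blinfun_apply p))"
          "cvec.dim (range (blinfun_apply s)) \<le> cvec.dim (range (blinfun_apply q))"
          by (rule cvec_dim_mono[OF sp(1) less.prems(2) F(1) sub(1)])
            (rule cvec_dim_mono[OF sp(2) less.prems(3) G(1) sub(2)])
        have lt: "cvec.dim (range (blinfun_apply r)) < cvec.dim (range (blinfun_apply p))" if "r \<noteq> p"
          using range_eq_proj[OF P(1) R(1) c(2)] that sub(1)
          by (intro cvec_dim_strict[OF sp(1) less.prems(2) F(1)]) auto
        have lt': "cvec.dim (range (blinfun_apply s)) < cvec.dim (range (blinfun_apply q))" if "s \<noteq> q"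
          using range_eq_proj[OF P(2) R(2) c(4)] that sub(2)
          by (intro cvec_dim_strict[OF sp(2) less.prems(3) G(1)]) auto
        have rp: "blinfun_apply p v = v" if "blinfun_apply r v = v" for v
          using that c(1) by (metis blinfun_apply_blinfun_compose)
        show ?thesis
        proof (rule less.hyps[OF _ rs])
          show "cvec.dim (range (blinfun_apply r)) + cvec.dim (range (blinfun_apply s))
              < cvec.dim (range (blinfun_apply p)) + cvec.dim (range (blinfun_apply q))"
            using le lt lt' ne by linarith
          show "range (blinfun_apply r) \<subseteq> cvec.span F" "range (blinfun_apply s) \<subseteq> cvec.span G"
            using sub less.prems(2,3) by auto
          show "v = 0" if "blinfun_apply r v = v" "\<And>t. t \<in> T \<Longrightarrow> blinfun_apply (\<theta> t) v = 0" for v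
            using less.prems(4)[OF rp[OF that(1)] that(2)] .
        qed
      qed
      have "P p' q'"
      proof (rule step[OF i1 pp(2,3) qq(2,3)])
        show "p' \<noteq> p \<or> q' \<noteq> q" using n1 proj_idem[OF P(1)] proj_idem[OF P(2)] by auto
      qed
      moreover have "P (p - p') (q - q')"
      proof (rule step[OF i2 dp(1,2) dq(1,2)])
        show "p - p' \<noteq> p \<or> q - q' \<noteq> q" using n0 by auto
      qed
      ultimately have "P (p' + (p - p')) (q' + (q - q'))"
        by (intro sum i1 i2 dp dq)
      then show ?thesis by simp
    qed
  qed
qed

text \<open>Apply words in a basis of \<open>T\<close>, alternating \<open>\<pi>\<close> and
  adjoints, to \<open>S\<close> and \<open>R\<close>. Three factors collapse to one, so words of
  length at most two span an invariant pair. Their number is linear in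
  \<open>card S + card R\<close>, with a factor that depends on \<open>T\<close> alone.\<close>

lemma finite_dimensional_reduction:
  fixes \<pi> :: "('a \<Rightarrow>\<^sub>L 'b) \<Rightarrow> ('e::chilbert_space \<Rightarrow>\<^sub>L 'f::chilbert_space)"
  assumes \<pi>: "representation T H K \<pi>" and H: "hilbert H" and K: "hilbert K"
  shows "\<exists>d. \<forall>S R. finite S \<longrightarrow> finite R \<longrightarrow> S \<subseteq> H \<longrightarrow> R \<subseteq> K \<longrightarrow>
    (\<exists>e m f k. reducing_system T H K \<pi> S R (d * (card S + card R)) e m f k)"
proof -
  have HK: "cvec.subspace H" "closed H" "cvec.subspace K" "closed K"
    using H K by (auto simp: hilbert_def)
  note lin = representation_linear[OF \<pi>]
  have bop: "\<pi> t \<in> Bop H K" if "t \<in> T" for t by (rule linear_mapD(1)[OF lin that])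
  have cl: "clin (\<pi> t)" if "t \<in> T" for t by (rule Bop_clin[OF bop[OF that]])
  obtain F where F: "finite F" "T \<subseteq> cop.span F" using fin unfolding finite_dimensional_def by blast
  obtain B where B: "finite B" "cop.independent B" "cop.span B = T" "B \<subseteq> T"
    by (rule finite_dimensional_basis[OF subspace_T F(2,1)])
  \<comment> \<open>Landing in a subspace is a linear condition on \<open>t\<close>, so basis
    elements suffice; \<open>sub2\<close> is the analogue for adjoints.\<close>
  have sub1: "\<pi> t v \<in> N" if N: "cvec.subspace N" and b: "\<And>b. b \<in> B \<Longrightarrow> blinfun_apply (\<pi> b) v \<in> N"
    and t: "t \<in> T" for t v N
  proof -
    have "cop.subspace {t \<in> T. blinfun_apply (\<pi> t) v \<in> N}"
      by (rule cop.subspaceI)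
        (simp_all add: blinfun.add_left cscale_apply linear_map_0[OF lin subspace_T] linear_mapD[OF lin]
          cop.subspace_0[OF subspace_T] cop.subspace_add[OF subspace_T] cop.subspace_scale[OF subspace_T]
          cvec.subspace_0[OF N] cvec.subspace_add[OF N] cvec.subspace_scale[OF N])
    moreover have "B \<subseteq> {t \<in> T. blinfun_apply (\<pi> t) v \<in> N}" using b B(4) by blast
    ultimately have "cop.span B \<subseteq> {t \<in> T. blinfun_apply (\<pi> t) v \<in> N}" by (rule cop.span_minimal[rotated])
    then show ?thesis using t B(3) by blast
  qed
  have sub2: "blinfun_apply (adj (\<pi> t)) v \<in> N" if N: "cvec.subspace N"
    and b: "\<And>b. b \<in> B \<Longrightarrow> blinfun_apply (adj (\<pi> b)) v \<in> N" and t: "t \<in> T" for t v N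
  proof -
    have "cop.subspace {t \<in> T. blinfun_apply (adj (\<pi> t)) v \<in> N}"
      by (rule cop.subspaceI)
        (simp_all add: blinfun.add_left cscale_apply linear_map_0[OF lin subspace_T] linear_mapD(2,3)[OF lin]
          cop.subspace_0[OF subspace_T] cop.subspace_add[OF subspace_T] cop.subspace_scale[OF subspace_T]
          cvec.subspace_0[OF N] cvec.subspace_add[OF N] cvec.subspace_scale[OF N] adj_add adj_cscale cl)
    moreover have "B \<subseteq> {t \<in> T. blinfun_apply (adj (\<pi> t)) v \<in> N}" using b B(4) by blast
    ultimately have "cop.span B \<subseteq> {t \<in> T. blinfun_apply (adj (\<pi> t)) v \<in> N}" by (rule cop.span_minimal[rotated])
    then show ?thesis using t B(3) by blast
  qed
  have pre: "cvec.subspace {x. blinfun_apply A x \<in> N}" if "cvec.subspace N" "clin A"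
    for A :: "'x::chilbert_space \<Rightarrow>\<^sub>L 'y::chilbert_space" and N
    by (rule cvec.subspaceI)
      (simp_all add: blinfun.add_right clinD[OF that(2)] cvec.subspace_0[OF that(1)]
        cvec.subspace_add[OF that(1)] cvec.subspace_scale[OF that(1)])
  \<comment> \<open>One summand each for the words of length zero, one and two over the
    basis.\<close>
  define d where "d = 1 + card B + card B * card B"
  show ?thesis
  proof (intro exI[of _ d] allI impI)
    fix S R assume S: "finite S" "S \<subseteq> H" and R: "finite R" "R \<subseteq> K"
    \<comment> \<open>\<open>SM\<close> holds the words that end on the domain side,
      \<open>SN\<close> those that end on the codomain side.\<close>
    define SM where "SM = S \<union> (\<Union>b\<in>B. blinfun_apply (adj (\<pi> b)) ` R)
      \<union> (\<Union>b\<in>B. \<Union>c\<in>B. (\<lambda>s. blinfun_apply (adj (\<pi> b)) (blinfun_apply (\<pi> c) s)) ` S)"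
    define SN where "SN = R \<union> (\<Union>b\<in>B. blinfun_apply (\<pi> b) ` S)
      \<union> (\<Union>b\<in>B. \<Union>c\<in>B. (\<lambda>r. blinfun_apply (\<pi> b) (blinfun_apply (adj (\<pi> c)) r)) ` R)"
    have finM: "finite SM" and finN: "finite SN" using B(1) S(1) R(1) by (auto simp: SM_def SN_def)
    have card1: "card (\<Union>b\<in>B. g b ` Y) \<le> card B * card Y" if "finite Y"
      for g :: "('a \<Rightarrow>\<^sub>L 'b) \<Rightarrow> 'y \<Rightarrow> 'z" and Y
    proof -
      have "card (\<Union>b\<in>B. g b ` Y) \<le> (\<Sum>b\<in>B. card (g b ` Y))" by (rule card_UN_le[OF B(1)])
      also have "\<dots> \<le> (\<Sum>b\<in>B. card Y)" by (intro sum_mono card_image_le that)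
      finally show ?thesis by simp
    qed
    have card2: "card (\<Union>b\<in>B. \<Union>c\<in>B. g b c ` Y) \<le> card B * card B * card Y" if "finite Y"
      for g :: "('a \<Rightarrow>\<^sub>L 'b) \<Rightarrow> ('a \<Rightarrow>\<^sub>L 'b) \<Rightarrow> 'y \<Rightarrow> 'z" and Y
    proof -
      have "card (\<Union>b\<in>B. \<Union>c\<in>B. g b c ` Y) \<le> (\<Sum>b\<in>B. card (\<Union>c\<in>B. g b c ` Y))" by (rule card_UN_le[OF B(1)])
      also have "\<dots> \<le> (\<Sum>b\<in>B. card B * card Y)" by (intro sum_mono card1 that)
      finally show ?thesis by simp
    qed
    have cM: "card SM \<le> d * (card S + card R)"
    proof -
      have "card SM \<le> card S + card B * card R + card B * card B * card S"
        unfolding SM_def by (intro order.trans[OF card_Un_le] add_mono card1 card2 S R order_refl)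
      also have "\<dots> \<le> d * (card S + card R)" by (simp add: d_def algebra_simps)
      finally show ?thesis .
    qed
    have cN: "card SN \<le> d * (card S + card R)"
    proof -
      have "card SN \<le> card R + card B * card S + card B * card B * card R"
        unfolding SN_def by (intro order.trans[OF card_Un_le] add_mono card1 card2 S R order_refl)
      also have "\<dots> \<le> d * (card S + card R)" by (simp add: d_def algebra_simps)
      finally show ?thesis .
    qed
    have SM3: "blinfun_apply (adj (\<pi> b)) (blinfun_apply (\<pi> c) s) \<in> SM" if "b \<in> B" "c \<in> B" "s \<in> S" for b c s
      unfolding SM_def by (rule UnI2, rule UN_I[OF that(1)], rule UN_I[OF that(2)], rule image_eqI[OF refl that(3)])
    have SN3: "blinfun_apply (\<pi> b) (blinfun_apply (adj (\<pi> c)) r) \<in> SN" if "b \<in> B" "c \<in> B" "r \<in> R" for b c r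
      unfolding SN_def by (rule UnI2, rule UN_I[OF that(1)], rule UN_I[OF that(2)], rule image_eqI[OF refl that(3)])
    define M where "M = cvec.span SM"
    define N where "N = cvec.span SN"
    have sM: "cvec.subspace M" and sN: "cvec.subspace N" by (simp_all add: M_def N_def)
    have A: "blinfun_apply (\<pi> t) s \<in> N" if "t \<in> T" "s \<in> S" for t s
    proof (rule sub1[OF sN _ that(1)])
      show "blinfun_apply (\<pi> b) s \<in> N" if "b \<in> B" for b
        unfolding N_def using that \<open>s \<in> S\<close> by (intro cvec.span_base) (auto simp: SN_def)
    qed
    have A': "blinfun_apply (adj (\<pi> t)) r \<in> M" if "t \<in> T" "r \<in> R" for t r
    proof (rule sub2[OF sM _ that(1)])
      show "blinfun_apply (adj (\<pi> b)) r \<in> M" if "b \<in> B" for b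
        unfolding M_def using that \<open>r \<in> R\<close> by (intro cvec.span_base) (auto simp: SM_def)
    qed
    have C: "blinfun_apply (\<pi> t) (blinfun_apply (adj (\<pi> u)) r) \<in> N" if "t \<in> T" "u \<in> T" "r \<in> R" for t u r
    proof -
      have "blinfun_apply (adj (\<pi> u)) r \<in> {x. blinfun_apply (\<pi> t) x \<in> N}"
      proof (rule sub2[OF pre[OF sN cl[OF that(1)]] _ that(2)], unfold mem_Collect_eq)
        show "blinfun_apply (\<pi> t) (blinfun_apply (adj (\<pi> c)) r) \<in> N" if c: "c \<in> B" for c
        proof (rule sub1[OF sN _ \<open>t \<in> T\<close>])
          show "blinfun_apply (\<pi> b) (blinfun_apply (adj (\<pi> c)) r) \<in> N" if "b \<in> B" for b
            unfolding N_def
              by (intro cvec.span_base SN3 that c \<open>r \<in> R\<close>)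
        qed
      qed
      then show ?thesis by simp
    qed
    have C': "blinfun_apply (adj (\<pi> t)) (blinfun_apply (\<pi> u) s) \<in> M" if "t \<in> T" "u \<in> T" "s \<in> S" for t u s
    proof -
      have "blinfun_apply (\<pi> u) s \<in> {x. blinfun_apply (adj (\<pi> t)) x \<in> M}"
      proof (rule sub1[OF pre[OF sM clin_adj[OF cl[OF that(1)]]] _ that(2)], unfold mem_Collect_eq)
        show "blinfun_apply (adj (\<pi> t)) (blinfun_apply (\<pi> c) s) \<in> M" if c: "c \<in> B" for c
        proof (rule sub2[OF sM _ \<open>t \<in> T\<close>])
          show "blinfun_apply (adj (\<pi> b)) (blinfun_apply (\<pi> c) s) \<in> M" if "b \<in> B" for b
            unfolding M_def by (intro cvec.span_base SM3 that c \<open>s \<in> S\<close>)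
        qed
      qed
      then show ?thesis by simp
    qed
    have inv: "blinfun_apply (\<pi> t) x \<in> N" if t: "t \<in> T" and x: "x \<in> M" for t x
    proof -
      have "blinfun_apply (\<pi> t) y \<in> N" if "y \<in> SM" for y
      proof -
        \<comment> \<open>A word of length three: the triple product brings it back to length
          one.\<close>
        have "blinfun_apply (\<pi> t) (blinfun_apply (adj (\<pi> b)) (blinfun_apply (\<pi> c) s)) \<in> N"
          if "b \<in> B" "c \<in> B" "s \<in> S" for b c s
        proof -
          have bc: "b \<in> T" "c \<in> T" using that B(4) by auto
          show ?thesis
            using A[OF triple_T[OF t bc] that(3)]
            by (simp add: representation_triple[OF \<pi> t bc] triple_apply)
        qed
        then show ?thesis using that A[OF t] C[OF t] B(4) by (auto simp: SM_def)
      qed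
      then have "cvec.span SM \<subseteq> {x. blinfun_apply (\<pi> t) x \<in> N}"
        by (intro cvec.span_minimal pre[OF sN cl[OF t]]) auto
      then show ?thesis using x by (auto simp: M_def)
    qed
    have inv': "blinfun_apply (adj (\<pi> t)) x \<in> M" if t: "t \<in> T" and x: "x \<in> N" for t x
    proof -
      have "blinfun_apply (adj (\<pi> t)) y \<in> M" if "y \<in> SN" for y
      proof -
        have "blinfun_apply (adj (\<pi> t)) (blinfun_apply (\<pi> b) (blinfun_apply (adj (\<pi> c)) r)) \<in> M"
          if "b \<in> B" "c \<in> B" "r \<in> R" for b c r
        proof -
          have bc: "b \<in> T" "c \<in> T" using that B(4) by auto
          \<comment> \<open>Taking adjoints reverses a triple, so a word that starts with
            \<open>adj (\<pi> t)\<close> comes from \<open>triple c b t\<close>.\<close>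
          have "adj (\<pi> (triple c b t)) = adj (\<pi> t) o\<^sub>L (\<pi> b o\<^sub>L adj (\<pi> c))"
            unfolding representation_triple[OF \<pi> bc(2,1) t]
            unfolding triple_def
            using cl[OF t] cl[OF bc(1)] cl[OF bc(2)]
            by (simp add: adj_compose clin_compose clin_adj adj_adj)
          then show ?thesis using A'[OF triple_T[OF bc(2,1) t] that(3)] by simp
        qed
        then show ?thesis using that A'[OF t] C'[OF t] B(4) by (auto simp: SN_def)
      qed
      then have "cvec.span SN \<subseteq> {x. blinfun_apply (adj (\<pi> t)) x \<in> M}"
        by (intro cvec.span_minimal pre[OF sM clin_adj[OF cl[OF t]]]) auto
      then show ?thesis using x by (auto simp: N_def)
    qed
    obtain e m where e: "m \<le> card SM" "orthonormal e m" "cvec.span SM = cvec.span (e ` {..<m})"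
      using Gram_Schmidt[OF finM] by blast
    obtain f k where f: "k \<le> card SN" "orthonormal f k" "cvec.span SN = cvec.span (f ` {..<k})"
      using Gram_Schmidt[OF finN] by blast
    define p where "p = partial_isom e e m"
    define q where "q = partial_isom f f k"
    have P: "proj p" "proj q" by (simp_all add: p_def q_def proj_partial_isom e f)
    have rM: "range (blinfun_apply p) = M" and rN: "range (blinfun_apply q) = N"
      by (simp_all add: p_def q_def M_def N_def partial_isom_span e f)
    \<comment> \<open>\<open>\<pi> t\<close> maps \<open>M\<close> into \<open>N\<close>, which
      settles the range of \<open>p\<close>; its adjoint maps \<open>N\<close> into
      \<open>M\<close>, so the complement of \<open>M\<close> goes into the complement of
      \<open>N\<close>.\<close>
    have "q o\<^sub>L \<pi> t = \<pi> t o\<^sub>L p" if t: "t \<in> T" for t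
    proof (rule blinfun_eqI)
      fix v
      define w where "w = v - blinfun_apply p v"
      have pw: "blinfun_apply p w = 0" by (simp add: w_def blinfun.diff_right proj_idem[OF P(1)])
      have "blinfun_apply q (blinfun_apply (\<pi> t) w) = 0"
      proof (rule cinner_eqI)
        fix y
        have "blinfun_apply (adj (\<pi> t)) (blinfun_apply q y) \<in> M" using inv'[OF t] rN by blast
        then have "blinfun_apply p (blinfun_apply (adj (\<pi> t)) (blinfun_apply q y))
            = blinfun_apply (adj (\<pi> t)) (blinfun_apply q y)"
          using proj_range_iff[OF P(1)] rM by blast
        then have "cinner w (blinfun_apply (adj (\<pi> t)) (blinfun_apply q y)) = 0"
          using proj_cinner[OF P(1), of w] pw by (metis cinner_zero_left)
        then show "cinner (blinfun_apply q (blinfun_apply (\<pi> t) w)) y = cinner 0 y"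
          by (simp add: proj_cinner[OF P(2)] cinner_adj[OF cl[OF t]])
      qed
      moreover have "blinfun_apply q (blinfun_apply (\<pi> t) (blinfun_apply p v)) = blinfun_apply (\<pi> t) (blinfun_apply p v)"
        using inv[OF t] rM proj_range_iff[OF P(2)] rN by blast
      ultimately show "blinfun_apply (q o\<^sub>L \<pi> t) v = blinfun_apply (\<pi> t o\<^sub>L p) v"
        by (simp add: w_def blinfun.diff_right)
    qed
    then have int: "intertwining T \<pi> p q" using P by (simp add: intertwining_def)
    have "SM \<subseteq> H"
      using S(2) B(4) Bop_adj_range[OF bop HK(1,2)] by (auto simp: SM_def)
    then have MH: "M \<subseteq> H" unfolding M_def by (rule cvec.span_minimal[OF _ HK(1)])
    have "SN \<subseteq> K"
      using R(2) B(4) Bop_range[OF bop] by (auto simp: SN_def)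
    then have NK: "N \<subseteq> K" unfolding N_def by (rule cvec.span_minimal[OF _ HK(3)])
    have SM: "S \<subseteq> M" unfolding M_def by (auto simp: SM_def intro: cvec.span_base)
    have RN: "R \<subseteq> N" unfolding N_def by (auto simp: SN_def intro: cvec.span_base)
    show "\<exists>e m f k. reducing_system T H K \<pi> S R (d * (card S + card R)) e m f k"
      using e f cM cN int rM rN MH NK SM RN unfolding p_def q_def reducing_system_def
      by (intro exI[of _ e] exI[of _ m] exI[of _ f] exI[of _ k]) auto
  qed
qed

end

section \<open>Unique extension for finite-dimensional representations\<close>

lemma Bop_project:
  fixes H :: "'a::chilbert_space set"
  assumes "hilbert H"
  obtains s where "s \<in> H" "norm s \<le> norm x"
    "\<And>A (K :: 'b::chilbert_space set). A \<in> Bop H K \<Longrightarrow> blinfun_apply A x = blinfun_apply A s"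
proof -
  obtain s where s: "s \<in> H" "\<And>y. y \<in> H \<Longrightarrow> cinner (x - s) y = 0"
    using cproj_exists[of H x] assms unfolding hilbert_def by blast
  have "cinner s (x - s) = 0" using s cinner_commute[of s "x - s"] by simp
  from Pythagoras[OF this] have "norm s \<le> norm x" by (simp add: power2_le_imp_le)
  moreover have "blinfun_apply A x = blinfun_apply A s" if "A \<in> Bop H K" for A and K :: "'b set"
    using Bop_kernel[OF that s(2)] by (simp add: blinfun.diff_right)
  ultimately show thesis using that s(1) by blast
qed

lemma inner_adj_left: "clin A \<Longrightarrow> inner (blinfun_apply (adj A) y) x = inner y (blinfun_apply A x)"
  by (simp flip: Re_cinner add: cinner_adj_left)

lemma sum_list_nth_lessThan: "(\<Sum>x\<leftarrow>xs. f x) = (\<Sum>i<length xs. f (xs ! i))"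
  by (simp add: sum_list_sum_nth lessThan_atLeast0)

context boundary_tro
begin

text \<open>The inequality tests finitely many vectors at a time, and these fit into a
  finite-dimensional reducing pair. There it reduces to irreducible summands, since over orthogonal
  pairs both sides add up by Pythagoras.\<close>

lemma representation_completely_contractive:
  fixes H :: "'c set" and K :: "'d set"
  assumes \<pi>: "representation T H K \<pi>" and H: "hilbert H" and K: "hilbert K" and nd: "nondegenerate T H K \<pi>"
  shows "completely_contractive T \<pi>"
  unfolding completely_contractive_iff
proof (intro allI impI)
  fix n :: nat and A
  assume "\<forall>i<n. \<forall>j<n. A i j \<in> T" and A1: "mat_contraction n A"
  then have A: "A i j \<in> T" if "i < n" "j < n" for i j using that by blast
  have HK: "cvec.subspace H" "cvec.subspace K" using H K by (auto simp: hilbert_def)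
  note lin = representation_linear[OF \<pi>]
  have cl: "clin (\<pi> t)" if "t \<in> T" for t by (rule Bop_clin[OF linear_mapD(1)[OF lin that]])
  define Q where "Q p \<longleftrightarrow> (\<forall>\<xi>. (\<Sum>i<n. (norm (\<Sum>j<n. blinfun_apply (\<pi> (A i j)) (blinfun_apply p (\<xi> j))))\<^sup>2)
     \<le> (\<Sum>j<n. (norm (blinfun_apply p (\<xi> j)))\<^sup>2))" for p :: "'c \<Rightarrow>\<^sub>L 'c"
  obtain d where d: "\<forall>S R. finite S \<longrightarrow> finite R \<longrightarrow> S \<subseteq> H \<longrightarrow> R \<subseteq> K \<longrightarrow>
    (\<exists>e m f k. reducing_system T H K \<pi> S R (d * (card S + card R)) e m f k)"
    using finite_dimensional_reduction[OF \<pi> H K] ..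
  show "mat_contraction n (\<lambda>i j. \<pi> (A i j))"
    unfolding mat_contraction_def
  proof
    fix \<xi> :: "nat \<Rightarrow> 'c"
    \<comment> \<open>Components orthogonal to \<open>H\<close> are killed by every
      \<open>\<pi> t\<close>; removing them keeps the left side and can only lower the right
      one.\<close>
    have "\<exists>s. s \<in> H \<and> norm s \<le> norm (\<xi> j) \<and> (\<forall>t\<in>T. blinfun_apply (\<pi> t) (\<xi> j) = blinfun_apply (\<pi> t) s)" for j
      using Bop_project[OF H, of "\<xi> j"] linear_mapD(1)[OF lin] by metis
    then obtain \<eta> where \<eta>: "\<And>j. \<eta> j \<in> H" "\<And>j. norm (\<eta> j) \<le> norm (\<xi> j)"
      "\<And>j t. t \<in> T \<Longrightarrow> blinfun_apply (\<pi> t) (\<xi> j) = blinfun_apply (\<pi> t) (\<eta> j)" by metis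
    obtain e m f k where ef: "orthonormal e m" "orthonormal f k"
        "intertwining T \<pi> (partial_isom e e m) (partial_isom f f k)" "\<eta> ` {..<n} \<subseteq> range (blinfun_apply (partial_isom e e m))"
        "range (blinfun_apply (partial_isom e e m)) \<subseteq> H"
      using d[THEN spec, of "\<eta> ` {..<n}", THEN spec, of "{}"] \<eta>(1) unfolding reducing_system_def by blast
    have fix_\<eta>: "blinfun_apply (partial_isom e e m) (\<eta> j) = \<eta> j" if "j < n" for j
      using ef(4) that proj_range_iff[OF proj_partial_isom[OF ef(1)], of "\<eta> j"] by blast
    have "Q (partial_isom e e m)"
    proof (rule decomposition_induct[OF \<pi> ef(3), where F = "e ` {..<m}" and G = "f ` {..<k}" and P = "\<lambda>p q. Q p"])
      show "range (blinfun_apply (partial_isom e e m)) \<subseteq> cvec.span (e ` {..<m})"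
        "range (blinfun_apply (partial_isom f f k)) \<subseteq> cvec.span (f ` {..<k})"
        by (simp_all add: partial_isom_span ef)
      show "v = 0" if "blinfun_apply (partial_isom e e m) v = v" "\<And>t. t \<in> T \<Longrightarrow> blinfun_apply (\<pi> t) v = 0" for v
      proof (rule nondegenerate_kernel[OF nd HK cl _ that(2)])
        show "v \<in> H" using that(1) ef(5) by (metis rangeI subsetD)
      qed
      show "Q 0" by (simp add: Q_def)
    next
      fix p q
      assume pq: "intertwining T \<pi> p q" and h: "hilbert (range (blinfun_apply p))" "hilbert (range (blinfun_apply q))"
        and irr: "irreducible_representation T (range (blinfun_apply p)) (range (blinfun_apply q)) (\<lambda>t. \<pi> t o\<^sub>L p)"
      have P: "proj p" using pq by (simp add: intertwining_def)
      have "mat_contraction n (\<lambda>i j. \<pi> (A i j) o\<^sub>L p)"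
        by (rule completely_contractiveD[OF irreducible_completely_contractive[OF h irr] A A1])
      then show "Q p"
        unfolding Q_def mat_contraction_def
        by (intro allI) (drule spec[where x = "\<lambda>j. blinfun_apply p (_ j)"], simp add: proj_idem[OF P])
    next
      fix p q p' q'
      assume pq: "intertwining T \<pi> p q" "intertwining T \<pi> p' q'" "p o\<^sub>L p' = 0" "q o\<^sub>L q' = 0" and Q: "Q p" "Q p'"
      have P: "proj p" "proj p'" "proj q" "proj q'" using pq by (auto simp: intertwining_def)
      have orth: "cinner (blinfun_apply r x) (blinfun_apply r' y) = 0"
        if "proj r" "proj r'" "r o\<^sub>L r' = 0" for r r' :: "'x::chilbert_space \<Rightarrow>\<^sub>L 'x" and x y
        using that(3) by (simp add: proj_cinner[OF that(1)] flip: blinfun_apply_blinfun_compose)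
      show "Q (p + p')"
        unfolding Q_def
      proof
        fix \<xi>
        define a where "a i = (\<Sum>j<n. blinfun_apply (\<pi> (A i j)) (blinfun_apply p (\<xi> j)))" for i
        define b where "b i = (\<Sum>j<n. blinfun_apply (\<pi> (A i j)) (blinfun_apply p' (\<xi> j)))" for i
        have ab: "(norm (\<Sum>j<n. blinfun_apply (\<pi> (A i j)) (blinfun_apply (p + p') (\<xi> j))))\<^sup>2
            = (norm (a i))\<^sup>2 + (norm (b i))\<^sup>2" if i: "i < n" for i
        proof -
          have "a i = blinfun_apply q (\<Sum>j<n. blinfun_apply (\<pi> (A i j)) (\<xi> j))"
            unfolding a_def blinfun.sum_right using A[OF i]
            by (intro sum.cong refl) (simp add: intertwiningD[OF pq(1)])
          moreover have "b i = blinfun_apply q' (\<Sum>j<n. blinfun_apply (\<pi> (A i j)) (\<xi> j))"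
            unfolding b_def blinfun.sum_right using A[OF i]
            by (intro sum.cong refl) (simp add: intertwiningD[OF pq(2)])
          ultimately have "cinner (a i) (b i) = 0" using orth[OF P(3,4) pq(4)] by simp
          from Pythagoras[OF this] show ?thesis
            by (simp add: a_def b_def blinfun.add_left blinfun.add_right sum.distrib)
        qed
        have "(\<Sum>i<n. (norm (\<Sum>j<n. blinfun_apply (\<pi> (A i j)) (blinfun_apply (p + p') (\<xi> j))))\<^sup>2)
            = (\<Sum>i<n. (norm (a i))\<^sup>2) + (\<Sum>i<n. (norm (b i))\<^sup>2)"
          by (simp add: ab sum.distrib)
        also have "\<dots> \<le> (\<Sum>j<n. (norm (blinfun_apply p (\<xi> j)))\<^sup>2) + (\<Sum>j<n. (norm (blinfun_apply p' (\<xi> j)))\<^sup>2)"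
          using Q unfolding Q_def a_def b_def by (intro add_mono) blast+
        also have "\<dots> = (\<Sum>j<n. (norm (blinfun_apply (p + p') (\<xi> j)))\<^sup>2)"
          by (simp add: blinfun.add_left Pythagoras[OF orth[OF P(1,2) pq(3)]] sum.distrib)
        finally show "(\<Sum>i<n. (norm (\<Sum>j<n. blinfun_apply (\<pi> (A i j)) (blinfun_apply (p + p') (\<xi> j))))\<^sup>2)
            \<le> (\<Sum>j<n. (norm (blinfun_apply (p + p') (\<xi> j)))\<^sup>2)" .
      qed
    qed (simp_all)
    then have "(\<Sum>i<n. (norm (\<Sum>j<n. blinfun_apply (\<pi> (A i j)) (\<eta> j)))\<^sup>2) \<le> (\<Sum>j<n. (norm (\<eta> j))\<^sup>2)"
      unfolding Q_def by (drule_tac spec[where x = \<eta>]) (simp add: fix_\<eta>)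
    also have "\<dots> \<le> (\<Sum>j<n. (norm (\<xi> j))\<^sup>2)" by (intro sum_mono power_mono \<eta>) auto
    finally show "(\<Sum>i<n. (norm (\<Sum>j<n. blinfun_apply (\<pi> (A i j)) (\<xi> j)))\<^sup>2) \<le> (\<Sum>j<n. (norm (\<xi> j))\<^sup>2)"
      by (simp add: A \<eta>(3))
  qed
qed

text \<open>Let \<open>a\<close> be the sum of \<open>adj x o\<^sub>L x\<close> over the column, so
  that \<open>y\<close> is \<open>s\<close> after \<open>1 - a\<close>. As \<open>s\<close> is a
  contraction, it remains to see that the square of \<open>1 - a\<close> plus \<open>a\<close> is at
  most one, that is, that \<open>a\<close> squared is at most \<open>a\<close>; this holds since
  \<open>a\<close> lies between 0 and 1.\<close>

lemma col_contraction_extend: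
  assumes xs: "set xs \<subseteq> T" "col_contraction xs" and s: "s \<in> T" "norm s \<le> 1"
  defines "y \<equiv> s - (\<Sum>i<length xs. triple s (xs ! i) (xs ! i))"
  shows "y \<in> T" "col_contraction (y # xs)"
proof -
  have xT: "xs ! i \<in> T" if "i < length xs" for i using xs(1) that by auto
  show "y \<in> T"
    unfolding y_def
    by (intro cop.subspace_diff cop.subspace_sum subspace_T s triple_T xT) auto
  show "col_contraction (y # xs)"
    unfolding col_contraction_def
  proof
    fix v
    define b where "b = (\<Sum>i<length xs. blinfun_apply (adj (xs ! i)) (blinfun_apply (xs ! i) v))"
    define \<beta> where "\<beta> = (\<Sum>x\<leftarrow>xs. (norm (blinfun_apply x v))\<^sup>2)"
    have bound: "(\<Sum>i<length xs. (norm (blinfun_apply (xs ! i) w))\<^sup>2) \<le> (norm w)\<^sup>2" for w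
      using xs(2) by (simp add: col_contraction_def sum_list_nth_lessThan)
    have b_inner: "inner b w = (\<Sum>i<length xs. inner (blinfun_apply (xs ! i) v) (blinfun_apply (xs ! i) w))" for w
      unfolding b_def inner_sum_left by (intro sum.cong refl inner_adj_left clin_T xT) simp
    have bv: "inner b v = \<beta>"
      by (simp add: b_inner \<beta>_def sum_list_nth_lessThan power2_norm_eq_inner)
    \<comment> \<open>\<open>b\<close> is \<open>a v\<close>, so the bound \<open>nb\<close>
      expresses that \<open>a\<close> squared is at most \<open>a\<close>; it uses the column
      inequality at \<open>b\<close>.\<close>
    have "(norm b)\<^sup>2 = (\<Sum>i<length xs. inner (blinfun_apply (xs ! i) v) (blinfun_apply (xs ! i) b))"
      by (simp add: power2_norm_eq_inner flip: b_inner)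
    also have "\<dots> \<le> (\<Sum>i<length xs. ((norm (blinfun_apply (xs ! i) v))\<^sup>2 + (norm (blinfun_apply (xs ! i) b))\<^sup>2) / 2)"
    proof (rule sum_mono)
      fix i
      let ?a = "blinfun_apply (xs ! i) v" and ?b = "blinfun_apply (xs ! i) b"
      have "0 \<le> (norm (?a - ?b))\<^sup>2" by simp
      also have "\<dots> = (norm ?a)\<^sup>2 + (norm ?b)\<^sup>2 - 2 * inner ?a ?b"
        unfolding power2_norm_eq_inner by (simp add: inner_diff_left inner_diff_right inner_commute)
      finally show "inner ?a ?b \<le> ((norm ?a)\<^sup>2 + (norm ?b)\<^sup>2) / 2" by simp
    qed
    also have "\<dots> = (\<beta> + (\<Sum>i<length xs. (norm (blinfun_apply (xs ! i) b))\<^sup>2)) / 2"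
      by (simp add: \<beta>_def sum_list_nth_lessThan sum.distrib flip: sum_divide_distrib)
    also have "\<dots> \<le> (\<beta> + (norm b)\<^sup>2) / 2" using bound[of b] by simp
    finally have nb: "(norm b)\<^sup>2 \<le> \<beta>" by simp
    have "blinfun_apply y v = blinfun_apply s (v - b)"
      by (simp add: y_def b_def blinfun.diff_left blinfun.diff_right blinfun.sum_left blinfun.sum_right triple_apply)
    then have "(norm (blinfun_apply y v))\<^sup>2 \<le> (norm (v - b))\<^sup>2"
      using norm_le_1_apply[OF s(2), of "v - b"] by (simp add: power_mono)
    also have "\<dots> = (norm v)\<^sup>2 - 2 * \<beta> + (norm b)\<^sup>2"
      unfolding power2_norm_eq_inner by (simp add: inner_diff_left inner_diff_right inner_commute bv[symmetric])
    also have "\<dots> \<le> (norm v)\<^sup>2 - \<beta>" using nb by simp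
    finally show "(\<Sum>x\<leftarrow>y # xs. (norm (blinfun_apply x v))\<^sup>2) \<le> (norm v)\<^sup>2"
      by (simp add: \<beta>_def)
  qed
qed

text \<open>Take a column through \<open>t\<close> whose value at \<open>h\<close> nearly attains
  the supremum. Extending it by the preceding lemma would raise the value by the square of
  \<open>norm (\<sigma> s w)\<close>, where \<open>w\<close> is what the column misses of
  \<open>h\<close>; so this is small for every contraction \<open>s\<close>. The reconstruction
  identity then makes \<open>w\<close> small, and the defect of the column at \<open>h\<close> is
  \<open>inner w h\<close>.\<close>

lemma nearly_isometric_column:
  fixes \<sigma> :: "('a \<Rightarrow>\<^sub>L 'b) \<Rightarrow> ('e::chilbert_space \<Rightarrow>\<^sub>L 'f::chilbert_space)"
  assumes \<sigma>: "representation T M N \<sigma>" and M: "cvec.subspace M" "closed M"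
    and cc: "completely_contractive T \<sigma>"
    and B: "finite B" "B \<subseteq> T" "\<And>b. b \<in> B \<Longrightarrow> u b \<in> T"
      "\<And>v. v \<in> M \<Longrightarrow> v = (\<Sum>b\<in>B. blinfun_apply (adj (\<sigma> (u b))) (blinfun_apply (\<sigma> b) v))"
    and h: "h \<in> M" and t: "t \<in> T" "norm t \<le> 1" and \<delta>: "\<delta> > 0"
  obtains xs where "set xs \<subseteq> T" "t \<in> set xs" "col_contraction xs"
    "(norm h)\<^sup>2 - \<delta> \<le> (\<Sum>x\<leftarrow>xs. (norm (blinfun_apply (\<sigma> x) h))\<^sup>2)"
proof -
  note lin = representation_linear[OF \<sigma>]
  have cl: "clin (\<sigma> t)" if "t \<in> T" for t by (rule Bop_clin[OF linear_mapD(1)[OF lin that]])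
  note zero = cop.subspace_0[OF subspace_T] linear_map_0[OF lin subspace_T]
  define G where "G = {xs. set xs \<subseteq> T \<and> t \<in> set xs \<and> col_contraction xs}"
  define val where "val xs = (\<Sum>x\<leftarrow>xs. (norm (blinfun_apply (\<sigma> x) h))\<^sup>2)" for xs
  have "[t] \<in> G"
    using t norm_le_1_apply[OF t(2)] by (simp add: G_def col_contraction_def power_mono)
  then have ne: "val ` G \<noteq> {}" by blast
  have "val xs \<le> (norm h)\<^sup>2" if "xs \<in> G" for xs
    using completely_contractive_column[OF cc zero, of xs] that
    by (simp add: G_def val_def col_contraction_def o_def)
  then have bdd: "bdd_above (val ` G)" by (intro bdd_aboveI2)
  \<comment> \<open>The factor \<open>1 + norm b\<close> pays for scaling \<open>b\<close> into the
    unit ball, where the estimate \<open>small\<close> applies.\<close>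
  define C where "C = (\<Sum>b\<in>B. norm (adj (\<sigma> (u b))) * (1 + norm b))"
  have C0: "C \<ge> 0" unfolding C_def by (intro sum_nonneg mult_nonneg_nonneg) auto
  \<comment> \<open>Chosen so that \<open>C * \<epsilon> * norm h \<le> \<delta>\<close>; the
    \<open>+ 1\<close> keeps the denominator positive.\<close>
  define \<epsilon> where "\<epsilon> = \<delta> / (C * norm h + 1)"
  have den: "C * norm h + 1 > 0" using C0 by (simp add: add_nonneg_pos)
  have \<epsilon>: "\<epsilon> > 0" using \<delta> den by (simp add: \<epsilon>_def)
  have "Sup (val ` G) - \<epsilon>\<^sup>2 < Sup (val ` G)" using \<epsilon> by simp
  then obtain xs where xs: "xs \<in> G" "Sup (val ` G) - \<epsilon>\<^sup>2 < val xs"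
    using less_cSup_iff[OF ne bdd] by blast
  have xT: "xs ! i \<in> T" if "i < length xs" for i using xs(1) that by (auto simp: G_def)
  define w where "w = h - (\<Sum>i<length xs. blinfun_apply (adj (\<sigma> (xs ! i))) (blinfun_apply (\<sigma> (xs ! i)) h))"
  have wM: "w \<in> M"
    unfolding w_def
    by (intro cvec.subspace_diff cvec.subspace_sum M(1) h Bop_adj_range[OF linear_mapD(1)[OF lin xT] M]) auto
  have small: "norm (blinfun_apply (\<sigma> s) w) \<le> \<epsilon>" if s: "s \<in> T" "norm s \<le> 1" for s
  proof -
    define y where "y = s - (\<Sum>i<length xs. triple s (xs ! i) (xs ! i))"
    have y: "y \<in> T" "col_contraction (y # xs)"
      using col_contraction_extend[OF _ _ s, of xs] xs(1) by (auto simp: G_def y_def)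
    then have "y # xs \<in> G" using xs(1) by (auto simp: G_def)
    then have "val (y # xs) \<le> Sup (val ` G)" by (intro cSup_upper imageI bdd)
    then have "(norm (blinfun_apply (\<sigma> y) h))\<^sup>2 \<le> \<epsilon>\<^sup>2" using xs(2) by (simp add: val_def)
    then have le: "norm (blinfun_apply (\<sigma> y) h) \<le> \<epsilon>" by (rule power2_le_imp_le) (use \<epsilon> in simp)
    have tr: "triple s (xs ! i) (xs ! i) \<in> T" if "i \<in> {..<length xs}" for i
      using that by (intro triple_T s xT) auto
    have "\<sigma> y = \<sigma> s - (\<Sum>i<length xs. \<sigma> (triple s (xs ! i) (xs ! i)))"
    proof -
      have "(\<Sum>i<length xs. triple s (xs ! i) (xs ! i)) \<in> T"
        by (rule cop.subspace_sum[OF subspace_T tr])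
      moreover have "\<sigma> (\<Sum>i<length xs. triple s (xs ! i) (xs ! i)) = (\<Sum>i<length xs. \<sigma> (triple s (xs ! i) (xs ! i)))"
        by (rule linear_map_sum[OF lin subspace_T tr])
      ultimately show ?thesis unfolding y_def by (simp add: linear_map_diff[OF lin subspace_T s(1)])
    qed
    also have "\<dots> = \<sigma> s - (\<Sum>i<length xs. triple (\<sigma> s) (\<sigma> (xs ! i)) (\<sigma> (xs ! i)))"
      by (simp add: representation_triple[OF \<sigma>] s xT)
    finally have "blinfun_apply (\<sigma> y) h = blinfun_apply (\<sigma> s) w"
      by (simp add: w_def blinfun.diff_left blinfun.diff_right blinfun.sum_left blinfun.sum_right triple_apply)
    then show ?thesis using le by simp
  qed
  have small_b: "norm (blinfun_apply (\<sigma> b) w) \<le> (1 + norm b) * \<epsilon>" if b: "b \<in> T" for b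
  proof -
    have n: "1 + norm b > 0" by (simp add: add_pos_nonneg)
    have "norm (cscale (of_real (1 / (1 + norm b))) b) \<le> 1"
      unfolding norm_cscale norm_of_real using n by (simp add: divide_le_eq)
    then have "norm (blinfun_apply (\<sigma> (cscale (of_real (1 / (1 + norm b))) b)) w) \<le> \<epsilon>"
      by (intro small cop.subspace_scale[OF subspace_T b])
    then have "norm (blinfun_apply (\<sigma> b) w) / (1 + norm b) \<le> \<epsilon>"
      unfolding linear_mapD(3)[OF lin b] cscale_apply norm_scaleC norm_of_real using n by simp
    then show ?thesis using n by (simp add: divide_le_eq mult.commute)
  qed
  have "norm w \<le> (\<Sum>b\<in>B. norm (blinfun_apply (adj (\<sigma> (u b))) (blinfun_apply (\<sigma> b) w)))"
    by (subst B(4)[OF wM]) (rule norm_sum)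
  also have "\<dots> \<le> (\<Sum>b\<in>B. norm (adj (\<sigma> (u b))) * ((1 + norm b) * \<epsilon>))"
    using B(2) by (intro sum_mono order.trans[OF norm_blinfun] mult_left_mono small_b) auto
  also have "\<dots> = C * \<epsilon>" by (simp add: C_def sum_distrib_right mult.assoc)
  finally have nw: "norm w \<le> C * \<epsilon>" .
  have "inner w h = (norm h)\<^sup>2 - val xs"
  proof -
    have "inner (\<Sum>i<length xs. blinfun_apply (adj (\<sigma> (xs ! i))) (blinfun_apply (\<sigma> (xs ! i)) h)) h
        = (\<Sum>i<length xs. inner (blinfun_apply (\<sigma> (xs ! i)) h) (blinfun_apply (\<sigma> (xs ! i)) h))"
      unfolding inner_sum_left by (intro sum.cong refl inner_adj_left cl xT) simp
    then show ?thesis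
      by (simp add: w_def inner_diff_left val_def sum_list_nth_lessThan power2_norm_eq_inner)
  qed
  then have "(norm h)\<^sup>2 - val xs \<le> norm w * norm h" by (metis norm_cauchy_schwarz)
  also have "\<dots> \<le> C * \<epsilon> * norm h" by (intro mult_right_mono nw) simp
  also have "\<dots> = \<delta> * (C * norm h / (C * norm h + 1))" by (simp add: \<epsilon>_def)
  also have "\<dots> \<le> \<delta> * 1"
    using \<delta> den by (intro mult_left_mono) (auto simp: divide_le_eq)
  finally have "(norm h)\<^sup>2 - \<delta> \<le> val xs" by simp
  then show thesis using that[of xs] xs(1) by (simp add: G_def val_def)
qed

text \<open>The claim cuts only on the right, so that it adds over summands. At an irreducible
  summand the boundary property controls only the compression by \<open>q\<close>; the column
  estimate removes the part of \<open>\<psi> t\<close> outside the range of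
  \<open>q\<close>.\<close>

lemma extension_unique:
  fixes H :: "'c set" and K :: "'d set"
  assumes \<theta>: "representation T H K \<theta>"
    and ef: "orthonormal e m" "orthonormal f k" "intertwining T \<theta> (partial_isom e e m) (partial_isom f f k)"
    and B: "finite B" "B \<subseteq> T" "\<And>b. b \<in> B \<Longrightarrow> u b \<in> T"
      "\<And>v. v \<in> range (blinfun_apply (partial_isom e e m)) \<Longrightarrow>
        v = (\<Sum>b\<in>B. blinfun_apply (adj (\<theta> (u b))) (blinfun_apply (\<theta> b) v))"
    and \<psi>: "linear_map T H K \<psi>" "completely_contractive T \<psi>" and eq: "\<And>x. x \<in> X \<Longrightarrow> \<psi> x = \<theta> x"
  shows "\<forall>t\<in>T. \<forall>v. blinfun_apply (\<psi> t) (blinfun_apply (partial_isom e e m) v)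
    = blinfun_apply (\<theta> t) (blinfun_apply (partial_isom e e m) v)"
proof -
  note lin = representation_linear[OF \<theta>]
  have cl: "clin (\<theta> t)" if "t \<in> T" for t by (rule Bop_clin[OF linear_mapD(1)[OF lin that]])
  note zero = cop.subspace_0[OF subspace_T] linear_map_0[OF \<psi>(1) subspace_T]
  define Q where "Q p \<longleftrightarrow> (\<forall>t\<in>T. \<forall>v. blinfun_apply (\<psi> t) (blinfun_apply p v) = blinfun_apply (\<theta> t) (blinfun_apply p v))" for p :: "'c \<Rightarrow>\<^sub>L 'c"
  have "Q (partial_isom e e m)"
  proof (rule decomposition_induct[OF \<theta> ef(3), where F = "e ` {..<m}" and G = "f ` {..<k}" and P = "\<lambda>p q. Q p"])
    show "range (blinfun_apply (partial_isom e e m)) \<subseteq> cvec.span (e ` {..<m})"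
      "range (blinfun_apply (partial_isom f f k)) \<subseteq> cvec.span (f ` {..<k})"
      by (simp_all add: partial_isom_span ef)
    show "v = 0" if "blinfun_apply (partial_isom e e m) v = v" "\<And>t. t \<in> T \<Longrightarrow> blinfun_apply (\<theta> t) v = 0" for v
    proof -
      have "v \<in> range (blinfun_apply (partial_isom e e m))" using that(1) by (metis rangeI)
      then have "v = (\<Sum>b\<in>B. blinfun_apply (adj (\<theta> (u b))) (blinfun_apply (\<theta> b) v))" by (rule B(4))
      also have "\<dots> = 0" using B(2) that(2) by (intro sum.neutral) auto
      finally show ?thesis .
    qed
    show "Q 0" by (simp add: Q_def)
    show "Q (p + p')" if "Q p" "Q p'" for p p' q q'
      using that by (simp add: Q_def blinfun.add_left blinfun.add_right)
  next
    fix p q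
    assume pq: "intertwining T \<theta> p q" and sub: "range (blinfun_apply p) \<subseteq> cvec.span (e ` {..<m})"
      and hil: "hilbert (range (blinfun_apply p))" "hilbert (range (blinfun_apply q))"
      and irr: "irreducible_representation T (range (blinfun_apply p)) (range (blinfun_apply q)) (\<lambda>t. \<theta> t o\<^sub>L p)"
    have P: "proj p" "proj q" using pq by (auto simp: intertwining_def)
    define \<sigma> where "\<sigma> t = \<theta> t o\<^sub>L p" for t
    note irr' = irr[folded \<sigma>_def]
    have \<sigma>_rep: "representation T (range (blinfun_apply p)) (range (blinfun_apply q)) \<sigma>"
      using irr' by (simp add: irreducible_representation_def)
    have q\<psi>: "q o\<^sub>L \<psi> t o\<^sub>L p = \<sigma> t" if "t \<in> T" for t
    proof (rule irreducible_extension_unique[OF hil irr' _ _ _ that])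
      show "linear_map T (range (blinfun_apply p)) (range (blinfun_apply q)) (\<lambda>t. q o\<^sub>L \<psi> t o\<^sub>L p)"
        by (rule linear_map_compress[OF \<psi>(1) P])
      show "completely_contractive T (\<lambda>t. q o\<^sub>L \<psi> t o\<^sub>L p)"
        by (intro completely_contractive_compress \<psi> proj_norm_le_1 P)
      show "q o\<^sub>L \<psi> x o\<^sub>L p = \<sigma> x" if "x \<in> X" for x
        using X_T that
        by (intro blinfun_eqI) (auto simp: eq \<sigma>_def intertwiningD[OF pq] proj_idem[OF P(1)])
    qed
    \<comment> \<open>Applying \<open>p\<close> to the identity for \<open>\<theta>\<close> turns
      \<open>adj (\<theta> (u b))\<close> into \<open>adj (\<sigma> (u b))\<close>.\<close>
    have rec: "v = (\<Sum>b\<in>B. blinfun_apply (adj (\<sigma> (u b))) (blinfun_apply (\<sigma> b) v))"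
      if v: "v \<in> range (blinfun_apply p)" for v
    proof -
      have pv: "blinfun_apply p v = v" using v proj_range_iff[OF P(1)] by blast
      have "v \<in> range (blinfun_apply (partial_isom e e m))" using v sub by (auto simp: partial_isom_span ef)
      from arg_cong[OF B(4)[OF this], of "blinfun_apply p"]
      have "v = (\<Sum>b\<in>B. blinfun_apply p (blinfun_apply (adj (\<theta> (u b))) (blinfun_apply (\<theta> b) v)))"
        by (simp add: pv blinfun.sum_right)
      also have "\<dots> = (\<Sum>b\<in>B. blinfun_apply (adj (\<sigma> (u b))) (blinfun_apply (\<sigma> b) v))"
        using B(3) by (intro sum.cong refl)
          (simp add: \<sigma>_def pv adj_compose cl proj_clin[OF P(1)] proj_adj[OF P(1)])
      finally show ?thesis .
    qed
    have contr: "blinfun_apply (\<psi> t) h = blinfun_apply (\<theta> t) h"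
      if t: "t \<in> T" "norm t \<le> 1" and h: "h \<in> range (blinfun_apply p)" for t h
    proof -
      have ph: "blinfun_apply p h = h" using h proj_range_iff[OF P(1)] by blast
      have "(norm (blinfun_apply (\<psi> t) h - blinfun_apply (\<theta> t) h))\<^sup>2 \<le> 0 + \<delta>" if \<delta>: "\<delta> > 0" for \<delta>
      proof -
        obtain xs where xs: "set xs \<subseteq> T" "t \<in> set xs" "col_contraction xs"
          "(norm h)\<^sup>2 - \<delta> \<le> (\<Sum>x\<leftarrow>xs. (norm (blinfun_apply (\<sigma> x) h))\<^sup>2)"
          using nearly_isometric_column[OF \<sigma>_rep csubspace_range[OF proj_clin[OF P(1)]]
              closed_range_proj[OF P(1)] irreducible_completely_contractive[OF hil irr'] B(1-3) rec h t \<delta>]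
          by blast
        \<comment> \<open>Orthogonal splitting by \<open>q\<close>. Summed over the column, the
          \<open>\<sigma>\<close> parts already exhaust the square of \<open>norm h\<close> up to
          \<open>\<delta>\<close>, which leaves at most \<open>\<delta>\<close> for the
          errors.\<close>
        have split: "(norm (blinfun_apply (\<psi> x) h))\<^sup>2
            = (norm (blinfun_apply (\<sigma> x) h))\<^sup>2 + (norm (blinfun_apply (\<psi> x) h - blinfun_apply (\<theta> x) h))\<^sup>2"
          if "x \<in> T" for x
        proof -
          have "blinfun_apply q (blinfun_apply (\<psi> x) h) = blinfun_apply (\<sigma> x) h"
            using arg_cong[OF q\<psi>[OF that], of "\<lambda>A. blinfun_apply A h"] by (simp add: ph)
          moreover have "blinfun_apply (\<sigma> x) h = blinfun_apply (\<theta> x) h" by (simp add: \<sigma>_def ph)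
          ultimately show ?thesis using norm_proj_split[OF P(2), of "blinfun_apply (\<psi> x) h"] by simp
        qed
        have "(norm (blinfun_apply (\<psi> t) h - blinfun_apply (\<theta> t) h))\<^sup>2
            \<le> (\<Sum>x\<leftarrow>xs. (norm (blinfun_apply (\<psi> x) h - blinfun_apply (\<theta> x) h))\<^sup>2)"
          using xs(2) by (intro member_le_sum_list) auto
        moreover have "(\<Sum>x\<leftarrow>xs. (norm (blinfun_apply (\<psi> x) h))\<^sup>2)
            = (\<Sum>x\<leftarrow>xs. (norm (blinfun_apply (\<sigma> x) h))\<^sup>2)
              + (\<Sum>x\<leftarrow>xs. (norm (blinfun_apply (\<psi> x) h - blinfun_apply (\<theta> x) h))\<^sup>2)"
          unfolding sum_list_addf[symmetric] using xs(1)
          by (intro arg_cong[of _ _ sum_list] map_cong refl split) auto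
        moreover have "(\<Sum>x\<leftarrow>xs. (norm (blinfun_apply (\<psi> x) h))\<^sup>2) \<le> (norm h)\<^sup>2"
          using completely_contractive_column[OF \<psi>(2) zero xs(1,3)]
          by (simp add: col_contraction_def o_def)
        ultimately show ?thesis using xs(4) by linarith
      qed
      then have "(norm (blinfun_apply (\<psi> t) h - blinfun_apply (\<theta> t) h))\<^sup>2 \<le> 0" by (rule field_le_epsilon)
      then show ?thesis by simp
    qed
    show "Q p"
      unfolding Q_def
    proof (intro ballI allI)
      fix t v assume t: "t \<in> T"
      define c where "c = complex_of_real (1 / (1 + norm t))"
      have n: "1 + norm t > 0" by (simp add: add_pos_nonneg)
      have c0: "c \<noteq> 0" using n unfolding c_def of_real_eq_0_iff by simp
      have "norm (cscale c t) \<le> 1"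
        unfolding c_def norm_cscale norm_of_real using n by (simp add: divide_le_eq)
      then have "blinfun_apply (\<psi> (cscale c t)) (blinfun_apply p v) = blinfun_apply (\<theta> (cscale c t)) (blinfun_apply p v)"
        by (intro contr cop.subspace_scale[OF subspace_T t] rangeI)
      then show "blinfun_apply (\<psi> t) (blinfun_apply p v) = blinfun_apply (\<theta> t) (blinfun_apply p v)"
        using c0 by (simp add: linear_mapD(3)[OF lin t] linear_mapD(3)[OF \<psi>(1) t] cscale_apply)
    qed
  qed simp_all
  then show ?thesis by (simp add: Q_def)
qed

end

section \<open>Limits along ultrafilters\<close>

text \<open>A minimal proper filter below \<open>F\<close>, from Zorn's lemma. Minimality decides
  every \<open>P\<close>: restricting \<open>U\<close> to \<open>{x. P x}\<close> gives either the
  improper filter or \<open>U\<close> again.\<close>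

lemma ultrafilter_below:
  fixes F :: "'a filter"
  assumes "F \<noteq> bot"
  obtains U where "U \<le> F" "U \<noteq> bot" "\<And>P. eventually P U \<or> eventually (\<lambda>x. \<not> P x) U"
proof -
  let ?A = "{U. U \<le> F \<and> U \<noteq> bot}"
  have "\<exists>U\<in>?A. \<forall>V\<in>?A. V \<le> U \<longrightarrow> V = U"
  proof (rule predicate_Zorn)
    show "partial_order_on ?A (relation_of (\<lambda>U V. V \<le> U) ?A)"
      by (rule partial_order_on_relation_ofI) auto
    fix C assume C: "C \<in> Chains (relation_of (\<lambda>U V. V \<le> U) ?A)"
    show "\<exists>U\<in>?A. \<forall>V\<in>C. U \<le> V"
    proof (cases "C = {}")
      case True
      then show ?thesis using assms by blast
    next
      case False
      have sub: "C \<subseteq> ?A" using C by (auto simp: Chains_def relation_of_def)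
      \<comment> \<open>A chain is directed, so an event of the infimum is already an event of some
        member; in particular the infimum stays proper.\<close>
      have ev: "eventually P (Inf C) \<longleftrightarrow> (\<exists>V\<in>C. eventually P V)" for P
      proof (rule eventually_Inf_base[OF False])
        fix V W assume "V \<in> C" "W \<in> C"
        then have "W \<le> V \<or> V \<le> W" using C by (auto simp: Chains_def relation_of_def)
        then show "\<exists>x\<in>C. x \<le> inf V W" using \<open>V \<in> C\<close> \<open>W \<in> C\<close> by (auto intro: bexI[of _ V] bexI[of _ W])
      qed
      have "Inf C \<noteq> bot"
        using ev[of "\<lambda>_. False"] sub by (auto simp: trivial_limit_def)
      moreover have "Inf C \<le> F"
        using False sub by (auto intro: Inf_lower2)
      ultimately show ?thesis by (auto intro!: bexI[of _ "Inf C"] Inf_lower)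
    qed
  qed
  then obtain U where U: "U \<le> F" "U \<noteq> bot" and min: "\<And>V. V \<noteq> bot \<Longrightarrow> V \<le> U \<Longrightarrow> V = U"
    using order.trans by blast
  have "eventually P U \<or> eventually (\<lambda>x. \<not> P x) U" for P
  proof (cases "inf U (principal {x. P x}) = bot")
    case True
    then have "eventually (\<lambda>_. False) (inf U (principal {x. P x}))" by simp
    then show ?thesis by (simp add: eventually_inf_principal)
  next
    case False
    then have "inf U (principal {x. P x}) = U" by (intro min) auto
    then have "U \<le> principal {x. P x}" by (metis inf_le2)
    then show ?thesis by (simp add: le_principal)
  qed
  then show thesis using that U by blast
qed

text \<open>Compactness of the disc gives a cluster point, and an ultrafilter converges to its
  cluster points.\<close>

lemma ultrafilter_bounded_limit:
  fixes f :: "'a \<Rightarrow> complex"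
  assumes U: "U \<noteq> bot" "\<And>P. eventually P U \<or> eventually (\<lambda>x. \<not> P x) U"
    and bd: "eventually (\<lambda>x. cmod (f x) \<le> C) U"
  obtains l where "(f \<longlongrightarrow> l) U"
proof -
  have "eventually (\<lambda>z. z \<in> cball 0 C) (filtermap f U)"
    using bd by (simp add: eventually_filtermap)
  moreover have "filtermap f U \<noteq> bot" using U(1) by (simp add: filtermap_bot_iff)
  ultimately obtain l where l: "inf (nhds l) (filtermap f U) \<noteq> bot"
    using compact_cball[of "0::complex" C] unfolding compact_filter by blast
  have "(f \<longlongrightarrow> l) U"
    unfolding tendsto_def
  proof (intro allI impI)
    fix S assume S: "open S" "l \<in> S"
    show "eventually (\<lambda>x. f x \<in> S) U"
    proof (rule ccontr)
      assume "\<not> ?thesis"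
      then have "eventually (\<lambda>z. z \<notin> S) (filtermap f U)"
        using U(2)[of "\<lambda>x. f x \<in> S"] by (simp add: eventually_filtermap)
      moreover have "eventually (\<lambda>z. z \<in> S) (nhds l)" using S by (rule eventually_nhds_in_open)
      ultimately have "eventually (\<lambda>z. False) (inf (nhds l) (filtermap f U))"
        unfolding eventually_inf by blast
      then show False using l by (simp add: trivial_limit_def)
    qed
  qed
  then show thesis using that by blast
qed

text \<open>Serves to make the dimensions of the reducing pairs constant: finitely many values
  cannot all be avoided along an ultrafilter.\<close>

lemma ultrafilter_bounded_nat:
  fixes f :: "'a \<Rightarrow> nat"
  assumes U: "U \<noteq> bot" "\<And>P. eventually P U \<or> eventually (\<lambda>x. \<not> P x) U"
    and bd: "eventually (\<lambda>x. f x \<le> D) U"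
  obtains d where "eventually (\<lambda>x. f x = d) U"
proof (rule ccontr)
  assume "\<not> thesis"
  then have "eventually (\<lambda>x. f x \<noteq> d) U" for d
    using U(2)[of "\<lambda>x. f x = d"] that by blast
  then have "eventually (\<lambda>x. \<forall>d\<in>{..D}. f x \<noteq> d) U"
    by (simp add: eventually_ball_finite_distrib)
  with bd have "eventually (\<lambda>_. False) U" by eventually_elim auto
  then show False using U(1) by (simp add: trivial_limit_def)
qed

section \<open>Compression and transport by frames\<close>

lemma orthonormal_norm:
  assumes "orthonormal e m" "i < m" shows "norm (e i) = 1"
proof -
  have "complex_of_real ((norm (e i))\<^sup>2) = complex_of_real 1"
    unfolding cinner_self[symmetric] using assms by (simp add: orthonormal_def)
  then have "(norm (e i))\<^sup>2 = 1\<^sup>2" unfolding of_real_eq_iff by simp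
  then show ?thesis by (rule power2_eq_imp_eq) simp_all
qed

lemma partial_isom_compose_apply:
  "orthonormal e m \<Longrightarrow> blinfun_apply (partial_isom f e m) (blinfun_apply (partial_isom e g m) v) = blinfun_apply (partial_isom f g m) v"
  by (metis blinfun_apply_blinfun_compose partial_isom_compose)

lemma norm_partial_isom_apply:
  assumes "orthonormal e m" "orthonormal f m"
  shows "norm (blinfun_apply (partial_isom f e m) x) = norm (blinfun_apply (partial_isom e e m) x)"
proof -
  have "(norm (blinfun_apply (partial_isom f e m) x))\<^sup>2 = (norm (blinfun_apply (partial_isom e e m) x))\<^sup>2"
  proof -
    have "inner (blinfun_apply (partial_isom g e m) x) (blinfun_apply (partial_isom g e m) x)
        = inner x (blinfun_apply (partial_isom e e m) x)" if "orthonormal g m" for g :: "nat \<Rightarrow> 'x::chilbert_space"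
      using inner_adj_left[of "partial_isom e g m" x "blinfun_apply (partial_isom g e m) x"]
      by (simp add: adj_partial_isom partial_isom_compose_apply[OF that])
    from this[OF assms(1)] this[OF assms(2)] show ?thesis by (simp add: power2_norm_eq_inner)
  qed
  then show ?thesis by simp
qed

lemma norm_partial_isom_le_1:
  assumes "orthonormal e m" "orthonormal f m"
  shows "norm (partial_isom f e m) \<le> 1"
  by (rule norm_blinfun_bound) (simp_all add: norm_partial_isom_apply[OF assms] norm_proj_le proj_partial_isom assms)

text \<open>The rank-one operators depend only on the target frames \<open>g\<close> and
  \<open>d\<close>, so norm convergence of such compressions with varying \<open>e\<close>,
  \<open>f\<close>, \<open>A\<close> reduces to convergence of finitely many complex
  numbers.\<close>

lemma partial_isom_matrix:
  assumes "clin A"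
  shows "partial_isom g f k o\<^sub>L A o\<^sub>L partial_isom e d m
    = (\<Sum>i<m. \<Sum>j<k. cscale (cinner (blinfun_apply A (e i)) (f j)) (rank_one (g j) (d i)))"
proof (rule blinfun_eqI)
  fix x
  have "blinfun_apply (partial_isom g f k o\<^sub>L A o\<^sub>L partial_isom e d m) x
      = (\<Sum>i<m. cinner x (d i) *\<^sub>C blinfun_apply (partial_isom g f k) (blinfun_apply A (e i)))"
    by (simp add: partial_isom_apply[of e d] blinfun.sum_right clinD[OF assms] clinD)
  also have "\<dots> = (\<Sum>i<m. \<Sum>j<k. (cinner x (d i) * cinner (blinfun_apply A (e i)) (f j)) *\<^sub>C g j)"
    by (simp add: partial_isom_apply[of g f] cvec.scale_sum_right scaleC_scaleC)
  also have "\<dots> = blinfun_apply (\<Sum>i<m. \<Sum>j<k. cscale (cinner (blinfun_apply A (e i)) (f j)) (rank_one (g j) (d i))) x"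
    by (simp add: blinfun.sum_left cscale_apply rank_one_apply scaleC_scaleC mult.commute)
  finally show "blinfun_apply (partial_isom g f k o\<^sub>L A o\<^sub>L partial_isom e d m) x
    = blinfun_apply (\<Sum>i<m. \<Sum>j<k. cscale (cinner (blinfun_apply A (e i)) (f j)) (rank_one (g j) (d i))) x" .
qed

text \<open>The frames \<open>e\<close> and \<open>f\<close> move with the index while
  \<open>g\<close> and \<open>d\<close> stay, so all compressions live in one finite-dimensional
  space; their entries are bounded by Cauchy-Schwarz.\<close>

lemma ultrafilter_compression_limit:
  fixes A :: "'i \<Rightarrow> 'a::chilbert_space \<Rightarrow>\<^sub>L 'b::chilbert_space"
  assumes U: "U \<noteq> bot" "\<And>P. eventually P U \<or> eventually (\<lambda>x. \<not> P x) U"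
    and cl: "\<And>n. clin (A n)" and bd: "\<And>n. norm (A n) \<le> C"
    and ef: "eventually (\<lambda>n. orthonormal (e n) m \<and> orthonormal (f n) k) U"
  obtains L where "((\<lambda>n. partial_isom g (f n) k o\<^sub>L A n o\<^sub>L partial_isom (e n) d m) \<longlongrightarrow> L) U"
proof -
  have "\<exists>l. ((\<lambda>n. cinner (blinfun_apply (A n) (e n i)) (f n j)) \<longlongrightarrow> l) U" if ij: "i < m" "j < k" for i j
  proof -
    have "eventually (\<lambda>n. cmod (cinner (blinfun_apply (A n) (e n i)) (f n j)) \<le> C) U"
      using ef
    proof eventually_elim
      case (elim n)
      have "cmod (cinner (blinfun_apply (A n) (e n i)) (f n j)) \<le> norm (blinfun_apply (A n) (e n i)) * norm (f n j)"
        by (rule cmod_cinner_le)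
      also have "\<dots> \<le> norm (A n) * norm (e n i) * norm (f n j)"
        by (intro mult_right_mono norm_blinfun) simp
      also have "\<dots> \<le> C" using elim bd[of n] by (simp add: orthonormal_norm[OF _ ij(1)] orthonormal_norm[OF _ ij(2)])
      finally show ?case .
    qed
    then show ?thesis using ultrafilter_bounded_limit[OF U] by metis
  qed
  then obtain l where l: "\<And>i j. i < m \<Longrightarrow> j < k \<Longrightarrow>
      ((\<lambda>n. cinner (blinfun_apply (A n) (e n i)) (f n j)) \<longlongrightarrow> l i j) U"
    by metis
  have "((\<lambda>n. partial_isom g (f n) k o\<^sub>L A n o\<^sub>L partial_isom (e n) d m)
      \<longlongrightarrow> (\<Sum>i<m. \<Sum>j<k. cscale (l i j) (rank_one (g j) (d i)))) U"
    unfolding partial_isom_matrix[OF cl] by (intro tendsto_sum tendsto_cscale l) auto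
  then show thesis by (rule that)
qed

section \<open>Limits of linear maps and of representations\<close>

lemma linear_map_limit:
  assumes F: "F \<noteq> bot" and H: "cvec.subspace K" "closed K" and T: "cop.subspace T"
    and lin: "eventually (\<lambda>n. linear_map T H K (\<phi> n)) F"
    and lim: "\<And>x. x \<in> T \<Longrightarrow> ((\<lambda>n. \<phi> n x) \<longlongrightarrow> \<psi> x) F"
  shows "linear_map T H K \<psi>"
  unfolding linear_map_def
proof (intro conjI ballI allI)
  fix x assume x: "x \<in> T"
  show "\<psi> x \<in> Bop H K"
  proof (rule Lim_in_closed_set[OF Bop_closed[OF H(2)] _ F lim[OF x]])
    show "eventually (\<lambda>n. \<phi> n x \<in> Bop H K) F"
      using lin by eventually_elim (rule linear_mapD(1)[OF _ x])
  qed
  fix c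
  have "((\<lambda>n. \<phi> n (cscale c x)) \<longlongrightarrow> cscale c (\<psi> x)) F"
  proof (rule Lim_transform_eventually)
    show "((\<lambda>n. cscale c (\<phi> n x)) \<longlongrightarrow> cscale c (\<psi> x)) F"
      unfolding cscale_def by (intro bounded_bilinear.tendsto[OF bounded_bilinear_blinfun_compose] tendsto_const lim x)
    show "eventually (\<lambda>n. cscale c (\<phi> n x) = \<phi> n (cscale c x)) F"
      using lin by eventually_elim (simp add: linear_mapD(3)[OF _ x])
  qed
  then show "\<psi> (cscale c x) = cscale c (\<psi> x)"
    using tendsto_unique[OF F lim[OF cop.subspace_scale[OF T x]]] by blast
next
  fix x y assume x: "x \<in> T" and y: "y \<in> T"
  have "((\<lambda>n. \<phi> n (x + y)) \<longlongrightarrow> \<psi> x + \<psi> y) F"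
  proof (rule Lim_transform_eventually)
    show "((\<lambda>n. \<phi> n x + \<phi> n y) \<longlongrightarrow> \<psi> x + \<psi> y) F" by (intro tendsto_add lim x y)
    show "eventually (\<lambda>n. \<phi> n x + \<phi> n y = \<phi> n (x + y)) F"
      using lin by eventually_elim (simp add: linear_mapD(2)[OF _ x y])
  qed
  then show "\<psi> (x + y) = \<psi> x + \<psi> y"
    using tendsto_unique[OF F lim[OF cop.subspace_add[OF T x y]]] by blast
qed

text \<open>Convergence is in norm, so composition and, on complex-linear operators,
  \<open>adj\<close> are continuous, and the triple identity passes to the limit.\<close>

lemma representation_limit:
  assumes F: "F \<noteq> bot" and H: "cvec.subspace K" "closed K" and T: "cop.subspace T"
    and tr: "\<And>x y z. x \<in> T \<Longrightarrow> y \<in> T \<Longrightarrow> z \<in> T \<Longrightarrow> triple x y z \<in> T"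
    and rep: "eventually (\<lambda>n. representation T H K (\<theta> n)) F"
    and lim: "\<And>x. x \<in> T \<Longrightarrow> ((\<lambda>n. \<theta> n x) \<longlongrightarrow> \<sigma> x) F"
  shows "representation T H K \<sigma>"
  unfolding representation_def
proof (intro conjI ballI)
  show lin: "linear_map T H K \<sigma>"
    using rep by (intro linear_map_limit[OF F H T _ lim]) (auto elim: eventually_mono simp: representation_def)
  fix x y z assume xyz: "x \<in> T" "y \<in> T" "z \<in> T"
  have "((\<lambda>n. \<theta> n (triple x y z)) \<longlongrightarrow> triple (\<sigma> x) (\<sigma> y) (\<sigma> z)) F"
  proof (rule Lim_transform_eventually)
    have "((\<lambda>n. adj (\<theta> n y)) \<longlongrightarrow> adj (\<sigma> y)) F"
    proof (rule tendsto_adj[OF lim[OF xyz(2)]])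
      show "eventually (\<lambda>n. clin (\<theta> n y)) F"
        using rep by eventually_elim (rule Bop_clin[OF linear_mapD(1)[OF representation_linear xyz(2)]])
      show "clin (\<sigma> y)" by (rule Bop_clin[OF linear_mapD(1)[OF lin xyz(2)]])
    qed
    then show "((\<lambda>n. triple (\<theta> n x) (\<theta> n y) (\<theta> n z)) \<longlongrightarrow> triple (\<sigma> x) (\<sigma> y) (\<sigma> z)) F"
      unfolding triple_def by (intro bounded_bilinear.tendsto[OF bounded_bilinear_blinfun_compose] lim xyz)
    show "eventually (\<lambda>n. triple (\<theta> n x) (\<theta> n y) (\<theta> n z) = \<theta> n (triple x y z)) F"
      using rep by eventually_elim (simp add: representation_triple xyz)
  qed
  then show "\<sigma> (triple x y z) = triple (\<sigma> x) (\<sigma> y) (\<sigma> z)"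
    using tendsto_unique[OF F lim[OF tr[OF xyz]]] by blast
qed

section \<open>Maps transported to the model pair\<close>

lemma linear_map_transfer:
  assumes \<phi>: "linear_map T H K \<phi>" and d: "orthonormal d m" and g: "orthonormal g k"
  shows "linear_map T (range (blinfun_apply (partial_isom d d m))) (range (blinfun_apply (partial_isom g g k)))
    (\<lambda>x. partial_isom g f k o\<^sub>L \<phi> x o\<^sub>L partial_isom e d m)"
  unfolding linear_map_def
proof (intro conjI ballI allI)
  fix x assume x: "x \<in> T"
  have cl: "clin (\<phi> x)" by (rule Bop_clin[OF linear_mapD(1)[OF \<phi> x]])
  have gg: "blinfun_apply (partial_isom g g k) (blinfun_apply (partial_isom g f k) v) = blinfun_apply (partial_isom g f k) v" for v
    by (rule partial_isom_compose_apply[OF g])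
  have dd: "blinfun_apply (partial_isom e d m) (blinfun_apply (partial_isom d d m) v) = blinfun_apply (partial_isom e d m) v" for v
    by (rule partial_isom_compose_apply[OF d])
  show "partial_isom g f k o\<^sub>L \<phi> x o\<^sub>L partial_isom e d m
      \<in> Bop (range (blinfun_apply (partial_isom d d m))) (range (blinfun_apply (partial_isom g g k)))"
    unfolding Bop_range_iff[OF proj_partial_isom[OF d] proj_partial_isom[OF g]]
    by (auto intro!: clin_compose cl blinfun_eqI simp: gg dd)
  show "partial_isom g f k o\<^sub>L \<phi> (cscale c x) o\<^sub>L partial_isom e d m = cscale c (partial_isom g f k o\<^sub>L \<phi> x o\<^sub>L partial_isom e d m)" for c
    unfolding linear_mapD(3)[OF \<phi> x]
    by (rule blinfun_eqI) (simp add: cscale_apply clinD)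
  fix y assume y: "y \<in> T"
  show "partial_isom g f k o\<^sub>L \<phi> (x + y) o\<^sub>L partial_isom e d m
      = (partial_isom g f k o\<^sub>L \<phi> x o\<^sub>L partial_isom e d m) + (partial_isom g f k o\<^sub>L \<phi> y o\<^sub>L partial_isom e d m)"
    unfolding linear_mapD(2)[OF \<phi> x y]
    by (rule blinfun_eqI) (simp add: blinfun.add_left blinfun.add_right)
qed

text \<open>\<open>\<pi> z\<close> sends the span of the frame \<open>e\<close> into that of
  \<open>f\<close>, so the round trip from \<open>f\<close> to \<open>g\<close> and back does
  nothing there.\<close>

lemma intertwining_transfer_adj:
  assumes \<pi>: "representation T H K \<pi>" and ef: "orthonormal e m" "orthonormal f k"
    and int: "intertwining T \<pi> (partial_isom e e m) (partial_isom f f k)" and g: "orthonormal g k"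
    and y: "y \<in> T" and z: "z \<in> T"
  shows "blinfun_apply (adj (partial_isom g f k o\<^sub>L \<pi> y o\<^sub>L partial_isom e d m))
      (blinfun_apply (partial_isom g f k o\<^sub>L \<pi> z o\<^sub>L partial_isom e d m) v)
    = blinfun_apply (partial_isom d e m) (blinfun_apply (adj (\<pi> y)) (blinfun_apply (\<pi> z) (blinfun_apply (partial_isom e d m) v)))"
proof -
  have cl: "clin (\<pi> t)" if "t \<in> T" for t
    by (rule Bop_clin[OF linear_mapD(1)[OF representation_linear[OF \<pi>] that]])
  have "adj (partial_isom g f k o\<^sub>L \<pi> y o\<^sub>L partial_isom e d m) = partial_isom d e m o\<^sub>L (adj (\<pi> y) o\<^sub>L partial_isom f g k)"
    using cl[OF y] by (simp add: adj_compose clin_compose adj_partial_isom)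
  moreover have "blinfun_apply (partial_isom f f k) (blinfun_apply (\<pi> z) (blinfun_apply (partial_isom e d m) v))
      = blinfun_apply (\<pi> z) (blinfun_apply (partial_isom e d m) v)"
    by (simp add: intertwiningD[OF int z] partial_isom_compose_apply ef)
  ultimately show ?thesis by (simp add: partial_isom_compose_apply g)
qed

lemma representation_transfer:
  assumes \<pi>: "representation T H K \<pi>" and ef: "orthonormal e m" "orthonormal f k"
    and int: "intertwining T \<pi> (partial_isom e e m) (partial_isom f f k)"
    and d: "orthonormal d m" and g: "orthonormal g k"
  shows "representation T (range (blinfun_apply (partial_isom d d m))) (range (blinfun_apply (partial_isom g g k)))
    (\<lambda>x. partial_isom g f k o\<^sub>L \<pi> x o\<^sub>L partial_isom e d m)"
  unfolding representation_def
proof (intro conjI ballI linear_map_transfer[OF representation_linear[OF \<pi>] d g])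
  fix x y z assume xyz: "x \<in> T" "y \<in> T" "z \<in> T"
  have cl: "clin (\<pi> t)" if "t \<in> T" for t
    by (rule Bop_clin[OF linear_mapD(1)[OF representation_linear[OF \<pi>] that]])
  have P: "proj (partial_isom e e m)" using ef by (simp add: proj_partial_isom)
  have *: "blinfun_apply (partial_isom e e m) (blinfun_apply (adj (\<pi> y)) (blinfun_apply (\<pi> z) (blinfun_apply (partial_isom e d m) v)))
      = blinfun_apply (adj (\<pi> y)) (blinfun_apply (\<pi> z) (blinfun_apply (partial_isom e d m) v))" for v
  proof -
    have "blinfun_apply (partial_isom f f k) (blinfun_apply (\<pi> z) (blinfun_apply (partial_isom e d m) v))
        = blinfun_apply (\<pi> z) (blinfun_apply (partial_isom e d m) v)"
      by (simp add: intertwiningD[OF int xyz(3)] partial_isom_compose_apply ef)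
    moreover have "blinfun_apply (partial_isom e e m) (blinfun_apply (adj (\<pi> y)) w)
        = blinfun_apply (adj (\<pi> y)) (blinfun_apply (partial_isom f f k) w)" for w
      using arg_cong[OF intertwining_adj[OF int xyz(2) cl[OF xyz(2)]], of "\<lambda>A. blinfun_apply A w"] by simp
    ultimately show ?thesis by simp
  qed
  show "partial_isom g f k o\<^sub>L \<pi> (triple x y z) o\<^sub>L partial_isom e d m
      = triple (partial_isom g f k o\<^sub>L \<pi> x o\<^sub>L partial_isom e d m) (partial_isom g f k o\<^sub>L \<pi> y o\<^sub>L partial_isom e d m)
          (partial_isom g f k o\<^sub>L \<pi> z o\<^sub>L partial_isom e d m)"
  proof (rule blinfun_eqI)
    fix v
    show "blinfun_apply (partial_isom g f k o\<^sub>L \<pi> (triple x y z) o\<^sub>L partial_isom e d m) v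
      = blinfun_apply (triple (partial_isom g f k o\<^sub>L \<pi> x o\<^sub>L partial_isom e d m) (partial_isom g f k o\<^sub>L \<pi> y o\<^sub>L partial_isom e d m)
          (partial_isom g f k o\<^sub>L \<pi> z o\<^sub>L partial_isom e d m)) v"
      unfolding triple_apply intertwining_transfer_adj[OF \<pi> ef int g xyz(2,3)]
      by (simp add: representation_triple[OF \<pi> xyz] triple_apply partial_isom_compose_apply d *)
  qed
qed

text \<open>Scaling by \<open>1 + norm x\<close> avoids a separate case for \<open>x = 0\<close>; a
  bound uniform in the map is all that the limits of matrix entries require.\<close>

lemma completely_contractive_bound:
  assumes cc: "completely_contractive T \<phi>" and lin: "linear_map T H K \<phi>" and T: "cop.subspace T" and x: "x \<in> T"
  shows "norm (\<phi> x) \<le> 1 + norm x"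
proof -
  have n: "1 + norm x > 0" by (simp add: add_pos_nonneg)
  have "norm (cscale (of_real (1 / (1 + norm x))) x) \<le> 1"
    unfolding norm_cscale norm_of_real using n by (simp add: divide_le_eq)
  then have "norm (\<phi> (cscale (of_real (1 / (1 + norm x))) x)) \<le> 1"
    using completely_contractive_norm[OF cc cop.subspace_0[OF T] linear_map_0[OF lin T]]
      cop.subspace_scale[OF T x] by blast
  then show ?thesis
    unfolding linear_mapD(3)[OF lin x] norm_cscale norm_of_real using n by (simp add: divide_le_eq)
qed

section \<open>Hyperrigidity\<close>

context boundary_tro
begin

lemma hyperrigid: "rectangular_hyperrigid TYPE('c) TYPE('d) X T"
  unfolding rectangular_hyperrigid_def
proof (intro allI impI ballI, elim conjE)
  fix H :: "'c set" and K :: "'d set" and \<pi> and \<phi> :: "nat \<Rightarrow> ('c \<Rightarrow>\<^sub>L 'd) \<Rightarrow> ('c \<Rightarrow>\<^sub>L 'd)" and t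
  assume H: "hilbert H" and K: "hilbert K" and \<pi>: "representation T H K \<pi>" and nd: "nondegenerate T H K \<pi>"
    and \<phi>: "\<forall>n. linear_map (Bop H K) H K (\<phi> n) \<and> completely_contractive (Bop H K) (\<phi> n) \<and> cb_norm (Bop H K) (\<phi> n) = 1"
    and conv: "\<forall>g\<in>X. (\<lambda>n. norm (\<phi> n (\<pi> g) - \<pi> g)) \<longlonglongrightarrow> 0" and t: "t \<in> T"
  have HK: "cvec.subspace H" "closed H" "cvec.subspace K" "closed K" using H K by (auto simp: hilbert_def)
  note lin\<pi> = representation_linear[OF \<pi>]
  have \<pi>B: "\<pi> x \<in> Bop H K" if "x \<in> T" for x by (rule linear_mapD(1)[OF lin\<pi> that])
  have cl\<pi>: "clin (\<pi> x)" if "x \<in> T" for x by (rule Bop_clin[OF \<pi>B[OF that]])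
  have cc\<phi>: "completely_contractive T (\<lambda>x. \<phi> n (\<pi> x))" for n
    using completely_contractive_comp[OF representation_completely_contractive[OF \<pi> H K nd], of "Bop H K" "\<phi> n"] \<phi> \<pi>B
    by blast
  have lin\<phi>: "linear_map T H K (\<lambda>x. \<phi> n (\<pi> x))" for n
  proof -
    have l: "linear_map (Bop H K) H K (\<phi> n)" using \<phi> by blast
    show ?thesis
      unfolding linear_map_def
      by (simp add: linear_mapD[OF lin\<pi>] linear_mapD[OF l] \<pi>B)
  qed
  have cl\<phi>: "clin (\<phi> n (\<pi> x))" if "x \<in> T" for x n by (rule Bop_clin[OF linear_mapD(1)[OF lin\<phi> that]])
  show "(\<lambda>n. norm (\<phi> n (\<pi> t) - \<pi> t)) \<longlonglongrightarrow> 0"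
  proof (rule ccontr)
    assume "\<not> ?thesis"
    then obtain \<epsilon> where \<epsilon>: "\<epsilon> > 0" and "\<not> eventually (\<lambda>n. norm (\<phi> n (\<pi> t) - \<pi> t) < \<epsilon>) sequentially"
      unfolding tendsto_iff by auto
    \<comment> \<open>Restricting to the bad indices before refining to an ultrafilter makes the
      failure at \<open>t\<close> hold along \<open>U\<close>, while convergence on \<open>X\<close>
      persists.\<close>
    then have "inf sequentially (principal {n. norm (\<phi> n (\<pi> t) - \<pi> t) \<ge> \<epsilon>}) \<noteq> bot"
      by (auto simp: trivial_limit_def eventually_inf_principal not_le)
    then obtain U where Ule: "U \<le> inf sequentially (principal {n. norm (\<phi> n (\<pi> t) - \<pi> t) \<ge> \<epsilon>})"
      and U_bot: "U \<noteq> bot" and U_ultra: "\<forall>P. eventually P U \<or> eventually (\<lambda>n. \<not> P n) U"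
      by (rule ultrafilter_below) simp
    note U = U_bot spec[OF U_ultra]
    have Useq: "U \<le> sequentially" using Ule by simp
    have bad: "eventually (\<lambda>n. norm (\<phi> n (\<pi> t) - \<pi> t) \<ge> \<epsilon>) U"
      using Ule by (simp add: le_principal)
    obtain D where D: "\<forall>S R. finite S \<longrightarrow> finite R \<longrightarrow> S \<subseteq> H \<longrightarrow> R \<subseteq> K \<longrightarrow>
      (\<exists>e m f k. reducing_system T H K \<pi> S R (D * (card S + card R)) e m f k)"
      using finite_dimensional_reduction[OF \<pi> H K] ..
    \<comment> \<open>Half of \<open>\<epsilon>\<close>, because an operator norm need not be
      attained. The image of \<open>s\<close> is captured too, so that compression loses nothing of
      the difference at \<open>s\<close>; one vector on each side gives the bound
      \<open>D + D\<close>.\<close>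
    define good where "good n s e m f k \<longleftrightarrow>
      \<epsilon> / 2 * norm s < norm (blinfun_apply (\<phi> n (\<pi> t) - \<pi> t) s) \<and>
      reducing_system T H K \<pi> {s} {blinfun_apply (\<phi> n (\<pi> t)) s} (D + D) e m f k" for n s e m f k
    have "\<exists>s e m f k. good n s e m f k" if n: "norm (\<phi> n (\<pi> t) - \<pi> t) \<ge> \<epsilon>" for n
    proof -
      let ?A = "\<phi> n (\<pi> t) - \<pi> t"
      have A: "?A \<in> Bop H K"
        by (intro cop.subspace_diff Bop_subspace HK \<pi>B linear_mapD(1)[OF lin\<phi>] t)
      have "\<exists>x. \<epsilon> / 2 * norm x < norm (blinfun_apply ?A x)"
      proof (rule ccontr)
        assume "\<not> ?thesis"
        then have "norm ?A \<le> \<epsilon> / 2"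
          using \<epsilon> by (intro norm_blinfun_bound) (auto simp: not_less)
        then show False using n \<epsilon> by simp
      qed
      then obtain x where x: "\<epsilon> / 2 * norm x < norm (blinfun_apply ?A x)" ..
      obtain s where s: "s \<in> H" "norm s \<le> norm x" "blinfun_apply ?A x = blinfun_apply ?A s"
        using Bop_project[OF H, of x] A by metis
      have "\<epsilon> / 2 * norm s \<le> \<epsilon> / 2 * norm x" using \<epsilon> s(2) by simp
      then have "\<epsilon> / 2 * norm s < norm (blinfun_apply ?A s)" using x s(3) by simp
      moreover have "blinfun_apply (\<phi> n (\<pi> t)) s \<in> K"
        by (rule Bop_range[OF linear_mapD(1)[OF lin\<phi> t]])
      then have "\<exists>e m f k. reducing_system T H K \<pi> {s} {blinfun_apply (\<phi> n (\<pi> t)) s} (D + D) e m f k"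
        using D[THEN spec, of "{s}", THEN spec, of "{blinfun_apply (\<phi> n (\<pi> t)) s}"] s(1) by simp
      ultimately show ?thesis unfolding good_def by blast
    qed
    then obtain s e m f k where good: "\<And>n. norm (\<phi> n (\<pi> t) - \<pi> t) \<ge> \<epsilon> \<Longrightarrow> good n (s n) (e n) (m n) (f n) (k n)"
      by metis
    have mk: "m n \<le> D + D" "k n \<le> D + D" if "norm (\<phi> n (\<pi> t) - \<pi> t) \<ge> \<epsilon>" for n
      using good[OF that] by (auto simp: good_def reducing_system_def)
    obtain M where M: "eventually (\<lambda>n. m n = M) U"
      by (rule ultrafilter_bounded_nat[OF U eventually_mono[OF bad mk(1)]])
    obtain N where N: "eventually (\<lambda>n. k n = N) U"
      by (rule ultrafilter_bounded_nat[OF U eventually_mono[OF bad mk(2)]])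
    have ev: "eventually (\<lambda>n. good n (s n) (e n) M (f n) N) U"
      using bad M N by eventually_elim (use good in auto)
    have "\<exists>n. good n (s n) (e n) M (f n) N"
      using eventually_happens[OF ev] U(1) by blast
    then obtain n0 where n0: "good n0 (s n0) (e n0) M (f n0) N" ..
    \<comment> \<open>The model frames are those of one good index, so the limit maps stay in the
      types to which the boundary hypothesis applies.\<close>
    define d where "d = e n0"
    define g where "g = f n0"
    have dg: "orthonormal d M" "orthonormal g N" using n0 by (auto simp: good_def reducing_system_def d_def g_def)
    have evE: "eventually (\<lambda>n. orthonormal (e n) M \<and> orthonormal (f n) N) U"
      using ev by eventually_elim (auto simp: good_def reducing_system_def)
    define \<theta>n where "\<theta>n n x = partial_isom g (f n) N o\<^sub>L \<pi> x o\<^sub>L partial_isom (e n) d M" for n x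
    define \<psi>n where "\<psi>n n x = partial_isom g (f n) N o\<^sub>L \<phi> n (\<pi> x) o\<^sub>L partial_isom (e n) d M" for n x
    have "\<exists>L. ((\<lambda>n. \<theta>n n x) \<longlongrightarrow> L) U" if x: "x \<in> T" for x
      unfolding \<theta>n_def
      by (rule ultrafilter_compression_limit[where g = g and d = d, OF U cl\<pi>[OF x] order_refl evE]) blast
    then obtain \<theta> where \<theta>lim: "\<And>x. x \<in> T \<Longrightarrow> ((\<lambda>n. \<theta>n n x) \<longlongrightarrow> \<theta> x) U" by metis
    have "\<exists>L. ((\<lambda>n. \<psi>n n x) \<longlongrightarrow> L) U" if x: "x \<in> T" for x
      unfolding \<psi>n_def
      by (rule ultrafilter_compression_limit[where A = "\<lambda>n. \<phi> n (\<pi> x)" and g = g and d = d, OF U cl\<phi>[OF x]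
            completely_contractive_bound[OF cc\<phi> lin\<phi> subspace_T x] evE]) blast
    then obtain \<psi> where \<psi>lim: "\<And>x. x \<in> T \<Longrightarrow> ((\<lambda>n. \<psi>n n x) \<longlongrightarrow> \<psi> x) U" by metis
    define p where "p = partial_isom d d M"
    define q where "q = partial_isom g g N"
    have P: "proj p" "proj q" by (simp_all add: p_def q_def proj_partial_isom dg)
    note csub = csubspace_range[OF proj_clin[OF P(2)]] closed_range_proj[OF P(2)]
    have repn: "eventually (\<lambda>n. representation T (range (blinfun_apply p)) (range (blinfun_apply q)) (\<theta>n n)) U"
      using ev
    proof eventually_elim
      case (elim n)
      then show ?case
        unfolding \<theta>n_def[abs_def] p_def q_def good_def reducing_system_def
        by (intro representation_transfer[OF \<pi> _ _ _ dg]) auto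
    qed
    have rep: "representation T (range (blinfun_apply p)) (range (blinfun_apply q)) \<theta>"
      by (rule representation_limit[OF U(1) csub subspace_T triple_T repn \<theta>lim])
    have lin\<psi>: "linear_map T (range (blinfun_apply p)) (range (blinfun_apply q)) \<psi>"
    proof (rule linear_map_limit[OF U(1) csub subspace_T _ \<psi>lim])
      show "eventually (\<lambda>n. linear_map T (range (blinfun_apply p)) (range (blinfun_apply q)) (\<psi>n n)) U"
        unfolding \<psi>n_def[abs_def] p_def q_def
        by (intro always_eventually allI linear_map_transfer[OF lin\<phi> dg])
    qed
    have cc\<psi>: "completely_contractive T \<psi>"
    proof (rule completely_contractive_lim[OF U(1) _ \<psi>lim])
      show "eventually (\<lambda>n. completely_contractive T (\<psi>n n)) U"
        using evE unfolding \<psi>n_def[abs_def]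
        by eventually_elim (intro completely_contractive_compress cc\<phi> norm_partial_isom_le_1 dg; simp)
    qed
    have comp: "q o\<^sub>L A = A" "A o\<^sub>L p = A"
      if "A \<in> Bop (range (blinfun_apply p)) (range (blinfun_apply q))" for A
      using that Bop_range_iff[OF P] by auto
    \<comment> \<open>\<open>p\<close> and \<open>q\<close> act as units on the corner where
      \<open>\<theta>\<close> takes its values, so this pair is reducing at once.\<close>
    have int: "intertwining T \<theta> p q"
      using P comp[OF linear_mapD(1)[OF representation_linear[OF rep]]] by (simp add: intertwining_def)
    obtain B u where B: "finite B" "B \<subseteq> T" "\<And>b. b \<in> B \<Longrightarrow> u b \<in> T"
      "\<And>v. v \<in> H \<Longrightarrow> v = (\<Sum>b\<in>B. blinfun_apply (adj (\<pi> (u b))) (blinfun_apply (\<pi> b) v))"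
      by (rule representation_reconstruction[OF \<pi> nd HK(1,2,3)]) blast
    \<comment> \<open>The identity for \<open>\<pi>\<close>, moved to the model, holds along
      \<open>U\<close> and passes to the limit; it plays the part of nondegeneracy for
      \<open>\<theta>\<close>.\<close>
    have rec: "v = (\<Sum>b\<in>B. blinfun_apply (adj (\<theta> (u b))) (blinfun_apply (\<theta> b) v))"
      if v: "v \<in> range (blinfun_apply p)" for v
    proof -
      have pv: "blinfun_apply p v = v" using v proj_range_iff[OF P(1)] by blast
      have "((\<lambda>n. \<Sum>b\<in>B. blinfun_apply (adj (\<theta>n n (u b))) (blinfun_apply (\<theta>n n b) v))
          \<longlongrightarrow> (\<Sum>b\<in>B. blinfun_apply (adj (\<theta> (u b))) (blinfun_apply (\<theta> b) v))) U"
      proof (intro tendsto_sum blinfun.tendsto tendsto_const)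
        fix b assume b: "b \<in> B"
        then show "((\<lambda>n. \<theta>n n b) \<longlongrightarrow> \<theta> b) U" using B(2) by (intro \<theta>lim) auto
        show "((\<lambda>n. adj (\<theta>n n (u b))) \<longlongrightarrow> adj (\<theta> (u b))) U"
        proof (rule tendsto_adj[OF \<theta>lim[OF B(3)[OF b]]])
          show "eventually (\<lambda>n. clin (\<theta>n n (u b))) U"
            unfolding \<theta>n_def by (intro always_eventually allI clin_compose clin_partial_isom cl\<pi> B(3) b)
          show "clin (\<theta> (u b))"
            by (rule Bop_clin[OF linear_mapD(1)[OF representation_linear[OF rep] B(3)[OF b]]])
        qed
      qed
      moreover have "eventually (\<lambda>n. (\<Sum>b\<in>B. blinfun_apply (adj (\<theta>n n (u b))) (blinfun_apply (\<theta>n n b) v)) = v) U"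
        using ev
      proof eventually_elim
        case (elim n)
        then have E: "orthonormal (e n) M" "orthonormal (f n) N"
          "intertwining T \<pi> (partial_isom (e n) (e n) M) (partial_isom (f n) (f n) N)"
          "range (blinfun_apply (partial_isom (e n) (e n) M)) \<subseteq> H"
          by (auto simp: good_def reducing_system_def)
        define w where "w = blinfun_apply (partial_isom (e n) d M) v"
        have "blinfun_apply (partial_isom (e n) (e n) M) w = w" by (simp add: w_def partial_isom_compose_apply E)
        then have wH: "w \<in> H" using E(4) by (metis rangeI subsetD)
        have "(\<Sum>b\<in>B. blinfun_apply (adj (\<theta>n n (u b))) (blinfun_apply (\<theta>n n b) v))
            = (\<Sum>b\<in>B. blinfun_apply (partial_isom d (e n) M) (blinfun_apply (adj (\<pi> (u b))) (blinfun_apply (\<pi> b) w)))"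
          unfolding \<theta>n_def w_def using B(2,3)
          by (intro sum.cong refl intertwining_transfer_adj[OF \<pi> E(1-3) dg(2)]) auto
        also have "\<dots> = blinfun_apply (partial_isom d (e n) M) w"
          unfolding blinfun.sum_right[symmetric] by (subst B(4)[OF wH, symmetric]) (rule refl)
        also have "\<dots> = v"
          using pv by (simp add: w_def partial_isom_compose_apply E p_def)
        finally show ?case .
      qed
      ultimately have "((\<lambda>n. v) \<longlongrightarrow> (\<Sum>b\<in>B. blinfun_apply (adj (\<theta> (u b))) (blinfun_apply (\<theta> b) v))) U"
        by (rule Lim_transform_eventually)
      then show ?thesis using tendsto_unique[OF U(1) tendsto_const] by blast
    qed
    have eqX: "\<psi> x = \<theta> x" if x: "x \<in> X" for x
    proof -
      have xT: "x \<in> T" using X_T x by blast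
      have "((\<lambda>n. \<psi>n n x - \<theta>n n x) \<longlongrightarrow> 0) U"
      proof (rule Lim_null_comparison)
        show "eventually (\<lambda>n. norm (\<psi>n n x - \<theta>n n x) \<le> norm (\<phi> n (\<pi> x) - \<pi> x)) U"
          using evE
        proof eventually_elim
          case (elim n)
          have le: "norm (partial_isom g (f n) N) \<le> 1" "norm (partial_isom (e n) d M) \<le> 1"
            using elim dg by (auto intro: norm_partial_isom_le_1)
          show ?case
          proof (rule norm_blinfun_bound)
            fix v
            have "blinfun_apply (\<psi>n n x - \<theta>n n x) v
                = blinfun_apply (partial_isom g (f n) N) (blinfun_apply (\<phi> n (\<pi> x) - \<pi> x) (blinfun_apply (partial_isom (e n) d M) v))"
              by (simp add: \<psi>n_def \<theta>n_def blinfun.diff_left blinfun.diff_right)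
            also have "norm \<dots> \<le> norm (blinfun_apply (\<phi> n (\<pi> x) - \<pi> x) (blinfun_apply (partial_isom (e n) d M) v))"
              by (rule norm_le_1_apply[OF le(1)])
            also have "\<dots> \<le> norm (\<phi> n (\<pi> x) - \<pi> x) * norm (blinfun_apply (partial_isom (e n) d M) v)"
              by (rule norm_blinfun)
            also have "\<dots> \<le> norm (\<phi> n (\<pi> x) - \<pi> x) * norm v"
              by (intro mult_left_mono norm_le_1_apply[OF le(2)]) simp
            finally show "norm (blinfun_apply (\<psi>n n x - \<theta>n n x) v) \<le> norm (\<phi> n (\<pi> x) - \<pi> x) * norm v" .
          qed simp
        qed
        show "((\<lambda>n. norm (\<phi> n (\<pi> x) - \<pi> x)) \<longlongrightarrow> 0) U"
          using conv x tendsto_mono[OF Useq] by blast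
      qed
      moreover have "((\<lambda>n. \<psi>n n x - \<theta>n n x) \<longlongrightarrow> \<psi> x - \<theta> x) U"
        by (intro tendsto_diff \<psi>lim \<theta>lim xT)
      ultimately have "\<psi> x - \<theta> x = 0" using tendsto_unique[OF U(1)] by blast
      then show ?thesis by simp
    qed
    have "\<forall>x\<in>T. \<forall>v. blinfun_apply (\<psi> x) (blinfun_apply p v) = blinfun_apply (\<theta> x) (blinfun_apply p v)"
      unfolding p_def
      by (rule extension_unique[OF rep dg int[unfolded p_def q_def] B(1,2,3) rec[unfolded p_def] lin\<psi> cc\<psi> eqX])
    then have "\<psi> t o\<^sub>L p = \<theta> t o\<^sub>L p" using t by (intro blinfun_eqI) simp
    then have eq: "\<psi> t = \<theta> t"
      using comp(2)[OF linear_mapD(1)[OF lin\<psi> t]] comp(2)[OF linear_mapD(1)[OF representation_linear[OF rep] t]]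
      by simp
    have "((\<lambda>n. norm (\<psi>n n t - \<theta>n n t)) \<longlongrightarrow> norm (\<psi> t - \<theta> t)) U"
      by (intro tendsto_norm tendsto_diff \<psi>lim \<theta>lim t)
    \<comment> \<open>The test vector is \<open>s n\<close> moved to the model. Both images of
      \<open>s n\<close> lie in the span of the frame \<open>f n\<close>, where transport is
      isometric, so their difference keeps its norm.\<close>
    moreover have "eventually (\<lambda>n. \<epsilon> / 2 \<le> norm (\<psi>n n t - \<theta>n n t)) U"
      using ev
    proof eventually_elim
      case (elim n)
      then have E: "orthonormal (e n) M" "orthonormal (f n) N"
        "intertwining T \<pi> (partial_isom (e n) (e n) M) (partial_isom (f n) (f n) N)"
        "s n \<in> range (blinfun_apply (partial_isom (e n) (e n) M))"
        "blinfun_apply (\<phi> n (\<pi> t)) (s n) \<in> range (blinfun_apply (partial_isom (f n) (f n) N))"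
        and big: "\<epsilon> / 2 * norm (s n) < norm (blinfun_apply (\<phi> n (\<pi> t) - \<pi> t) (s n))"
        by (auto simp: good_def reducing_system_def)
      have ps: "blinfun_apply (partial_isom (e n) (e n) M) (s n) = s n"
        using E(4) proj_range_iff[OF proj_partial_isom[OF E(1)]] by blast
      define y where "y = blinfun_apply (\<phi> n (\<pi> t) - \<pi> t) (s n)"
      have "blinfun_apply (partial_isom (f n) (f n) N) (blinfun_apply (\<phi> n (\<pi> t)) (s n)) = blinfun_apply (\<phi> n (\<pi> t)) (s n)"
        using E(5) proj_range_iff[OF proj_partial_isom[OF E(2)]] by blast
      then have qy: "blinfun_apply (partial_isom (f n) (f n) N) y = y"
        by (simp add: y_def blinfun.diff_left blinfun.diff_right intertwiningD[OF E(3) t] ps)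
      define w where "w = blinfun_apply (partial_isom d (e n) M) (s n)"
      have nw: "norm w \<le> norm (s n)"
        unfolding w_def by (intro norm_le_1_apply norm_partial_isom_le_1 E dg)
      have "blinfun_apply (\<psi>n n t - \<theta>n n t) w = blinfun_apply (partial_isom g (f n) N) y"
        by (simp add: w_def y_def \<psi>n_def \<theta>n_def blinfun.diff_left blinfun.diff_right partial_isom_compose_apply dg ps)
      then have "norm (blinfun_apply (\<psi>n n t - \<theta>n n t) w) = norm y"
        using norm_partial_isom_apply[OF E(2) dg(2), of y] qy by simp
      then have "norm y \<le> norm (\<psi>n n t - \<theta>n n t) * norm w" by (metis norm_blinfun)
      also have "\<dots> \<le> norm (\<psi>n n t - \<theta>n n t) * norm (s n)" by (intro mult_left_mono nw) simp
      finally have "\<epsilon> / 2 * norm (s n) < norm (\<psi>n n t - \<theta>n n t) * norm (s n)"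
        using big by (simp add: y_def)
      then have "\<epsilon> / 2 < norm (\<psi>n n t - \<theta>n n t)" by (rule mult_right_less_imp_less) simp
      then show ?case by (rule less_imp_le)
    qed
    ultimately have "\<epsilon> / 2 \<le> norm (\<psi> t - \<theta> t)" by (rule tendsto_lowerbound[OF _ _ U(1)])
    then show False using \<epsilon> eq by simp
  qed
qed

end

theorem theorem6p8:
  fixes H\<^sub>0 :: "'a::chilbert_space set" and K\<^sub>0 :: "'b::chilbert_space set"
    and X T :: "('a \<Rightarrow>\<^sub>L 'b) set"
  assumes "hilbert H\<^sub>0" and "hilbert K\<^sub>0"
    and "operator_space H\<^sub>0 K\<^sub>0 X"
    and "T = generated_tro H\<^sub>0 K\<^sub>0 X"
    and "finite_dimensional T"
    and "\<And>(H :: 'c::chilbert_space set) (K :: 'd::chilbert_space set) \<pi>.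
           hilbert H \<Longrightarrow> hilbert K \<Longrightarrow> irreducible_representation T H K \<pi> \<Longrightarrow>
           boundary_representation X T H K \<pi>"
  shows "rectangular_hyperrigid TYPE('c) TYPE('d) X T"
proof -
  interpret boundary_tro H\<^sub>0 K\<^sub>0 X T "TYPE('c)" "TYPE('d)"
    by (rule boundary_tro.intro) (fact assms)+
  show ?thesis by (rule hyperrigid)
qed

end
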